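(* Let $\lambda=(p,0,r;a,1/2;x)\in\mathcal{I}$ be a non-elementary solution to Problem I (so $p,r$ are integers). (1) There exist complex numbers $v_1,\dots,v_r,v_1^*,\dots,v_r^*$ with $$\prod_{i=1}^r(w+v_i)\prod_{i=1}^r(w+v_i^* )=\prod_{i=0}^{p-1}\Big(w+\tfrac{i+a}{p}\Big)\prod_{j=0}^{r-p-1}\Big(w+\tfrac{j-a}{r-p}\Big)\prod_{j=0}^{r-1}\Big(w+\tfrac{j-1/2}{r}\Big)$$ and nonzero constants $C,C'$ such that $$f(w;\lambda)=C\frac{\prod_{i=0}^{r-1}\Gamma(w+\frac ir)}{\prod_{i=1}^r\Gamma(w+v_i)},\qquad f(w;\lambda')=C'\frac{\prod_{i=0}^{r-1}\Gamma(w+\frac ir)}{\prod_{i=1}^r\Gamma(w+v_i')},\quad v_i':=1-\tfrac2r-v_i^*,$$ where $\lambda'$ is the dual of $\lambda$. Moreover $v_1+\dots+v_r=v_1'+\dots+v_r'=(r-1)/2$. (2) The polynomial $\prod_{i=0}^{p-1}(w+\frac{i+a}{p})$ divides $\prod_{i=1}^r(w+v_i)$, so the $v_i$ may be ordered so that $\prod_{i=0}^{p-1}(w+\frac{i+a}{p})=\prod_{i=r-p+1}^r(w+v_i)$. With this ordering, the reciprocal $\check\lambda$ of $\lambda$ is a solution to Problem I with $$f(w;\check\lambda)=\check C\,\frac{\prod_{i=0}^{r-p-1}\Gamma(w+\frac{i}{r-p})}{\prod_{i=1}^{r-p}\Gamma(w+\check v_i)},\qquad \check v_i:=v_i-\frac{1/2-a}{r-p},$$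 for some nonzero constant $\check C$.
   Context: For $\lambda=(p,q,r;a,b;x)\in\mathbb{R}^6$ with $0<x<1$ put $f(w;\lambda):={}_2F_1(pw+a,\,qw+b;\,rw;\,x)$ (Gauss hypergeometric function, meromorphic in $w\in\mathbb{C}$). $\lambda$ is a solution to Problem I if there are $C,d\in\mathbb{C}^\times$, $u_i,v_j\in\mathbb{C}$ with $f(w;\lambda)=C\,d^w\prod_{i=1}^m\Gamma(w+u_i)/\prod_{j=1}^n\Gamma(w+v_j)$ identically in $w$. $\lambda$ is elementary if $f(w;\lambda)$ has finitely many poles in $w$. $\mathcal{I}:=\{(p,0,r;a,b;x)\in\mathbb{R}^6:0<p<r,\ 0<x<1\}$. The dual of $\lambda=(p,0,r;a,1/2;x)$ is $\lambda'=(p,0,r;1-2p/r-a,1/2;x)$. The reciprocal of $\lambda=(p,0,r;a,1/2;x)$ is $\check\lambda=\big(-p,0,r-p;\ \frac{r(1-a)-p/2}{r-p},\ \frac12;\ 1-x\big)$. It is known that non-elementary solutions in $\mathcal{I}$ have $p,r\in\mathbb{Z}$, $p\equiv r\pmod 2$, $b=1/2$. *)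

theory Defs
  imports "HOL-Complex_Analysis.Complex_Analysis" "HOL-Computational_Algebra.Polynomial"
begin

type_synonym param = "real \<times> real \<times> real \<times> real \<times> real \<times> real"
  \<comment> \<open>(p, q, r, a, b, x)\<close>

text \<open>Gauss hypergeometric series 2F1(A,B;C;z) for real 0<z<1 (convergent whenever
  C is not a nonpositive integer).\<close>
definition hyp2F1 :: "complex \<Rightarrow> complex \<Rightarrow> complex \<Rightarrow> real \<Rightarrow> complex" where
  "hyp2F1 A B C z =
     (\<Sum>n. pochhammer A n * pochhammer B n / (pochhammer C n * of_nat (fact n)) * of_real (z ^ n))"

definition fF :: "param \<Rightarrow> complex \<Rightarrow> complex" where
  "fF lam w = (case lam of (p, q, r, a, b, x) \<Rightarrow>
      hyp2F1 (of_real p * w + of_real a) (of_real q * w + of_real b) (of_real r * w) x)"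

text \<open>Points where the series defining f(w) is undefined (rw a nonpositive integer);
  away from them f is holomorphic.\<close>
definition bad_pts :: "param \<Rightarrow> complex set" where
  "bad_pts lam = (case lam of (p, q, r, a, b, x) \<Rightarrow> {w. of_real r * w \<in> \<int>\<^sub>\<le>\<^sub>0})"

text \<open>Problem I: f(w) = C d^w prod Gamma(w+u_i) / prod Gamma(w+v_j) identically.
  Written with the reciprocal Gamma function (entire) after clearing denominators, and
  d^w = exp(w * delta) for a logarithm delta of d (any branch).\<close>
definition solution_I :: "param \<Rightarrow> bool" where
  "solution_I lam \<longleftrightarrow> (\<exists>(C::complex) (\<delta>::complex) (us::complex list) (vs::complex list).
      C \<noteq> 0 \<and>
      (\<forall>w. w \<notin> bad_pts lam \<longrightarrow>
         fF lam w * (\<Prod>u\<leftarrow>us. rGamma (w + u)) = C * exp (w * \<delta>) * (\<Prod>v\<leftarrow>vs. rGamma (w + v))))"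

definition elementary :: "param \<Rightarrow> bool" where
  "elementary lam \<longleftrightarrow> finite {w. is_pole (fF lam) w}"

definition in_I :: "param \<Rightarrow> bool" where
  "in_I lam \<longleftrightarrow> (case lam of (p, q, r, a, b, x) \<Rightarrow> q = 0 \<and> 0 < p \<and> p < r \<and> 0 < x \<and> x < 1)"

definition dual :: "param \<Rightarrow> param" where
  "dual lam = (case lam of (p, q, r, a, b, x) \<Rightarrow> (p, 0, r, 1 - 2 * p / r - a, 1/2, x))"

definition recip :: "param \<Rightarrow> param" where
  "recip lam = (case lam of (p, q, r, a, b, x) \<Rightarrow>
      (-p, 0, r - p, (r * (1 - a) - p / 2) / (r - p), 1/2, 1 - x))"

end

theory Submission
  imports Defs "HOL-Real_Asymp.Real_Asymp" "HOL-Computational_Algebra.Fundamental_Theorem_Algebra"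
begin

text \<open>
  Write \<open>F(w)\<close> for the series regularized by \<open>1 / \<Gamma>(r w)\<close> and \<open>T(w)\<close> for its Euler derivative
  \<open>x d/dx\<close>. Contiguity relations give \<open>F(w) = P(w) F(w + 1) + Q(w) T(w + 1)\<close> with polynomials \<open>P\<close>, \<open>Q\<close>.
  A gamma product formula makes \<open>F(w) / F(w + 1)\<close> rational. If \<open>Q\<close> were nonzero, then \<open>T / F\<close> would be
  rational, but it is bounded at the positive integers and unbounded at the infinitely many poles
  \<open>- k / r\<close> of \<open>f\<close>. So \<open>Q = 0\<close>, and since \<open>f\<close> has a nonzero limit along the real axis, the zeros of
  \<open>P\<close> are the numbers \<open>- v\<^sub>i\<close>.

  The contiguity relations hold for every solution of the hypergeometric equation, up to factors.
  The solution at \<open>0\<close> with exponent \<open>1 - r w\<close> is a multiple of \<open>f(2/r - w)\<close> for the dual parameter, which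
  yields the product formula \<open>P(w) P'(2/r - 1 - w) = \<kappa> \<Prod>\<dots>\<close>. At \<open>w = - (i + a) / p\<close> this solution is a
  terminating series with positive terms, which forces \<open>P(w) = 0\<close>. The solution at \<open>1\<close> is the reciprocal
  series.
\<close>

section \<open>Regularized hypergeometric series\<close>

text \<open>One and the same row (P, Q) of contiguity coefficients governs three solutions: the
  regular one at 0, the second one at 0, and the one at 1 with exponent \<gamma> - \<alpha> - b.
  Euler's transformation gives the last two the common prefactor x^(1 - \<gamma>) (1 - x)^(\<gamma>
  - \<alpha> - b) and the upper parameters 1 - \<alpha>, 1 - b, so that one logarithmic derivative,
  \<open>dual_tau\<close>, occurs in both, and \<open>Q = 0\<close> turns each transport into a
  first-order recurrence.

  The obstacle that fixes the order of the argument is the positivity of the terminating series at w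
  = - (i + a) / p: it requires an upper bound on \<open>a\<close>. At i = 0 and a < 0 positivity is
  automatic and yields a contradiction, so a \<ge> 0; the same conclusion for the dual parameter is
  the bound a \<le> 1 - 2 p / r. Duality therefore precedes divisibility, and \<open>Q = 0\<close>
  for the dual has to come from the transport relation of the original parameter, where the
  independence of F and T is already available.\<close>

definition rhyp_coeff :: "complex \<Rightarrow> complex \<Rightarrow> complex \<Rightarrow> nat \<Rightarrow> complex" where
  "rhyp_coeff a b c n = pochhammer a n * pochhammer b n * rGamma (c + of_nat n) / fact n"

definition rhyp :: "complex \<Rightarrow> complex \<Rightarrow> complex \<Rightarrow> complex \<Rightarrow> complex" where
  "rhyp a b c z = (\<Sum>n. rhyp_coeff a b c n * z ^ n)"

definition rhyp_theta :: "complex \<Rightarrow> complex \<Rightarrow> complex \<Rightarrow> complex \<Rightarrow> complex" where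
  "rhyp_theta a b c z = (\<Sum>n. of_nat n * rhyp_coeff a b c n * z ^ n)"

lemma rhyp_coeff_Suc:
  "(c + of_nat n) * of_nat (Suc n) * rhyp_coeff a b c (Suc n)
     = (a + of_nat n) * (b + of_nat n) * rhyp_coeff a b c n"
proof -
  have "rGamma (c + of_nat n) = (c + of_nat n) * rGamma (c + of_nat (Suc n))"
    using rGamma_plus1[of "c + of_nat n"] by (simp add: add_ac)
  then show ?thesis
    by (simp add: rhyp_coeff_def pochhammer_Suc fact_reduce field_simps del: of_nat_Suc)
qed

text \<open>Uniformity in \<open>a\<close> and \<open>c\<close> is the point: it feeds the M-test
  that makes the series holomorphic in its parameters. Past an index depending only on R, b and
  \<rho> the ratio of consecutive terms is at most 1, so the terms decrease; the finitely many
  earlier ones are bounded by compactness, \<open>rGamma\<close> being continuous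
  everywhere.\<close>

lemma rhyp_coeff_bound_aux:
  fixes R \<rho> :: real
  assumes R: "0 \<le> R" and \<rho>: "0 < \<rho>" "\<rho> < 1"
  shows "\<exists>D. \<forall>a c n. norm a \<le> R \<longrightarrow> norm c \<le> R \<longrightarrow> norm (rhyp_coeff a b c n) * \<rho> ^ n \<le> D"
proof -
  define R' where "R' = max R (norm b)"
  have "eventually (\<lambda>n::nat. (real n + R') * (real n + R') * \<rho> \<le> (real n - R') * (real n + 1) \<and> real n > R') sequentially"
  proof -
    have "((\<lambda>n::nat. (real n + R') * (real n + R') * \<rho> / ((real n - R') * (real n + 1))) \<longlonglongrightarrow> \<rho>)"
      using \<rho>(1) by real_asymp
    then have "eventually (\<lambda>n::nat. (real n + R') * (real n + R') * \<rho> / ((real n - R') * (real n + 1)) < 1) sequentially"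
      using \<rho>(2) by (rule order_tendstoD)
    moreover have "eventually (\<lambda>n::nat. real n > R') sequentially"
      by real_asymp
    ultimately show ?thesis
      by eventually_elim (auto simp: divide_less_eq)
  qed
  then obtain N where N: "\<And>n::nat. n \<ge> N \<Longrightarrow> (real n + R') * (real n + R') * \<rho> \<le> (real n - R') * (real n + 1) \<and> real n > R'"
    by (auto simp: eventually_sequentially)
  have "\<exists>B. \<forall>a c. norm a \<le> R \<longrightarrow> norm c \<le> R \<longrightarrow> norm (rhyp_coeff a b c n) * \<rho> ^ n \<le> B" for n
  proof -
    have "compact ((\<lambda>(a,c). rhyp_coeff a b c n) ` (cball 0 R \<times> cball 0 R))"
      unfolding rhyp_coeff_def split_def pochhammer_prod
      by (intro compact_continuous_image continuous_intros compact_Times compact_cball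
            continuous_on_compose2[OF continuous_on_rGamma]) auto
    then obtain B where "\<forall>y \<in> (\<lambda>(a,c). rhyp_coeff a b c n) ` (cball 0 R \<times> cball 0 R). norm y \<le> B"
      using compact_imp_bounded bounded_iff by metis
    then show ?thesis
      using \<rho> by (intro exI[of _ "B * \<rho> ^ n"]) (force intro!: mult_right_mono)
  qed
  then obtain B where B: "\<And>n a c. norm a \<le> R \<Longrightarrow> norm c \<le> R \<Longrightarrow> norm (rhyp_coeff a b c n) * \<rho> ^ n \<le> B n"
    by metis
  define D where "D = Max (B ` {..N})"
  have D: "norm (rhyp_coeff a b c n) * \<rho> ^ n \<le> D" if "norm a \<le> R" "norm c \<le> R" "n \<le> N" for a c n
  proof -
    have "B n \<le> D" unfolding D_def using that by (intro Max_ge) auto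
    then show ?thesis using B[of a c n] that by auto
  qed
  have "norm (rhyp_coeff a b c n) * \<rho> ^ n \<le> D" if ac: "norm a \<le> R" "norm c \<le> R" and "n \<ge> N" for a c n
    using \<open>n \<ge> N\<close>
  proof (induction n rule: dec_induct)
    case base
    then show ?case using D ac by simp
  next
    case (step n)
    have n: "(real n + R') * (real n + R') * \<rho> \<le> (real n - R') * (real n + 1)" "real n > R'"
      using N step by auto
    have c: "real n - R' \<le> norm (c + of_nat n)"
      using norm_triangle_ineq2[of "of_nat n" "-c"] ac by (simp add: R'_def add.commute)
    have cp: "norm (c + of_nat n) * real (Suc n) > 0"
      using c n by (intro mult_pos_pos) auto
    have a: "norm (a + of_nat n) \<le> real n + R'"
      using norm_triangle_ineq[of a "of_nat n"] ac by (simp add: R'_def)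
    have b: "norm (b + of_nat n) \<le> real n + R'"
      using norm_triangle_ineq[of b "of_nat n"] by (simp add: R'_def)
    have R'0: "R' \<ge> 0" using R by (simp add: R'_def)
    have "norm (c + of_nat n) * real (Suc n) * (norm (rhyp_coeff a b c (Suc n)) * \<rho> ^ Suc n)
        = norm (a + of_nat n) * norm (b + of_nat n) * \<rho> * (norm (rhyp_coeff a b c n) * \<rho> ^ n)"
      using arg_cong[OF rhyp_coeff_Suc[of c n a b], of norm] by (simp add: norm_mult del: of_nat_Suc)
    also have "\<dots> \<le> (norm (c + of_nat n) * real (Suc n)) * (norm (rhyp_coeff a b c n) * \<rho> ^ n)"
    proof (rule mult_right_mono)
      have "norm (a + of_nat n) * norm (b + of_nat n) * \<rho> \<le> (real n + R') * (real n + R') * \<rho>"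
        using a b \<rho> R'0 by (intro mult_right_mono mult_mono) auto
      also have "\<dots> \<le> (real n - R') * (real n + 1)" using n by simp
      also have "\<dots> \<le> norm (c + of_nat n) * real (Suc n)"
        using mult_right_mono[OF c, of "real n + 1"] by (simp add: add.commute)
      finally show "norm (a + of_nat n) * norm (b + of_nat n) * \<rho> \<le> norm (c + of_nat n) * real (Suc n)" .
    qed (use \<rho> in auto)
    finally have "norm (rhyp_coeff a b c (Suc n)) * \<rho> ^ Suc n \<le> norm (rhyp_coeff a b c n) * \<rho> ^ n"
      using cp by (rule mult_left_le_imp_le)
    then show ?case using step by linarith
  qed
  with D show ?thesis by (metis nle_le)
qed

text \<open>A radius \<rho> between |z| and 1 turns bounded coefficients into a geometric majorant
  in q = |z| / \<rho>; the additional \<open>n q^n\<close> covers the Euler derivative.\<close>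

lemma rhyp_coeff_bound:
  fixes R :: real
  assumes "norm z < 1"
  shows "\<exists>M. summable M \<and> (\<forall>a c n. norm a \<le> R \<longrightarrow> norm c \<le> R \<longrightarrow>
           norm (rhyp_coeff a b c n * z ^ n) \<le> M n \<and> norm (of_nat n * rhyp_coeff a b c n * z ^ n) \<le> M n)"
proof -
  define \<rho> where "\<rho> = (1 + norm z) / 2"
  have \<rho>: "0 < \<rho>" "\<rho> < 1" "norm z < \<rho>"
    using assms norm_ge_zero[of z] by (auto simp: \<rho>_def simp del: norm_ge_zero)
  obtain D where D: "\<And>a c n. norm a \<le> max R 0 \<Longrightarrow> norm c \<le> max R 0 \<Longrightarrow> norm (rhyp_coeff a b c n) * \<rho> ^ n \<le> D"
    using rhyp_coeff_bound_aux[of "max R 0" \<rho> b] \<rho> by auto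
  define q where "q = norm z / \<rho>"
  have q: "0 \<le> q" "q < 1" using \<rho> by (auto simp: q_def field_simps)
  have "D \<ge> 0" using D[of 0 0 0] by (auto intro: order_trans[rotated])
  define M where "M n = D * (real n * q ^ n) + D * q ^ n" for n
  have "summable (\<lambda>n. real n * q ^ n)"
  proof (rule summable_comparison_test')
    show "summable (\<lambda>n. of_nat (Suc n) * q ^ n)"
      using geometric_deriv_sums[of q] q by (auto simp: sums_iff)
    show "norm (real n * q ^ n) \<le> of_nat (Suc n) * q ^ n" for n
      using q by (auto simp: abs_mult intro!: mult_right_mono)
  qed
  then have "summable M"
    unfolding M_def using q by (intro summable_add summable_mult summable_geometric) auto
  moreover have bound: "norm (rhyp_coeff a b c n * z ^ n) \<le> D * q ^ n"
    if "norm a \<le> R" "norm c \<le> R" for a c n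
  proof -
    have "norm (rhyp_coeff a b c n * z ^ n) = norm (rhyp_coeff a b c n) * \<rho> ^ n * q ^ n"
      using \<rho> by (simp add: q_def norm_mult norm_power power_divide)
    also have "\<dots> \<le> D * q ^ n"
      using D[of a c n] that q by (intro mult_right_mono) auto
    finally show ?thesis .
  qed
  moreover have "norm (of_nat n * rhyp_coeff a b c n * z ^ n) \<le> D * (real n * q ^ n)"
    if "norm a \<le> R" "norm c \<le> R" for a c n
  proof -
    have "norm (of_nat n * rhyp_coeff a b c n * z ^ n) = real n * norm (rhyp_coeff a b c n * z ^ n)"
      by (simp add: norm_mult)
    also have "\<dots> \<le> real n * (D * q ^ n)"
      using bound[OF that] by (intro mult_left_mono) auto
    finally show ?thesis by (simp add: mult_ac)
  qed
  moreover have "0 \<le> D * q ^ n" "0 \<le> D * (real n * q ^ n)" for n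
    using \<open>D \<ge> 0\<close> q by auto
  ultimately show ?thesis
    by (intro exI[of _ M] conjI allI impI) (auto simp: M_def add_increasing add_increasing2)
qed

lemma rhyp_sums:
  assumes "norm z < 1"
  shows "(\<lambda>n. rhyp_coeff a b c n * z ^ n) sums rhyp a b c z"
    and "(\<lambda>n. of_nat n * rhyp_coeff a b c n * z ^ n) sums rhyp_theta a b c z"
proof -
  obtain M where M: "summable M" "\<And>n. norm (rhyp_coeff a b c n * z ^ n) \<le> M n"
       "\<And>n. norm (of_nat n * rhyp_coeff a b c n * z ^ n) \<le> M n"
    using rhyp_coeff_bound[OF assms, of "max (norm a) (norm c)" b] by (metis max.cobounded1 max.cobounded2)
  show "(\<lambda>n. rhyp_coeff a b c n * z ^ n) sums rhyp a b c z"
    unfolding rhyp_def by (intro summable_sums summable_comparison_test'[OF M(1), of 0] M(2))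
  show "(\<lambda>n. of_nat n * rhyp_coeff a b c n * z ^ n) sums rhyp_theta a b c z"
    unfolding rhyp_theta_def by (intro summable_sums summable_comparison_test'[OF M(1), of 0] M(3))
qed

lemma holomorphic_rhyp:
  fixes A C :: "complex \<Rightarrow> complex"
  assumes z: "norm z < 1" and A: "A holomorphic_on UNIV" and C: "C holomorphic_on UNIV"
  shows "(\<lambda>w. rhyp (A w) b (C w) z) holomorphic_on UNIV"
    and "(\<lambda>w. rhyp_theta (A w) b (C w) z) holomorphic_on UNIV"
proof -
  have bd: "\<exists>R. \<forall>w\<in>cball w0 1. norm (A w) \<le> R \<and> norm (C w) \<le> R" for w0
  proof -
    have "compact ((\<lambda>w. (A w, C w)) ` cball w0 1)"
      using A C by (intro compact_continuous_image continuous_on_Pair holomorphic_on_imp_continuous_on)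
        (auto intro: holomorphic_on_subset)
    then obtain R where "\<forall>y\<in>(\<lambda>w. (A w, C w)) ` cball w0 1. norm y \<le> R"
      using compact_imp_bounded bounded_iff by metis
    then have "\<forall>w\<in>cball w0 1. norm (A w, C w) \<le> R" by blast
    then show ?thesis
      by (meson norm_fst_le norm_snd_le order_trans fst_conv snd_conv)
  qed
  have hol: "(\<lambda>w. \<Sum>n<k. h n * rhyp_coeff (A w) b (C w) n * z ^ n) holomorphic_on UNIV" for h k
    unfolding rhyp_coeff_def pochhammer_prod by (intro holomorphic_intros A C) auto
  \<comment> \<open>The weight \<open>h\<close> treats both series at once: the constant 1 gives
    \<open>rhyp\<close>, \<open>of_nat\<close> gives \<open>rhyp_theta\<close>.\<close>
  have lim: "\<exists>d>0. cball w0 d \<subseteq> UNIV \<and>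
       uniform_limit (cball w0 d) (\<lambda>k w. \<Sum>n<k. h n * rhyp_coeff (A w) b (C w) n * z ^ n)
         (\<lambda>w. \<Sum>n. h n * rhyp_coeff (A w) b (C w) n * z ^ n) sequentially"
    if h: "h = (\<lambda>_. 1) \<or> h = of_nat" for h w0
  proof -
    obtain R where R: "\<And>w. w \<in> cball w0 1 \<Longrightarrow> norm (A w) \<le> R \<and> norm (C w) \<le> R" using bd by blast
    obtain M where M: "summable M" "\<And>a c n. norm a \<le> R \<Longrightarrow> norm c \<le> R \<Longrightarrow>
           norm (rhyp_coeff a b c n * z ^ n) \<le> M n \<and> norm (of_nat n * rhyp_coeff a b c n * z ^ n) \<le> M n"
      using rhyp_coeff_bound[OF z, of R b] by blast
    have "uniform_limit (cball w0 1) (\<lambda>k w. \<Sum>n<k. h n * rhyp_coeff (A w) b (C w) n * z ^ n)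
         (\<lambda>w. \<Sum>n. h n * rhyp_coeff (A w) b (C w) n * z ^ n) sequentially"
      using h M R by (intro Weierstrass_m_test[where M = M]) auto
    then show ?thesis by (intro exI[of _ 1]) auto
  qed
  show "(\<lambda>w. rhyp (A w) b (C w) z) holomorphic_on UNIV"
    using holomorphic_uniform_sequence[OF open_UNIV hol lim[of "\<lambda>_. 1"]]
    by (simp add: rhyp_def)
  show "(\<lambda>w. rhyp_theta (A w) b (C w) z) holomorphic_on UNIV"
    using holomorphic_uniform_sequence[OF open_UNIV hol lim[of of_nat]]
    by (simp add: rhyp_theta_def)
qed

lemma rhyp_eq_hyp2F1:
  assumes "c \<notin> \<int>\<^sub>\<le>\<^sub>0" "0 < x" "x < 1"
  shows "rhyp a b c (of_real x) = rGamma c * hyp2F1 a b c x"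
proof -
  have eq: "rhyp_coeff a b c n * of_real x ^ n = rGamma c *
        (pochhammer a n * pochhammer b n / (pochhammer c n * of_nat (fact n)) * of_real (x ^ n))" for n
  proof -
    have "pochhammer c n \<noteq> 0"
      using assms(1) by (auto simp: pochhammer_eq_0_iff)
    then show ?thesis
      using pochhammer_rGamma[of c n] by (simp add: rhyp_coeff_def field_simps)
  qed
  have "(\<lambda>n. rGamma c * (pochhammer a n * pochhammer b n / (pochhammer c n * of_nat (fact n)) * of_real (x ^ n)))
     sums rhyp a b c (of_real x)"
    unfolding eq[symmetric] using assms by (intro rhyp_sums) auto
  moreover have "rGamma c \<noteq> 0"
    using assms(1) by (simp add: rGamma_eq_zero_iff)
  ultimately have "(\<lambda>n. pochhammer a n * pochhammer b n / (pochhammer c n * of_nat (fact n)) * of_real (x ^ n))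
     sums (rhyp a b c (of_real x) / rGamma c)"
    using sums_divide[where c = "rGamma c"] by fastforce
  then show ?thesis
    using \<open>rGamma c \<noteq> 0\<close> unfolding hyp2F1_def by (simp add: sums_iff)
qed

section \<open>Contiguity relations\<close>

lemma power_series_shift:
  fixes f g h :: "nat \<Rightarrow> complex"
  assumes "(\<lambda>n. f n * z ^ n) sums F" "(\<lambda>n. g n * z ^ n) sums G" "(\<lambda>n. h n * z ^ n) sums H"
    and "h 0 = f 0" "\<And>n. h (Suc n) = f (Suc n) + g n"
  shows "H = F + z * G"
proof -
  have "(\<lambda>n. z * (g n * z ^ n)) sums (z * G)"
    by (intro sums_mult assms)
  moreover have "(\<lambda>n. f (Suc n) * z ^ Suc n) sums (F - f 0)"
    using assms(1) by (subst sums_Suc_iff) simp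
  ultimately have "(\<lambda>n. f (Suc n) * z ^ Suc n + z * (g n * z ^ n)) sums (F - f 0 + z * G)"
    by (rule sums_add[rotated])
  also have "(\<lambda>n. f (Suc n) * z ^ Suc n + z * (g n * z ^ n)) = (\<lambda>n. h (Suc n) * z ^ Suc n)"
    by (auto simp: assms algebra_simps)
  finally have "(\<lambda>n. h n * z ^ n) sums (F + z * G)"
    using assms(4) by (subst (asm) sums_Suc_iff) simp
  then show ?thesis
    using assms(3) sums_unique2 by blast
qed

text \<open>With \<theta> = z d/dz, which multiplies the n-th coefficient by n, this reads F(c) = (c
  + \<theta>) F(c + 1). The next two lemmas read a F(a + 1) = (a + \<theta>) F(a) and \<theta> F(c)
  = z (a + \<theta>) (b + \<theta>) F(c + 1). They are the main source of the relations
  below.\<close>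

lemma rhyp_coeff_c_plus1: "rhyp_coeff a b c n = (c + of_nat n) * rhyp_coeff a b (c + 1) n"
  using rGamma_plus1[of "c + of_nat n"] by (simp add: rhyp_coeff_def add_ac)

lemma rhyp_coeff_a_plus1: "a * rhyp_coeff (a + 1) b c n = (a + of_nat n) * rhyp_coeff a b c n"
proof -
  have "a * pochhammer (a + 1) n = (a + of_nat n) * pochhammer a n"
    using pochhammer_rec[of a n] by (simp add: pochhammer_Suc mult.commute)
  then show ?thesis
    unfolding rhyp_coeff_def times_divide_eq_right mult.assoc[symmetric] by simp
qed

lemma rhyp_coeff_Suc_c_plus1:
  "of_nat (Suc n) * rhyp_coeff a b c (Suc n) = (a + of_nat n) * (b + of_nat n) * rhyp_coeff a b (c + 1) n"
  by (simp add: rhyp_coeff_def pochhammer_Suc fact_reduce field_simps del: of_nat_Suc)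
     (simp add: algebra_simps)

context
  fixes z :: complex
  assumes z: "norm z < 1"
begin

lemma rhyp_contig_c:
  "rhyp a b c z = c * rhyp a b (c + 1) z + rhyp_theta a b (c + 1) z"
proof -
  have "(\<lambda>n. (c + of_nat n) * rhyp_coeff a b (c + 1) n * z ^ n) sums
          (c * rhyp a b (c + 1) z + rhyp_theta a b (c + 1) z)"
    using sums_add[OF sums_mult[OF rhyp_sums(1)[OF z], of c a b "c + 1"] rhyp_sums(2)[OF z, of a b "c + 1"]]
    by (simp add: algebra_simps)
  then show ?thesis
    using rhyp_sums(1)[OF z, of a b c] sums_unique2 unfolding rhyp_coeff_c_plus1[of a b c] by blast
qed

lemma rhyp_theta_contig_c:
  "(1 - z) * rhyp_theta a b c z = z * (a * b * rhyp a b (c + 1) z + (a + b - c) * rhyp_theta a b (c + 1) z)"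
proof -
  \<comment> \<open>The n^2 hidden in (a + n) (b + n) is removed by n times
    \<open>rhyp_coeff_c_plus1\<close>. This puts \<theta> F(c) on the right as well, whence the
    factor 1 - z.\<close>
  have "(\<lambda>n. (of_nat n * rhyp_coeff a b c n + a * b * rhyp_coeff a b (c + 1) n
           + (a + b - c) * (of_nat n * rhyp_coeff a b (c + 1) n)) * z ^ n) sums
          (rhyp_theta a b c z + a * b * rhyp a b (c + 1) z + (a + b - c) * rhyp_theta a b (c + 1) z)"
    using sums_add[OF sums_add[OF rhyp_sums(2)[OF z, of a b c] sums_mult[OF rhyp_sums(1)[OF z], of "a*b" a b "c+1"]]
            sums_mult[OF rhyp_sums(2)[OF z], of "a+b-c" a b "c+1"]]
    by (simp add: algebra_simps)
  from power_series_shift[OF _ this rhyp_sums(2)[OF z, of a b c], of "\<lambda>_. 0" 0]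
  have "rhyp_theta a b c z = z * (rhyp_theta a b c z + a * b * rhyp a b (c + 1) z + (a + b - c) * rhyp_theta a b (c + 1) z)"
    unfolding rhyp_coeff_Suc_c_plus1 by (simp add: rhyp_coeff_c_plus1[of a b c] algebra_simps)
  then show ?thesis by (simp add: algebra_simps)
qed

lemma rhyp_contig_ac:
  "rhyp a b c z = (c - b * z) * rhyp (a + 1) b (c + 1) z + (1 - z) * rhyp_theta (a + 1) b (c + 1) z"
proof -
  let ?t = "rhyp_coeff (a + 1) b (c + 1)"
  have 1: "(\<lambda>n. (c + of_nat n) * ?t n * z ^ n) sums
          (c * rhyp (a + 1) b (c + 1) z + rhyp_theta (a + 1) b (c + 1) z)"
    using sums_add[OF sums_mult[OF rhyp_sums(1)[OF z], of c "a + 1" b "c + 1"] rhyp_sums(2)[OF z, of "a + 1" b "c + 1"]]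
    by (simp add: algebra_simps)
  have 2: "(\<lambda>n. - (b + of_nat n) * ?t n * z ^ n) sums
          (- b * rhyp (a + 1) b (c + 1) z - rhyp_theta (a + 1) b (c + 1) z)"
    using sums_diff[OF sums_mult[OF rhyp_sums(1)[OF z], of "-b" "a + 1" b "c + 1"] rhyp_sums(2)[OF z, of "a + 1" b "c + 1"]]
    by (simp add: algebra_simps)
  have "rhyp_coeff a b c (Suc n) = (c + of_nat (Suc n)) * ?t (Suc n) + - (b + of_nat n) * ?t n" for n
  proof -
    have "(c + of_nat (Suc n)) * ?t (Suc n) = rhyp_coeff (a + 1) b c (Suc n)"
      by (simp add: rhyp_coeff_c_plus1[of "a + 1" b c])
    moreover have "of_nat (Suc n) * (rhyp_coeff (a + 1) b c (Suc n) - (b + of_nat n) * ?t n) = of_nat (Suc n) * rhyp_coeff a b c (Suc n)"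
      using rhyp_coeff_Suc_c_plus1[of n "a + 1" b c] rhyp_coeff_Suc_c_plus1[of n a b c] rhyp_coeff_a_plus1[of a b "c + 1" n]
      unfolding of_nat_Suc by algebra
    ultimately show ?thesis
      by (metis add_uminus_conv_diff mult_minus_left mult_left_cancel of_nat_neq_0)
  qed
  from power_series_shift[OF 1 2 rhyp_sums(1)[OF z, of a b c] _ this]
  have "rhyp a b c z = c * rhyp (a + 1) b (c + 1) z + rhyp_theta (a + 1) b (c + 1) z +
     z * (- b * rhyp (a + 1) b (c + 1) z - rhyp_theta (a + 1) b (c + 1) z)"
    by (simp add: rhyp_coeff_def rGamma_plus1)
  then show ?thesis by (simp add: algebra_simps)
qed

lemma rhyp_theta_contig_ac:
  "rhyp_theta a b c z = a * b * z * rhyp (a + 1) b (c + 1) z + a * z * rhyp_theta (a + 1) b (c + 1) z"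
proof -
  have 2: "(\<lambda>n. (b + of_nat n) * (a * rhyp_coeff (a + 1) b (c + 1) n) * z ^ n) sums
          (a * b * rhyp (a + 1) b (c + 1) z + a * rhyp_theta (a + 1) b (c + 1) z)"
    using sums_add[OF sums_mult[OF rhyp_sums(1)[OF z], of "a*b" "a + 1" b "c + 1"]
       sums_mult[OF rhyp_sums(2)[OF z], of a "a + 1" b "c + 1"]]
    by (simp add: algebra_simps)
  from power_series_shift[OF _ 2 rhyp_sums(2)[OF z, of a b c], of "\<lambda>_. 0" 0]
  show ?thesis
    unfolding rhyp_coeff_Suc_c_plus1 rhyp_coeff_a_plus1 by (simp add: algebra_simps)
qed

text \<open>Serves the solution at 1: raising \<alpha> and \<gamma> together leaves its lower
  parameter \<gamma> - \<alpha> - b + 1 fixed and moves only the upper parameter 1 -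
  \<alpha>.\<close>

lemma rhyp_contig_a: "a * rhyp (a + 1) b c z = a * rhyp a b c z + rhyp_theta a b c z"
proof -
  have "(\<lambda>n. a * rhyp_coeff (a + 1) b c n * z ^ n) sums (a * rhyp a b c z + rhyp_theta a b c z)"
    using sums_add[OF sums_mult[OF rhyp_sums(1)[OF z], of a a b c] rhyp_sums(2)[OF z, of a b c]]
    unfolding rhyp_coeff_a_plus1 by (simp add: algebra_simps)
  then show ?thesis
    using sums_mult[OF rhyp_sums(1)[OF z, of "a + 1" b c], of a] sums_unique2 by (simp add: mult.assoc)
qed

lemma rhyp_theta_contig_a:
  "(1 - z) * (a * rhyp_theta (a + 1) b c z) = a * b * z * rhyp a b c z + (a + 1 - c + b * z) * rhyp_theta a b c z"
proof -
  have 1: "(\<lambda>n. (a + 1 - c) * of_nat n * rhyp_coeff a b c n * z ^ n) sums ((a + 1 - c) * rhyp_theta a b c z)"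
    using sums_mult[OF rhyp_sums(2)[OF z, of a b c], of "a + 1 - c"] by (simp add: algebra_simps)
  have 2: "(\<lambda>n. (of_nat n * (a * rhyp_coeff (a + 1) b c n) + (a * b + b * of_nat n) * rhyp_coeff a b c n) * z ^ n) sums
          (a * rhyp_theta (a + 1) b c z + a * b * rhyp a b c z + b * rhyp_theta a b c z)"
    using sums_add[OF sums_add[OF sums_mult[OF rhyp_sums(2)[OF z], of a "a + 1" b c] sums_mult[OF rhyp_sums(1)[OF z], of "a*b" a b c]]
       sums_mult[OF rhyp_sums(2)[OF z], of b a b c]]
    by (simp add: algebra_simps)
  have 3: "(\<lambda>n. of_nat n * (a * rhyp_coeff (a + 1) b c n) * z ^ n) sums (a * rhyp_theta (a + 1) b c z)"
    using sums_mult[OF rhyp_sums(2)[OF z, of "a + 1" b c], of a] by (simp add: algebra_simps)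
  have "of_nat (Suc n) * (a * rhyp_coeff (a + 1) b c (Suc n)) = (a + 1 - c) * of_nat (Suc n) * rhyp_coeff a b c (Suc n) +
     (of_nat n * (a * rhyp_coeff (a + 1) b c n) + (a * b + b * of_nat n) * rhyp_coeff a b c n)" for n
    unfolding rhyp_coeff_a_plus1 using rhyp_coeff_Suc[of c n a b] by (simp add: algebra_simps)
  from power_series_shift[OF 1 2 3 _ this]
  have "a * rhyp_theta (a + 1) b c z = (a + 1 - c) * rhyp_theta a b c z +
     z * (a * rhyp_theta (a + 1) b c z + a * b * rhyp a b c z + b * rhyp_theta a b c z)"
    by simp
  then show ?thesis by (simp add: algebra_simps)
qed

end

section \<open>Products of contiguity matrices and the solutions they transport\<close>

definition contig_step_ac :: "complex \<Rightarrow> complex \<Rightarrow> complex \<Rightarrow> complex \<Rightarrow> complex \<times> complex \<Rightarrow> complex \<times> complex" where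
  "contig_step_ac b x \<alpha> \<gamma> PQ = (fst PQ * (\<gamma> - b * x) + snd PQ * (\<alpha> * b * x), fst PQ * (1 - x) + snd PQ * (\<alpha> * x))"

definition contig_step_c :: "complex \<Rightarrow> complex \<Rightarrow> complex \<Rightarrow> complex \<Rightarrow> complex \<times> complex \<Rightarrow> complex \<times> complex" where
  "contig_step_c b x \<alpha> \<gamma> PQ = (fst PQ * \<gamma> + snd PQ * (x / (1 - x) * (\<alpha> * b)), fst PQ + snd PQ * (x / (1 - x) * (\<alpha> + b - \<gamma>)))"

primrec contig_row_ac :: "complex \<Rightarrow> complex \<Rightarrow> complex \<Rightarrow> complex \<Rightarrow> nat \<Rightarrow> complex \<times> complex" where
  "contig_row_ac b x \<alpha> \<gamma> 0 = (1, 0)"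
| "contig_row_ac b x \<alpha> \<gamma> (Suc i) = contig_step_ac b x (\<alpha> + of_nat i) (\<gamma> + of_nat i) (contig_row_ac b x \<alpha> \<gamma> i)"

text \<open>After p joint steps and r - p steps in \<gamma> alone, (p w + a, r w) has become (p (w +
  1) + a, r (w + 1)). Only the first row of the matrix product is kept, the one that expresses the
  solution itself; the start (1, 0) selects it.\<close>

primrec contig_row :: "complex \<Rightarrow> complex \<Rightarrow> complex \<Rightarrow> complex \<Rightarrow> nat \<Rightarrow> nat \<Rightarrow> complex \<times> complex" where
  "contig_row b x \<alpha> \<gamma> p 0 = contig_row_ac b x \<alpha> \<gamma> p"
| "contig_row b x \<alpha> \<gamma> p (Suc j) = contig_step_c b x (\<alpha> + of_nat p) (\<gamma> + of_nat p + of_nat j) (contig_row b x \<alpha> \<gamma> p j)"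

text \<open>The contiguity matrices act on the whole two-dimensional solution space, so each
  solution is carried to a multiple of its neighbour in any chosen normalization. The scalars
  \<open>ka\<close> and \<open>kc\<close>, common to y and its Euler derivative t, record these
  multiples and let one row serve all solutions.\<close>

lemma contig_row_transport:
  fixes y t ka kc :: "complex \<Rightarrow> complex \<Rightarrow> complex"
  assumes a1: "\<And>\<alpha> \<gamma>. (\<gamma> - b * x) * y (\<alpha> + 1) (\<gamma> + 1) + (1 - x) * t (\<alpha> + 1) (\<gamma> + 1) = ka \<alpha> \<gamma> * y \<alpha> \<gamma>"
    and a2: "\<And>\<alpha> \<gamma>. \<alpha> * b * x * y (\<alpha> + 1) (\<gamma> + 1) + \<alpha> * x * t (\<alpha> + 1) (\<gamma> + 1) = ka \<alpha> \<gamma> * t \<alpha> \<gamma>"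
    and c1: "\<And>\<alpha> \<gamma>. \<gamma> * y \<alpha> (\<gamma> + 1) + t \<alpha> (\<gamma> + 1) = kc \<alpha> \<gamma> * y \<alpha> \<gamma>"
    and c2: "\<And>\<alpha> \<gamma>. x / (1 - x) * (\<alpha> * b * y \<alpha> (\<gamma> + 1) + (\<alpha> + b - \<gamma>) * t \<alpha> (\<gamma> + 1)) = kc \<alpha> \<gamma> * t \<alpha> \<gamma>"
  shows "fst (contig_row b x \<alpha> \<gamma> p q) * y (\<alpha> + of_nat p) (\<gamma> + of_nat p + of_nat q) +
         snd (contig_row b x \<alpha> \<gamma> p q) * t (\<alpha> + of_nat p) (\<gamma> + of_nat p + of_nat q) =
         (\<Prod>i<p. ka (\<alpha> + of_nat i) (\<gamma> + of_nat i)) * (\<Prod>j<q. kc (\<alpha> + of_nat p) (\<gamma> + of_nat p + of_nat j)) * y \<alpha> \<gamma>"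
proof -
  have *: "fst (contig_row_ac b x \<alpha> \<gamma> p) * y (\<alpha> + of_nat p) (\<gamma> + of_nat p) +
         snd (contig_row_ac b x \<alpha> \<gamma> p) * t (\<alpha> + of_nat p) (\<gamma> + of_nat p) =
         (\<Prod>i<p. ka (\<alpha> + of_nat i) (\<gamma> + of_nat i)) * y \<alpha> \<gamma>"
  proof (induction p)
    case (Suc p)
    let ?a = "\<alpha> + of_nat p" and ?g = "\<gamma> + of_nat p"
    let ?P = "fst (contig_row_ac b x \<alpha> \<gamma> p)" and ?Q = "snd (contig_row_ac b x \<alpha> \<gamma> p)"
    have "fst (contig_row_ac b x \<alpha> \<gamma> (Suc p)) * y (?a + 1) (?g + 1) + snd (contig_row_ac b x \<alpha> \<gamma> (Suc p)) * t (?a + 1) (?g + 1)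
       = ?P * ((?g - b * x) * y (?a + 1) (?g + 1) + (1 - x) * t (?a + 1) (?g + 1))
       + ?Q * (?a * b * x * y (?a + 1) (?g + 1) + ?a * x * t (?a + 1) (?g + 1))"
      by (simp add: contig_step_ac_def algebra_simps)
    also have "\<dots> = ka ?a ?g * (?P * y ?a ?g + ?Q * t ?a ?g)"
      unfolding a1 a2 by (simp add: algebra_simps)
    finally show ?case
      unfolding Suc by (simp add: algebra_simps)
  qed auto
  show ?thesis
  proof (induction q)
    case 0
    then show ?case using * by simp
  next
    case (Suc q)
    let ?a = "\<alpha> + of_nat p" and ?g = "\<gamma> + of_nat p + of_nat q"
    let ?P = "fst (contig_row b x \<alpha> \<gamma> p q)" and ?Q = "snd (contig_row b x \<alpha> \<gamma> p q)"
    define k where "k = x / (1 - x)"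
    have "fst (contig_row b x \<alpha> \<gamma> p (Suc q)) * y ?a (?g + 1) + snd (contig_row b x \<alpha> \<gamma> p (Suc q)) * t ?a (?g + 1)
       = ?P * (?g * y ?a (?g + 1) + t ?a (?g + 1))
       + ?Q * (x / (1 - x) * (?a * b * y ?a (?g + 1) + (?a + b - ?g) * t ?a (?g + 1)))"
      unfolding k_def[symmetric] by (simp add: contig_step_c_def k_def[symmetric]) (simp add: algebra_simps)
    also have "\<dots> = kc ?a ?g * (?P * y ?a ?g + ?Q * t ?a ?g)"
      unfolding c1 c2 by (simp add: algebra_simps)
    finally show ?case
      unfolding Suc by (simp add: algebra_simps)
  qed
qed

lemma contig_row_rhyp:
  assumes "norm x < 1"
  shows "fst (contig_row b x \<alpha> \<gamma> p q) * rhyp (\<alpha> + of_nat p) b (\<gamma> + of_nat p + of_nat q) x +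
         snd (contig_row b x \<alpha> \<gamma> p q) * rhyp_theta (\<alpha> + of_nat p) b (\<gamma> + of_nat p + of_nat q) x = rhyp \<alpha> b \<gamma> x"
proof -
  have "1 - x \<noteq> 0" using assms by auto
  then have c: "x / (1 - x) * (\<alpha> * b * rhyp \<alpha> b (\<gamma> + 1) x + (\<alpha> + b - \<gamma>) * rhyp_theta \<alpha> b (\<gamma> + 1) x) = 1 * rhyp_theta \<alpha> b \<gamma> x"
    for \<alpha> \<gamma>
    using rhyp_theta_contig_c[OF assms, of \<alpha> b \<gamma>] by (simp add: divide_eq_eq mult.commute)
  have "fst (contig_row b x \<alpha> \<gamma> p q) * rhyp (\<alpha> + of_nat p) b (\<gamma> + of_nat p + of_nat q) x +
         snd (contig_row b x \<alpha> \<gamma> p q) * rhyp_theta (\<alpha> + of_nat p) b (\<gamma> + of_nat p + of_nat q) x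
       = (\<Prod>i<p. 1) * (\<Prod>j<q. 1) * rhyp \<alpha> b \<gamma> x"
  proof (rule contig_row_transport)
    fix \<alpha> \<gamma>
    show "(\<gamma> - b * x) * rhyp (\<alpha> + 1) b (\<gamma> + 1) x + (1 - x) * rhyp_theta (\<alpha> + 1) b (\<gamma> + 1) x = 1 * rhyp \<alpha> b \<gamma> x"
      using rhyp_contig_ac[OF assms, of \<alpha> b \<gamma>] by simp
    show "\<alpha> * b * x * rhyp (\<alpha> + 1) b (\<gamma> + 1) x + \<alpha> * x * rhyp_theta (\<alpha> + 1) b (\<gamma> + 1) x = 1 * rhyp_theta \<alpha> b \<gamma> x"
      using rhyp_theta_contig_ac[OF assms, of \<alpha> b \<gamma>] by simp
    show "\<gamma> * rhyp \<alpha> b (\<gamma> + 1) x + rhyp_theta \<alpha> b (\<gamma> + 1) x = 1 * rhyp \<alpha> b \<gamma> x"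
      using rhyp_contig_c[OF assms, of \<alpha> b \<gamma>] by simp
  qed (rule c)
  then show ?thesis by simp
qed

text \<open>The logarithmic Euler derivative of x^(1 - \<gamma>) (1 - x)^(\<gamma> - \<alpha> - b),
  the prefactor shared by the second solution at 0 and the solution at 1. The prefactor itself is
  dropped; its change in each step is absorbed in the transport factors.\<close>

definition dual_tau :: "complex \<Rightarrow> complex \<Rightarrow> complex \<Rightarrow> complex \<Rightarrow> complex" where
  "dual_tau b x \<alpha> \<gamma> = (1 - \<gamma>) - (\<gamma> - \<alpha> - b) * (x / (1 - x))"

text \<open>The second solution at 0 has the lower parameter 2 - \<gamma>, so raising \<gamma>
  lowers it: the contiguity relations give the shifted values directly in terms of the unshifted
  ones, and after substitution only polynomial identities remain.\<close>

lemma contig_row_dual: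
  assumes "norm x < 1"
  shows "fst (contig_row b x \<alpha> \<gamma> p q) * rhyp (1 - \<alpha> - of_nat p) (1 - b) (2 - \<gamma> - of_nat p - of_nat q) x +
         snd (contig_row b x \<alpha> \<gamma> p q) *
           (dual_tau b x (\<alpha> + of_nat p) (\<gamma> + of_nat p + of_nat q) * rhyp (1 - \<alpha> - of_nat p) (1 - b) (2 - \<gamma> - of_nat p - of_nat q) x
             + rhyp_theta (1 - \<alpha> - of_nat p) (1 - b) (2 - \<gamma> - of_nat p - of_nat q) x) =
         (\<Prod>i<p. - x * (\<alpha> + of_nat i) * (\<gamma> + of_nat i - b)) *
         (\<Prod>j<q. x / (1 - x) * (\<gamma> + of_nat j - \<alpha>) * (\<gamma> + of_nat p + of_nat j - b)) *
         rhyp (1 - \<alpha>) (1 - b) (2 - \<gamma>) x"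
proof -
  define k where "k = x / (1 - x)"
  have "1 - x \<noteq> 0" using assms by auto
  then have k: "k * (1 - x) = x" by (simp add: k_def)
  define y where "y \<alpha> \<gamma> = rhyp (1 - \<alpha>) (1 - b) (2 - \<gamma>) x" for \<alpha> \<gamma>
  define s where "s \<alpha> \<gamma> = rhyp_theta (1 - \<alpha>) (1 - b) (2 - \<gamma>) x" for \<alpha> \<gamma>
  define t where "t \<alpha> \<gamma> = dual_tau b x \<alpha> \<gamma> * y \<alpha> \<gamma> + s \<alpha> \<gamma>" for \<alpha> \<gamma>
  have c: "y \<alpha> (\<gamma> + 1) = (1 - \<gamma>) * y \<alpha> \<gamma> + s \<alpha> \<gamma>" for \<alpha> \<gamma>
    using rhyp_contig_c[OF assms, of "1 - \<alpha>" "1 - b" "1 - \<gamma>"] by (simp add: y_def s_def)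
  have ct: "s \<alpha> (\<gamma> + 1) = k * ((1 - \<alpha>) * (1 - b) * y \<alpha> \<gamma> + (1 - \<alpha> - b + \<gamma>) * s \<alpha> \<gamma>)" for \<alpha> \<gamma>
    using rhyp_theta_contig_c[OF assms, of "1 - \<alpha>" "1 - b" "1 - \<gamma>"] \<open>1 - x \<noteq> 0\<close>
    by (simp add: y_def s_def k_def field_simps)
  have a: "y (\<alpha> + 1) (\<gamma> + 1) = (1 - \<gamma> - (1 - b) * x) * y \<alpha> \<gamma> + (1 - x) * s \<alpha> \<gamma>" for \<alpha> \<gamma>
    using rhyp_contig_ac[OF assms, of "- \<alpha>" "1 - b" "1 - \<gamma>"] by (simp add: y_def s_def)
  have at: "s (\<alpha> + 1) (\<gamma> + 1) = - \<alpha> * (1 - b) * x * y \<alpha> \<gamma> - \<alpha> * x * s \<alpha> \<gamma>" for \<alpha> \<gamma>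
    using rhyp_theta_contig_ac[OF assms, of "- \<alpha>" "1 - b" "1 - \<gamma>"] by (simp add: y_def s_def)
  have tau: "dual_tau b x \<alpha> \<gamma> = (1 - \<gamma>) - (\<gamma> - \<alpha> - b) * k" for \<alpha> \<gamma>
    by (simp add: dual_tau_def k_def)
  define ka where "ka \<alpha> \<gamma> = - x * \<alpha> * (\<gamma> - b)" for \<alpha> \<gamma>
  define kc where "kc \<alpha> \<gamma> = k * (\<gamma> - \<alpha>) * (\<gamma> - b)" for \<alpha> \<gamma>
  have "fst (contig_row b x \<alpha> \<gamma> p q) * y (\<alpha> + of_nat p) (\<gamma> + of_nat p + of_nat q) +
         snd (contig_row b x \<alpha> \<gamma> p q) * t (\<alpha> + of_nat p) (\<gamma> + of_nat p + of_nat q) =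
         (\<Prod>i<p. ka (\<alpha> + of_nat i) (\<gamma> + of_nat i)) * (\<Prod>j<q. kc (\<alpha> + of_nat p) (\<gamma> + of_nat p + of_nat j)) * y \<alpha> \<gamma>"
  proof (rule contig_row_transport)
    fix \<alpha> \<gamma>
    show "(\<gamma> - b * x) * y (\<alpha> + 1) (\<gamma> + 1) + (1 - x) * t (\<alpha> + 1) (\<gamma> + 1) = ka \<alpha> \<gamma> * y \<alpha> \<gamma>"
    proof -
      \<comment> \<open>The difference is an explicit multiple of k (1 - x) - x = 0, which keeps the
        division by 1 - x out of the identity.\<close>
      have "(\<gamma> - b * x) * y (\<alpha> + 1) (\<gamma> + 1) + (1 - x) * t (\<alpha> + 1) (\<gamma> + 1) - ka \<alpha> \<gamma> * y \<alpha> \<gamma>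
          = - (\<gamma> - \<alpha> - b) * y (\<alpha> + 1) (\<gamma> + 1) * (k * (1 - x) - x)"
        unfolding t_def tau ka_def a at by algebra
      then show ?thesis using k by simp
    qed
    show "\<alpha> * b * x * y (\<alpha> + 1) (\<gamma> + 1) + \<alpha> * x * t (\<alpha> + 1) (\<gamma> + 1) = ka \<alpha> \<gamma> * t \<alpha> \<gamma>"
    proof -
      have "\<alpha> * b * x * y (\<alpha> + 1) (\<gamma> + 1) + \<alpha> * x * t (\<alpha> + 1) (\<gamma> + 1) - ka \<alpha> \<gamma> * t \<alpha> \<gamma>
          = - \<alpha> * x * (\<gamma> - \<alpha> - b) * ((1 - b) * y \<alpha> \<gamma> + s \<alpha> \<gamma>) * (k * (1 - x) - x)"
        unfolding t_def tau ka_def a at by algebra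
      then show ?thesis using k by simp
    qed
    show "\<gamma> * y \<alpha> (\<gamma> + 1) + t \<alpha> (\<gamma> + 1) = kc \<alpha> \<gamma> * y \<alpha> \<gamma>"
      unfolding t_def tau kc_def c ct by algebra
    show "x / (1 - x) * (\<alpha> * b * y \<alpha> (\<gamma> + 1) + (\<alpha> + b - \<gamma>) * t \<alpha> (\<gamma> + 1)) = kc \<alpha> \<gamma> * t \<alpha> \<gamma>"
      unfolding k_def[symmetric] t_def tau kc_def c ct by algebra
  qed
  then show ?thesis
    by (simp add: y_def s_def t_def ka_def kc_def k_def[symmetric] diff_diff_eq algebra_simps)
qed

text \<open>The solution at 1 is a series in 1 - x. Its Euler derivative in x is - x / (1 - x) times
  the one in 1 - x, which explains the coefficient of \<open>rhyp_theta\<close>.\<close>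

lemma contig_row_recip:
  assumes "norm x < 1" "norm (1 - x) < 1"
  shows "fst (contig_row b x \<alpha> \<gamma> p q) * rhyp (1 - \<alpha> - of_nat p) (1 - b) (\<gamma> - \<alpha> - b + 1 + of_nat q) (1 - x) +
         snd (contig_row b x \<alpha> \<gamma> p q) *
           (dual_tau b x (\<alpha> + of_nat p) (\<gamma> + of_nat p + of_nat q) * rhyp (1 - \<alpha> - of_nat p) (1 - b) (\<gamma> - \<alpha> - b + 1 + of_nat q) (1 - x)
             - x / (1 - x) * rhyp_theta (1 - \<alpha> - of_nat p) (1 - b) (\<gamma> - \<alpha> - b + 1 + of_nat q) (1 - x)) =
         (\<Prod>i<p. x * (\<alpha> + of_nat i)) * (- x / (1 - x)) ^ q * rhyp (1 - \<alpha>) (1 - b) (\<gamma> - \<alpha> - b + 1) (1 - x)"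
proof -
  define k where "k = x / (1 - x)"
  have x: "1 - x \<noteq> 0" "x \<noteq> 0" using assms by auto
  then have k: "k * (1 - x) = x" by (simp add: k_def)
  define y where "y \<alpha> \<gamma> = rhyp (1 - \<alpha>) (1 - b) (\<gamma> - \<alpha> - b + 1) (1 - x)" for \<alpha> \<gamma>
  define s where "s \<alpha> \<gamma> = rhyp_theta (1 - \<alpha>) (1 - b) (\<gamma> - \<alpha> - b + 1) (1 - x)" for \<alpha> \<gamma>
  define t where "t \<alpha> \<gamma> = dual_tau b x \<alpha> \<gamma> * y \<alpha> \<gamma> - k * s \<alpha> \<gamma>" for \<alpha> \<gamma>
  have c: "y \<alpha> \<gamma> = (\<gamma> - \<alpha> - b + 1) * y \<alpha> (\<gamma> + 1) + s \<alpha> (\<gamma> + 1)" for \<alpha> \<gamma>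
    using rhyp_contig_c[OF assms(2), of "1 - \<alpha>" "1 - b" "\<gamma> - \<alpha> - b + 1"] by (simp add: y_def s_def algebra_simps)
  have ct: "k * s \<alpha> \<gamma> = (1 - \<alpha>) * (1 - b) * y \<alpha> (\<gamma> + 1) + (1 - \<gamma>) * s \<alpha> (\<gamma> + 1)" for \<alpha> \<gamma>
    using rhyp_theta_contig_c[OF assms(2), of "1 - \<alpha>" "1 - b" "\<gamma> - \<alpha> - b + 1"] x
    by (simp add: y_def s_def k_def field_simps)
  have a: "\<alpha> * y \<alpha> \<gamma> = \<alpha> * y (\<alpha> + 1) (\<gamma> + 1) - s (\<alpha> + 1) (\<gamma> + 1)" for \<alpha> \<gamma>
    using rhyp_contig_a[OF assms(2), of "- \<alpha>" "1 - b" "\<gamma> - \<alpha> - b + 1"] by (simp add: y_def s_def algebra_simps)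
  have at: "x * (\<alpha> * s \<alpha> \<gamma>) = \<alpha> * (1 - b) * (1 - x) * y (\<alpha> + 1) (\<gamma> + 1)
      - (b - \<gamma> + (1 - b) * (1 - x)) * s (\<alpha> + 1) (\<gamma> + 1)" for \<alpha> \<gamma>
    using rhyp_theta_contig_a[OF assms(2), of "- \<alpha>" "1 - b" "\<gamma> - \<alpha> - b + 1"] by (simp add: y_def s_def) algebra
  have tau: "dual_tau b x \<alpha> \<gamma> = (1 - \<gamma>) - (\<gamma> - \<alpha> - b) * k" for \<alpha> \<gamma>
    by (simp add: dual_tau_def k_def)
  define ka where "ka \<alpha> \<gamma> = x * \<alpha>" for \<alpha> \<gamma> :: complex
  define kc where "kc \<alpha> \<gamma> = - k" for \<alpha> \<gamma> :: complex
  have "fst (contig_row b x \<alpha> \<gamma> p q) * y (\<alpha> + of_nat p) (\<gamma> + of_nat p + of_nat q) +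
         snd (contig_row b x \<alpha> \<gamma> p q) * t (\<alpha> + of_nat p) (\<gamma> + of_nat p + of_nat q) =
         (\<Prod>i<p. ka (\<alpha> + of_nat i) (\<gamma> + of_nat i)) * (\<Prod>j<q. kc (\<alpha> + of_nat p) (\<gamma> + of_nat p + of_nat j)) * y \<alpha> \<gamma>"
  proof (rule contig_row_transport)
    fix \<alpha> \<gamma>
    show "(\<gamma> - b * x) * y (\<alpha> + 1) (\<gamma> + 1) + (1 - x) * t (\<alpha> + 1) (\<gamma> + 1) = ka \<alpha> \<gamma> * y \<alpha> \<gamma>"
    proof -
      \<comment> \<open>Relation \<open>a\<close> determines only the product \<alpha> y(\<alpha>,
        \<gamma>), where \<alpha> may be 0. It therefore enters as a vanishing multiple, next to k
        (1 - x) - x.\<close>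
      have "(\<gamma> - b * x) * y (\<alpha> + 1) (\<gamma> + 1) + (1 - x) * t (\<alpha> + 1) (\<gamma> + 1) - ka \<alpha> \<gamma> * y \<alpha> \<gamma>
          = (- (\<gamma> - \<alpha> - b) * y (\<alpha> + 1) (\<gamma> + 1) - s (\<alpha> + 1) (\<gamma> + 1)) * (k * (1 - x) - x)
            - x * (\<alpha> * y \<alpha> \<gamma> - (\<alpha> * y (\<alpha> + 1) (\<gamma> + 1) - s (\<alpha> + 1) (\<gamma> + 1)))"
        unfolding t_def tau ka_def by algebra
      then show ?thesis using k a[of \<alpha> \<gamma>] by simp
    qed
    show "\<alpha> * b * x * y (\<alpha> + 1) (\<gamma> + 1) + \<alpha> * x * t (\<alpha> + 1) (\<gamma> + 1) = ka \<alpha> \<gamma> * t \<alpha> \<gamma>"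
    proof -
      have "\<alpha> * b * x * y (\<alpha> + 1) (\<gamma> + 1) + \<alpha> * x * t (\<alpha> + 1) (\<gamma> + 1) - ka \<alpha> \<gamma> * t \<alpha> \<gamma>
          = (\<alpha> * (1 - b) * y (\<alpha> + 1) (\<gamma> + 1) + (\<gamma> - 1) * s (\<alpha> + 1) (\<gamma> + 1)) * (k * (1 - x) - x)
            - x * dual_tau b x \<alpha> \<gamma> * (\<alpha> * y \<alpha> \<gamma> - (\<alpha> * y (\<alpha> + 1) (\<gamma> + 1) - s (\<alpha> + 1) (\<gamma> + 1)))
            + k * (x * (\<alpha> * s \<alpha> \<gamma>) - (\<alpha> * (1 - b) * (1 - x) * y (\<alpha> + 1) (\<gamma> + 1)
                - (b - \<gamma> + (1 - b) * (1 - x)) * s (\<alpha> + 1) (\<gamma> + 1)))"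
        unfolding t_def tau ka_def by algebra
      then show ?thesis using k a[of \<alpha> \<gamma>] at[of \<alpha> \<gamma>] by simp
    qed
    show "\<gamma> * y \<alpha> (\<gamma> + 1) + t \<alpha> (\<gamma> + 1) = kc \<alpha> \<gamma> * y \<alpha> \<gamma>"
      unfolding t_def tau kc_def c[of \<alpha> \<gamma>] by algebra
    show "x / (1 - x) * (\<alpha> * b * y \<alpha> (\<gamma> + 1) + (\<alpha> + b - \<gamma>) * t \<alpha> (\<gamma> + 1)) = kc \<alpha> \<gamma> * t \<alpha> \<gamma>"
      unfolding k_def[symmetric] t_def tau kc_def ct[of \<alpha> \<gamma>] c[of \<alpha> \<gamma>] by algebra
  qed
  then show ?thesis
    by (simp add: y_def s_def t_def ka_def kc_def k_def[symmetric] diff_diff_eq algebra_simps)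
qed

lemma contig_row_poly:
  fixes A G :: "complex poly"
  shows "\<exists>P Q. \<forall>w. contig_row b x (poly A w) (poly G w) p q = (poly P w, poly Q w)"
proof -
  have ac: "\<exists>P Q. \<forall>w. contig_row_ac b x (poly A w) (poly G w) p = (poly P w, poly Q w)"
  proof (induction p)
    case 0
    show ?case by (intro exI[of _ 1] exI[of _ 0]) simp
  next
    case (Suc p)
    then obtain P Q where PQ: "\<And>w. contig_row_ac b x (poly A w) (poly G w) p = (poly P w, poly Q w)" by blast
    show ?case
    proof (rule exI, rule exI, rule allI)
      show "contig_row_ac b x (poly A w) (poly G w) (Suc p) =
          (poly (P * (G + [:of_nat p - b * x:]) + Q * ((A + [:of_nat p:]) * [:b * x:])) w,
           poly (P * [:1 - x:] + Q * ((A + [:of_nat p:]) * [:x:])) w)" for w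
        by (simp add: PQ contig_step_ac_def algebra_simps)
    qed
  qed
  show ?thesis
  proof (induction q)
    case 0
    then show ?case using ac by simp
  next
    case (Suc q)
    then obtain P Q where PQ: "\<And>w. contig_row b x (poly A w) (poly G w) p q = (poly P w, poly Q w)" by blast
    define k where "k = x / (1 - x)"
    show ?case
    proof (rule exI, rule exI, rule allI)
      show "contig_row b x (poly A w) (poly G w) p (Suc q) =
          (poly (P * (G + [:of_nat p + of_nat q:]) + Q * ([:k:] * ((A + [:of_nat p:]) * [:b:]))) w,
           poly (P + Q * ([:k:] * (A + [:of_nat p + b:] - G - [:of_nat p + of_nat q:]))) w)" for w
        by (simp add: PQ contig_step_c_def k_def[symmetric] algebra_simps)
    qed
  qed
qed

section \<open>Asymptotics along the real axis\<close>

lemma has_bochner_integral_lborel_nonneg: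
  fixes f :: "real \<Rightarrow> real"
  assumes [measurable]: "f \<in> borel_measurable borel" "S \<in> sets borel"
    and "\<And>x. f x \<ge> 0" "(f has_integral I) S"
  shows "has_bochner_integral lborel (\<lambda>x. indicator S x * f x) I"
proof (rule has_bochner_integral_nn_integral)
  show "0 \<le> I" using assms(3,4) has_integral_nonneg by blast
  show "(\<integral>\<^sup>+ x. ennreal (indicator S x * f x) \<partial>lborel) = ennreal I"
  proof -
    have "((\<lambda>x. if x \<in> S then f x else 0) has_integral I) UNIV"
      using assms(4) by (simp add: has_integral_restrict_UNIV)
    also have "(\<lambda>x. if x \<in> S then f x else 0) = (\<lambda>x. indicator S x * f x)"
      by auto
    finally have I: "((\<lambda>x. indicator S x * f x) has_integral I) UNIV" .
    have "0 \<le> indicator S x * f x" for x using assms(3) by simp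
    from nn_integral_has_integral_lborel[of "\<lambda>x. indicator S x * f x" I, OF _ this I] show ?thesis by simp
  qed
qed (use assms(3) in auto)

lemma has_bochner_integral_Beta_real:
  fixes a b :: real
  assumes "a > 0" "b > 0"
  shows "has_bochner_integral lborel (\<lambda>t. indicator {0..1} t * (t powr (a - 1) * (1 - t) powr (b - 1))) (Beta a b)"
  by (rule has_bochner_integral_lborel_nonneg) (use has_integral_Beta_real[OF assms] in auto)

lemma has_bochner_integral_Gamma_real:
  fixes a c :: real
  assumes "a > 0" "c > 0"
  shows "has_bochner_integral lborel (\<lambda>s. indicator {0..} s * (s powr (a - 1) * exp (- (c * s)))) (Gamma a / c powr a)"
proof -
  let ?f = "\<lambda>t::real. indicator {0..} t * (t powr (a - 1) / exp t)"
  have "has_bochner_integral lborel ?f (Gamma a)"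
    by (rule has_bochner_integral_lborel_nonneg) (use Gamma_integral_real[OF assms(1)] in auto)
  then have "has_bochner_integral lborel (\<lambda>s. ?f (0 + c * s)) (Gamma a /\<^sub>R \<bar>c\<bar>)"
    using assms(2) by (subst lborel_has_bochner_integral_real_affine_iff[symmetric]) auto
  then have "has_bochner_integral lborel (\<lambda>s. c powr (1 - a) * ?f (0 + c * s)) (c powr (1 - a) * (Gamma a /\<^sub>R \<bar>c\<bar>))"
    by (rule has_bochner_integral_mult_right)
  also have "(\<lambda>s. c powr (1 - a) * ?f (0 + c * s)) = (\<lambda>s. indicator {0..} s * (s powr (a - 1) * exp (- (c * s))))"
  proof
    fix s :: real
    have "c powr (1 - a) * c powr (a - 1) = 1"
      using assms(2) by (simp add: powr_add[symmetric])
    then show "c powr (1 - a) * ?f (0 + c * s) = indicator {0..} s * (s powr (a - 1) * exp (- (c * s)))"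
      using assms(2) by (cases "s \<ge> 0") (simp_all add: zero_le_mult_iff powr_mult exp_minus divide_inverse mult.assoc[symmetric])
  qed
  also have "c powr (1 - a) * (Gamma a /\<^sub>R \<bar>c\<bar>) = Gamma a / c powr a"
    using assms(2) by (simp add: powr_diff field_simps)
  finally show ?thesis .
qed

section \<open>Euler's integral with b = 1/2 and Laplace's method\<close>

definition euler_integrand :: "real \<Rightarrow> real \<Rightarrow> real \<Rightarrow> real \<Rightarrow> real" where
  "euler_integrand A C z t = indicator {0..1} t * (t powr (-1/2) * (1 - t) powr (C - 3/2) * (1 - z * t) powr (- A))"

lemma abs_pochhammer_le: "\<bar>pochhammer (A::real) n\<bar> \<le> pochhammer \<bar>A\<bar> n"
  unfolding pochhammer_prod abs_prod by (intro prod_mono) auto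

text \<open>The binomial series of (1 - z t)^(- A) is integrated term by term against a Beta
  density. Since (1/2)_n \<le> (C)_n, the Beta values are at most \<open>B 0\<close>, and absolute
  convergence of the binomial series at t = 1 suffices.\<close>

lemma euler_integral:
  fixes A C z :: real
  assumes C: "C > 1/2" and z: "0 < z" "z < 1"
  shows "integrable lborel (euler_integrand A C z)"
    and "hyp2F1 (of_real A) (1/2) (of_real C) z * of_real (Beta (1/2) (C - 1/2)) = of_real (integral\<^sup>L lborel (euler_integrand A C z))"
proof -
  define c where "c n = pochhammer A n / fact n * z ^ n" for n
  define f where "f n t = c n * (indicator {0..1} t * (t powr ((real n + 1/2) - 1) * (1 - t) powr ((C - 1/2) - 1)))" for n t
  define B where "B n = Beta (real n + 1/2) (C - 1/2)" for n
  have f: "has_bochner_integral lborel (f n) (c n * B n)" for n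
    unfolding f_def B_def using C by (intro has_bochner_integral_mult_right has_bochner_integral_Beta_real) auto
  have nf: "has_bochner_integral lborel (\<lambda>t. norm (f n t)) (\<bar>c n\<bar> * B n)" for n
  proof -
    have "(\<lambda>t. norm (f n t)) = (\<lambda>t. \<bar>c n\<bar> * (indicator {0..1} t * (t powr ((real n + 1/2) - 1) * (1 - t) powr ((C - 1/2) - 1))))"
      by (auto simp: f_def abs_mult)
    moreover have "has_bochner_integral lborel \<dots> (\<bar>c n\<bar> * B n)"
      unfolding B_def using C by (intro has_bochner_integral_mult_right has_bochner_integral_Beta_real) auto
    ultimately show ?thesis by simp
  qed
  have binom: "(\<lambda>n. pochhammer A n / fact n * y ^ n) sums (1 - y) powr (- A)" if "\<bar>y\<bar> < 1" for A y :: real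
  proof -
    have "(- A gchoose n) * (- y) ^ n = pochhammer A n / fact n * y ^ n" for n
    proof -
      have "(- 1) ^ n * (- y) ^ n = y ^ n" by (simp flip: power_mult_distrib)
      then have "pochhammer A n / fact n * ((- 1) ^ n * (- y) ^ n) = pochhammer A n / fact n * y ^ n" by simp
      then show ?thesis by (simp only: gbinomial_pochhammer minus_minus) (simp only: divide_inverse mult_ac)
    qed
    then show ?thesis
      using gen_binomial_real[of "-y" "-A"] that by simp
  qed
  have sum_c: "summable (\<lambda>n. \<bar>c n\<bar>)"
  proof (rule summable_comparison_test')
    show "summable (\<lambda>n. pochhammer \<bar>A\<bar> n / fact n * z ^ n)"
      using binom[of z "\<bar>A\<bar>"] z by (auto simp: sums_iff)
    show "norm \<bar>c n\<bar> \<le> pochhammer \<bar>A\<bar> n / fact n * z ^ n" for n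
      using z abs_pochhammer_le[of A n] by (simp add: c_def abs_mult divide_right_mono mult_right_mono)
  qed
  have B_eq: "B n = pochhammer (1/2) n / pochhammer C n * B 0" for n
  proof -
    have "Gamma (u + real n) = pochhammer u n * Gamma u" if "u > 0" for u :: real
    proof -
      have "u \<notin> \<int>\<^sub>\<le>\<^sub>0" using that by (auto elim!: nonpos_Ints_cases)
      then have "pochhammer u n = Gamma (u + real n) / Gamma u" by (rule pochhammer_Gamma)
      then show ?thesis using Gamma_real_pos[OF that] by simp
    qed
    from this[of "1/2"] this[of C] C have "Gamma (1/2 + real n) = pochhammer (1/2) n * Gamma (1/2)"
      "Gamma (C + real n) = pochhammer C n * Gamma C" by auto
    then show ?thesis
      by (simp add: B_def Beta_def add_ac)
  qed
  have B0: "B 0 > 0"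
    unfolding B_def Beta_def using C by (intro divide_pos_pos mult_pos_pos Gamma_real_pos) auto
  have B_le: "0 \<le> B n" "B n \<le> B 0" for n
  proof -
    have p: "0 \<le> pochhammer (1/2::real) n" "pochhammer (1/2) n \<le> pochhammer C n" "pochhammer C n > 0"
      using C by (auto intro!: pochhammer_nonneg pochhammer_pos) (auto simp: pochhammer_prod intro!: prod_mono)
    then show "0 \<le> B n" using B0 by (subst B_eq) auto
    show "B n \<le> B 0" using B0 p by (subst B_eq) (auto simp: field_simps)
  qed
  have "summable (\<lambda>n. \<bar>c n\<bar> * B n)"
  proof (rule summable_comparison_test')
    show "summable (\<lambda>n. \<bar>c n\<bar> * B 0)" by (intro summable_mult2 sum_c)
    show "norm (\<bar>c n\<bar> * B n) \<le> \<bar>c n\<bar> * B 0" for n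
      using B_le[of n] by (auto simp: abs_mult intro!: mult_left_mono)
  qed
  then have int_sum: "summable (\<lambda>n. integral\<^sup>L lborel (\<lambda>t. norm (f n t)))"
    using nf by (simp add: has_bochner_integral_iff)
  \<comment> \<open>At t = 0 both sides vanish by the convention \<open>0 powr y = 0\<close>, so t^n
    may be split off there too.\<close>
  have f_eq: "f n t = (pochhammer A n / fact n * (z * t) ^ n) * (indicator {0..1} t * (t powr (-1/2) * (1 - t) powr (C - 3/2)))" for n t
  proof (cases "t > 0")
    case True
    have "t powr (real n + 1/2 - 1) = t ^ n * t powr (-1/2)"
      using True powr_add[of t "real n" "-1/2"] by (simp add: powr_realpow)
    then show ?thesis by (simp add: f_def c_def power_mult_distrib algebra_simps)
  next
    case False
    then show ?thesis by (cases "t = 0") (auto simp: f_def)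
  qed
  have f_sums: "(\<lambda>n. f n t) sums euler_integrand A C z t" for t
  proof (cases "t \<in> {0..1}")
    case True
    then have "\<bar>z * t\<bar> < 1"
      using z by (auto simp: abs_mult intro: mult_le_less_imp_less order_le_less_trans[of _ "z * 1"] mult_left_mono)
    from sums_mult2[OF binom[OF this, of A], of "indicator {0..1} t * (t powr (-1/2) * (1 - t) powr (C - 3/2))"]
    show ?thesis unfolding f_eq euler_integrand_def by (simp add: mult_ac)
  qed (auto simp: f_def euler_integrand_def)
  have norm_summable: "summable (\<lambda>n. norm (f n t))" for t
  proof -
    have "summable (\<lambda>n. \<bar>c n\<bar> * (indicator {0..1} t * (t powr (-1/2) * (1 - t) powr (C - 3/2))))"
      by (intro summable_mult2 sum_c)
    then show ?thesis
    proof (rule summable_comparison_test'[of _ 0])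
      fix n
      show "norm (norm (f n t)) \<le> \<bar>c n\<bar> * (indicator {0..1} t * (t powr (-1/2) * (1 - t) powr (C - 3/2)))"
      proof (cases "t \<in> {0..1}")
        case True
        then have "\<bar>c n\<bar> * \<bar>t ^ n\<bar> \<le> \<bar>c n\<bar>"
          by (intro mult_left_le) (auto intro: power_le_one)
        then have "\<bar>pochhammer A n / fact n * (z * t) ^ n\<bar> \<le> \<bar>c n\<bar>"
          by (simp add: c_def power_mult_distrib abs_mult mult_ac)
        then show ?thesis
          unfolding f_eq real_norm_def abs_abs by (subst abs_mult) (intro mult_mono, auto)
      qed (simp add: f_eq)
    qed
  qed
  have int: "integrable lborel (f n)" for n
    using f by (simp add: has_bochner_integral_iff)
  have lim: "(\<lambda>t. \<Sum>n. f n t) = euler_integrand A C z"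
    using f_sums by (auto simp: sums_iff)
  show "integrable lborel (euler_integrand A C z)"
    using integrable_suminf[OF int _ int_sum] norm_summable unfolding lim by auto
  have "(\<lambda>n. integral\<^sup>L lborel (f n)) sums integral\<^sup>L lborel (euler_integrand A C z)"
    using sums_integral[OF int _ int_sum] norm_summable unfolding lim by auto
  then have "(\<lambda>n. c n * B n) sums integral\<^sup>L lborel (euler_integrand A C z)"
    using f by (simp add: has_bochner_integral_iff)
  then have "(\<lambda>n. complex_of_real (c n * B n)) sums of_real (integral\<^sup>L lborel (euler_integrand A C z))"
    by (rule sums_of_real)
  moreover have "complex_of_real (c n * B n) = pochhammer (of_real A) n * pochhammer (1/2) n / (pochhammer (of_real C) n * of_nat (fact n)) * of_real (z ^ n)
      * of_real (B 0)" for n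
  proof -
    have "pochhammer (1/2::complex) n = of_real (pochhammer (1/2) n)"
      using pochhammer_of_real[of "1/2" n, where 'a = complex] by simp
    then show ?thesis
      unfolding B_eq[of n] c_def by (simp add: pochhammer_of_real mult_ac)
  qed
  ultimately have *: "(\<lambda>n. pochhammer (of_real A) n * pochhammer (1/2) n / (pochhammer (of_real C) n * of_nat (fact n)) * of_real (z ^ n)
      * complex_of_real (B 0)) sums of_real (integral\<^sup>L lborel (euler_integrand A C z))"
    by simp
  have "hyp2F1 (of_real A) (1/2) (of_real C) z * of_real (B 0) = of_real (integral\<^sup>L lborel (euler_integrand A C z))"
    using sums_divide[OF *, of "of_real (B 0)"] B0 unfolding hyp2F1_def by (simp add: sums_iff)
  then show "hyp2F1 (of_real A) (1/2) (of_real C) z * of_real (Beta (1/2) (C - 1/2)) = of_real (integral\<^sup>L lborel (euler_integrand A C z))"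
    by (simp add: B_def)
qed

text \<open>The majorant for the substitution t = s / w. With v = 1 - s / w \<le> u = 1 - z s / w
  \<le> 1 the powers that grow with w combine to at most v^(2 c w - 3/2). The lower bound on w makes
  this exponent at least c w, and ln v \<le> - s / w then gives exp (- c s). The maximum with 0
  admits negative P, which occurs for the reciprocal parameter.\<close>

lemma euler_integrand_bound:
  fixes R P a z w s c :: real
  assumes z: "0 < z" "z < 1" and c: "c = (R - max P 0) / 2" "c > 0" and w: "w \<ge> 3 / (2 * c)" "w > 0"
  shows "w powr (-1/2) * euler_integrand (P * w + a) (R * w) z (s / w)
     \<le> max 1 ((1 - z) powr (- a)) * (indicator {0..} s * (s powr (1/2 - 1) * exp (- (c * s))))"
proof (cases "0 < s \<and> s < w")
  case False
  then have "euler_integrand (P * w + a) (R * w) z (s / w) = 0"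
    using w by (cases "s = 0"; cases "s = w") (auto simp: euler_integrand_def indicator_def field_simps)
  then show ?thesis by (simp add: indicator_def max_def)
next
  case True
  define u where "u = 1 - z * (s / w)"
  define v where "v = 1 - s / w"
  have sw: "0 < s / w" "s / w < 1" using True by auto
  have "z * (s / w) < 1 * (s / w)" using sw z by (intro mult_strict_right_mono) auto
  moreover have "z * (s / w) < z * 1" using sw z by (intro mult_strict_left_mono) auto
  moreover have "z * (s / w) > 0" using sw z by (intro mult_pos_pos) auto
  ultimately have uv: "0 < v" "v \<le> u" "u \<le> 1" "1 - z \<le> u" "v < 1" "0 < u"
    using sw z by (auto simp: u_def v_def)
  have ua: "u powr (- a) \<le> max 1 ((1 - z) powr (- a))"
  proof (cases "a \<ge> 0")
    case True
    then have "u powr (- a) \<le> (1 - z) powr (- a)" using uv z by (intro powr_mono2') auto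
    then show ?thesis by simp
  next
    case False
    then have "u powr (- a) \<le> 1" using uv by (intro powr_le1) auto
    then show ?thesis by simp
  qed
  have uP: "u powr (- (P * w)) \<le> v powr (- (max P 0 * w))"
  proof (cases "P \<ge> 0")
    case True
    then show ?thesis using uv w by (auto intro!: powr_mono2' mult_nonneg_nonneg simp: max_def)
  next
    case False
    then have "u powr (- (P * w)) \<le> 1" using uv w by (intro powr_le1) (auto simp: mult_nonpos_nonneg)
    then show ?thesis using False uv by (simp add: max_def)
  qed
  have vv: "v powr (R * w - 3/2) * v powr (- (max P 0 * w)) \<le> exp (- (c * s))"
  proof -
    have e: "R * w - 3/2 - max P 0 * w = 2 * c * w - 3/2" by (simp add: c algebra_simps)
    have cw: "3/2 \<le> c * w" using w(1) c(2) by (simp add: divide_le_eq mult_ac)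
    have "v powr (R * w - 3/2) * v powr (- (max P 0 * w)) = exp ((2 * c * w - 3/2) * ln v)"
    proof -
      have "v powr (R * w - 3/2) * v powr (- (max P 0 * w)) = v powr (R * w - 3/2 - max P 0 * w)"
        by (simp only: powr_add[symmetric] diff_conv_add_uminus)
      then show ?thesis using uv by (simp only: e powr_def) simp
    qed
    also have "(2 * c * w - 3/2) * ln v \<le> (2 * c * w - 3/2) * (- (s / w))"
      using ln_le_minus_one[OF uv(1)] cw by (intro mult_left_mono) (auto simp: v_def)
    also have "\<dots> \<le> (c * w) * (- (s / w))"
      using cw sw by (intro mult_right_mono_neg) auto
    also have "\<dots> = - (c * s)" using w by simp
    finally show ?thesis by simp
  qed
  have "w powr (-1/2) * euler_integrand (P * w + a) (R * w) z (s / w)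
      = w powr (-1/2) * (s / w) powr (-1/2) * (v powr (R * w - 3/2) * u powr (- (P * w)) * u powr (- a))"
  proof -
    have "euler_integrand (P * w + a) (R * w) z (s / w) = (s / w) powr (-1/2) * v powr (R * w - 3/2) * u powr (- (P * w + a))"
      using sw by (simp only: euler_integrand_def u_def[symmetric] v_def[symmetric]) (simp add: indicator_def mult.assoc)
    also have "u powr (- (P * w + a)) = u powr (- (P * w)) * u powr (- a)"
      by (simp flip: powr_add)
    finally show ?thesis by (simp add: mult_ac)
  qed
  also have "w powr (-1/2) * (s / w) powr (-1/2) = s powr (1/2 - 1)"
    using True w by (simp add: powr_divide)
  also have "v powr (R * w - 3/2) * u powr (- (P * w)) * u powr (- a)
      \<le> (v powr (R * w - 3/2) * v powr (- (max P 0 * w))) * max 1 ((1 - z) powr (- a))"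
    using uP ua by (intro mult_mono) auto
  also have "\<dots> \<le> exp (- (c * s)) * max 1 ((1 - z) powr (- a))"
    using vv by (intro mult_right_mono) auto
  finally show ?thesis using True by (simp add: mult_ac mult_left_mono)
qed

lemma euler_integrand_limit:
  fixes R P a z s :: real
  assumes z: "0 < z" "z < 1" and s: "s > 0"
  shows "((\<lambda>w. w powr (-1/2) * euler_integrand (P * w + a) (R * w) z (s / w))
     \<longlongrightarrow> s powr (1/2 - 1) * exp (- ((R - P * z) * s))) at_top"
proof (rule Lim_transform_eventually)
  have 1: "((\<lambda>w. (1 - s / w) powr (R * w - 3/2)) \<longlongrightarrow> exp (- R * s)) at_top"
    using s by real_asymp
  have 2: "((\<lambda>w. (1 - z * (s / w)) powr (- (P * w + a))) \<longlongrightarrow> exp (P * z * s)) at_top"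
    using s z by real_asymp
  have "((\<lambda>w. s powr (1/2 - 1) * ((1 - s / w) powr (R * w - 3/2) * (1 - z * (s / w)) powr (- (P * w + a))))
     \<longlongrightarrow> s powr (1/2 - 1) * (exp (- R * s) * exp (P * z * s))) at_top"
    by (intro tendsto_intros 1 2)
  then show "((\<lambda>w. s powr (1/2 - 1) * ((1 - s / w) powr (R * w - 3/2) * (1 - z * (s / w)) powr (- (P * w + a))))
     \<longlongrightarrow> s powr (1/2 - 1) * exp (- ((R - P * z) * s))) at_top"
    by (simp add: exp_add[symmetric] algebra_simps)
  show "\<forall>\<^sub>F w in at_top. s powr (1/2 - 1) * ((1 - s / w) powr (R * w - 3/2) * (1 - z * (s / w)) powr (- (P * w + a)))
     = w powr (-1/2) * euler_integrand (P * w + a) (R * w) z (s / w)"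
    using eventually_gt_at_top[of s]
  proof eventually_elim
    case (elim w)
    have "w powr (-1/2) * (s / w) powr (-1/2) = s powr (1/2 - 1)"
      using s elim by (simp add: powr_divide)
    then show ?case using elim s by (simp add: euler_integrand_def mult.assoc[symmetric])
  qed
qed

text \<open>The mass sits at t of order 1 / w. The scaling w^(1/2) times the Jacobian 1 / w is the
  factor w^(-1/2) in \<open>g\<close>, and dominated convergence leaves a Gamma integral with rate R
  - P z.\<close>

lemma euler_integral_limit:
  fixes R P a z :: real
  assumes z: "0 < z" "z < 1" and R: "R > 0" "P < R"
  shows "((\<lambda>w. w powr (1/2) * integral\<^sup>L lborel (euler_integrand (P * w + a) (R * w) z))
     \<longlongrightarrow> Gamma (1/2) / (R - P * z) powr (1/2)) at_top"
proof -
  define c where "c = (R - max P 0) / 2"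
  have c: "c > 0" using R by (auto simp: c_def)
  have RP: "R - P * z > 0"
  proof (cases "P > 0")
    case True
    then have "P * z \<le> P * 1" using z by (intro mult_left_mono) auto
    then show ?thesis using R by simp
  next
    case False
    then have "P * z \<le> 0" using z by (simp add: mult_nonpos_nonneg)
    then show ?thesis using R by simp
  qed
  define g where "g w s = w powr (-1/2) * euler_integrand (P * w + a) (R * w) z (s / w)" for w s
  have "((\<lambda>w. integral\<^sup>L lborel (g w)) \<longlongrightarrow>
     integral\<^sup>L lborel (\<lambda>s. indicator {0..} s * (s powr (1/2 - 1) * exp (- ((R - P * z) * s))))) at_top"
  proof (rule integral_dominated_convergence_at_top)
    show "integrable lborel (\<lambda>s. max 1 ((1 - z) powr (- a)) * (indicator {0..} s * (s powr (1/2 - 1) * exp (- (c * s)))))"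
      using has_bochner_integral_Gamma_real[of "1/2" c] c
      by (intro integrable_mult_right) (auto simp: has_bochner_integral_iff)
    show "g w \<in> borel_measurable lborel" for w
      unfolding g_def euler_integrand_def by measurable
    show "(\<lambda>s. indicator {0..} s * (s powr (1/2 - 1) * exp (- ((R - P * z) * s)))) \<in> borel_measurable lborel"
      by measurable
    show "\<forall>\<^sub>F w in at_top. AE s in lborel. norm (g w s)
        \<le> max 1 ((1 - z) powr (- a)) * (indicator {0..} s * (s powr (1/2 - 1) * exp (- (c * s))))"
      using eventually_ge_at_top[of "3 / (2 * c)"] eventually_gt_at_top[of 0]
    proof eventually_elim
      case (elim w)
      have "g w s \<ge> 0" for s by (auto simp: g_def euler_integrand_def)
      then show ?case
        using euler_integrand_bound[OF z c_def c elim, of a] by (intro AE_I2) (simp add: g_def)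
    qed
    show "AE s in lborel. ((\<lambda>w. g w s) \<longlongrightarrow> indicator {0..} s * (s powr (1/2 - 1) * exp (- ((R - P * z) * s)))) at_top"
    proof (intro AE_I2)
      fix s :: real
      show "((\<lambda>w. g w s) \<longlongrightarrow> indicator {0..} s * (s powr (1/2 - 1) * exp (- ((R - P * z) * s)))) at_top"
      proof (cases "s > 0")
        case True
        then show ?thesis using euler_integrand_limit[OF z True, of P a R] by (simp add: g_def)
      next
        case False
        have "\<forall>\<^sub>F w in at_top. g w s = 0"
          using eventually_gt_at_top[of 0]
        proof eventually_elim
          case (elim w)
          then show ?case using False
            by (cases "s = 0") (auto simp: g_def euler_integrand_def indicator_def zero_le_divide_iff)
        qed
        then have "((\<lambda>w. g w s) \<longlongrightarrow> 0) at_top"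
          by (rule tendsto_eventually)
        moreover have "indicator {0..} s * (s powr (1/2 - 1) * exp (- ((R - P * z) * s))) = 0"
          using False by (cases "s = 0") auto
        ultimately show ?thesis
          by (simp only:)
      qed
    qed
  qed
  also have "integral\<^sup>L lborel (\<lambda>s. indicator {0..} s * (s powr (1/2 - 1) * exp (- ((R - P * z) * s)))) = Gamma (1/2) / (R - P * z) powr (1/2)"
    using has_bochner_integral_Gamma_real[of "1/2" "R - P * z"] RP by (simp add: has_bochner_integral_iff)
  finally show ?thesis
  proof (rule Lim_transform_eventually)
    show "\<forall>\<^sub>F w in at_top. integral\<^sup>L lborel (g w) = w powr (1/2) * integral\<^sup>L lborel (euler_integrand (P * w + a) (R * w) z)"
      using eventually_gt_at_top[of 0]
    proof eventually_elim
      case (elim w)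
      let ?E = "euler_integrand (P * w + a) (R * w) z"
      have "integral\<^sup>L lborel ?E = \<bar>1 / w\<bar> *\<^sub>R integral\<^sup>L lborel (\<lambda>s. ?E (0 + 1 / w * s))"
        using elim by (intro lborel_integral_real_affine) auto
      then have E: "integral\<^sup>L lborel ?E = 1 / w * integral\<^sup>L lborel (\<lambda>s. ?E (s / w))"
        using elim by simp
      have "w powr (-1/2) = w powr (1/2) * (1 / w)"
        using elim powr_diff[of w "1/2" 1] by simp
      then show ?case
        unfolding g_def E by (simp add: mult.assoc)
    qed
  qed
qed

text \<open>For P = a = 0 the series is 1, so its Euler integral is the Beta factor itself. Dividing
  by that case removes the Beta factor and gives the limit (R / (R - P z))^(1/2).\<close>

lemma hyp2F1_limit_at_top:
  fixes R P a z :: real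
  assumes z: "0 < z" "z < 1" and R: "R > 0" "P < R"
  shows "\<exists>L\<noteq>0. ((\<lambda>w. hyp2F1 (of_real (P * w + a)) (1/2) (of_real (R * w)) z) \<longlongrightarrow> of_real L) at_top"
proof -
  define I where "I P a w = integral\<^sup>L lborel (euler_integrand (P * w + a) (R * w) z)" for P a w :: real
  define L where "L = (Gamma (1/2) / (R - P * z) powr (1/2)) / (Gamma (1/2) / (R - 0 * z) powr (1/2))"
  have RP: "R - P * z > 0"
  proof (cases "P > 0")
    case True
    then have "P * z \<le> P * 1" using z by (intro mult_left_mono) auto
    then show ?thesis using R by simp
  next
    case False
    then have "P * z \<le> 0" using z by (simp add: mult_nonpos_nonneg)
    then show ?thesis using R by simp
  qed
  have G: "Gamma (1/2::real) \<noteq> 0" by (simp add: Gamma_one_half_real)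
  have "L \<noteq> 0" using G R RP by (simp add: L_def)
  have "((\<lambda>w. (w powr (1/2) * I P a w) / (w powr (1/2) * I 0 0 w)) \<longlongrightarrow> L) at_top"
    unfolding L_def I_def using G R RP
    by (intro tendsto_divide euler_integral_limit[OF z]) (auto simp: Gamma_one_half_real)
  then have "((\<lambda>w. complex_of_real ((w powr (1/2) * I P a w) / (w powr (1/2) * I 0 0 w))) \<longlongrightarrow> of_real L) at_top"
    by (rule tendsto_of_real)
  moreover have "\<forall>\<^sub>F w in at_top. complex_of_real ((w powr (1/2) * I P a w) / (w powr (1/2) * I 0 0 w)) =
     hyp2F1 (of_real (P * w + a)) (1/2) (of_real (R * w)) z"
    using eventually_gt_at_top[of 0] eventually_gt_at_top[of "1 / R"]
  proof eventually_elim
    case (elim w)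
    have C: "R * w > 1/2" using elim R by (simp add: field_simps)
    have B: "Beta (1/2) (R * w - 1/2) > 0"
      unfolding Beta_def using C by (intro divide_pos_pos mult_pos_pos Gamma_real_pos) auto
    have "I 0 0 w = Beta (1/2) (R * w - 1/2)"
    proof -
      have "hyp2F1 (of_real 0) (1/2) (of_real (R * w)) z = 1"
      proof -
        have "(\<lambda>n. pochhammer (of_real 0) n * pochhammer (1/2) n / (pochhammer (complex_of_real (R * w)) n * of_nat (fact n)) * of_real (z ^ n))
            = (\<lambda>n. if n = 0 then 1 else 0)"
          by (simp add: fun_eq_iff pochhammer_0_left)
        then show ?thesis unfolding hyp2F1_def by (subst suminf_finite[of "{0}"]) (auto simp: fun_eq_iff)
      qed
      with euler_integral(2)[OF C z, of 0] have "complex_of_real (Beta (1/2) (R * w - 1/2)) = of_real (I 0 0 w)"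
        by (simp add: I_def)
      then show ?thesis by (simp only: of_real_eq_iff)
    qed
    then show ?case
      using euler_integral(2)[OF C z, of "P * w + a"] B elim by (simp add: I_def field_simps)
  qed
  ultimately have "((\<lambda>w. hyp2F1 (of_real (P * w + a)) (1/2) (of_real (R * w)) z) \<longlongrightarrow> of_real L) at_top"
    by (rule Lim_transform_eventually)
  with \<open>L \<noteq> 0\<close> show ?thesis by blast
qed

section \<open>Gamma products from first-order recurrences\<close>

lemma poly_over_power_tendsto:
  fixes p :: "complex poly"
  shows "((\<lambda>w. poly p w / w ^ degree p) \<longlongrightarrow> lead_coeff p) at_infinity"
proof -
  have "((\<lambda>w. poly (reflect_poly p) (inverse w)) \<longlongrightarrow> poly (reflect_poly p) 0) at_infinity"
    by (intro tendsto_poly tendsto_inverse_0)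
  then have "((\<lambda>w. poly (reflect_poly p) (inverse w)) \<longlongrightarrow> lead_coeff p) at_infinity"
    by (simp add: poly_0_coeff_0)
  moreover have "\<forall>\<^sub>F w in at_infinity. poly (reflect_poly p) (inverse w) = poly p w / w ^ degree p"
    unfolding eventually_at_infinity
  proof (intro exI[of _ 1] allI impI)
    fix w :: complex assume "norm w \<ge> 1"
    then have "w \<noteq> 0" by auto
    then show "poly (reflect_poly p) (inverse w) = poly p w / w ^ degree p"
      by (subst poly_reflect_poly_nz) (simp_all add: power_inverse divide_inverse mult.commute)
  qed
  ultimately show ?thesis by (rule Lim_transform_eventually)
qed

lemma poly_degree_le_of_bound:
  fixes L N :: "complex poly"
  assumes le: "\<forall>\<^sub>F n in sequentially. norm (poly L (of_nat n)) \<le> B * norm (poly N (of_nat n))"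
    and "L \<noteq> 0"
  shows "degree L \<le> degree N"
proof (rule ccontr)
  assume "\<not> ?thesis"
  then have d: "degree N < degree L" by simp
  define d where "d = degree L - degree N"
  have "((\<lambda>n. (B * norm (poly N (of_nat n) / of_nat n ^ degree N)) * inverse (real n ^ d))
      \<longlongrightarrow> (B * norm (lead_coeff N)) * 0) sequentially"
    using d by (intro tendsto_intros filterlim_compose[OF poly_over_power_tendsto tendsto_of_nat]
        tendsto_inverse_0_at_top filterlim_pow_at_top filterlim_real_sequentially) (auto simp: d_def)
  moreover have "((\<lambda>n. norm (poly L (of_nat n) / of_nat n ^ degree L)) \<longlongrightarrow> norm (lead_coeff L)) sequentially"
    by (intro tendsto_norm filterlim_compose[OF poly_over_power_tendsto tendsto_of_nat])
  moreover have "\<forall>\<^sub>F n in sequentially. norm (poly L (of_nat n) / of_nat n ^ degree L) \<le>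
       (B * norm (poly N (of_nat n) / of_nat n ^ degree N)) * inverse (real n ^ d)"
    using le eventually_gt_at_top[of 0]
  proof eventually_elim
    case (elim n)
    have "real n ^ degree L = real n ^ degree N * real n ^ d"
      using d by (simp add: d_def flip: power_add)
    then show ?case
      using elim by (simp add: norm_divide norm_power field_simps)
  qed
  ultimately have "norm (lead_coeff L) \<le> (B * norm (lead_coeff N)) * 0"
    by (intro tendsto_le[OF sequentially_bot])
  then show False using \<open>L \<noteq> 0\<close> by simp
qed

text \<open>For polynomials a bound along the positive integers amounts to a comparison of degrees
  and so holds in every direction. This moves an estimate from the points n to the points - k /
  r.\<close>

lemma poly_dominated_at_infinity:
  fixes L N :: "complex poly"
  assumes N: "N \<noteq> 0" and le: "\<forall>\<^sub>F n in sequentially. norm (poly L (of_nat n)) \<le> B * norm (poly N (of_nat n))"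
  shows "\<exists>B'. \<forall>\<^sub>F w in at_infinity. norm (poly L w) \<le> B' * norm (poly N w) \<and> poly N w \<noteq> 0"
proof -
  have Nw: "\<forall>\<^sub>F w in at_infinity. norm (poly N w / w ^ degree N) > norm (lead_coeff N) / 2"
    using N by (intro order_tendstoD(1)[OF tendsto_norm[OF poly_over_power_tendsto]]) auto
  have Lw: "\<forall>\<^sub>F w in at_infinity. norm (poly L w / w ^ degree L) < norm (lead_coeff L) + 1"
    by (intro order_tendstoD(2)[OF tendsto_norm[OF poly_over_power_tendsto]]) auto
  have deg: "degree L \<le> degree N"
    using poly_degree_le_of_bound[OF le] by (cases "L = 0") auto
  define B' where "B' = (norm (lead_coeff L) + 1) * (2 / norm (lead_coeff N))"
  have ge1: "\<forall>\<^sub>F w::complex in at_infinity. norm w \<ge> 1"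
    unfolding eventually_at_infinity by blast
  have "\<forall>\<^sub>F w in at_infinity. norm (poly L w) \<le> B' * norm (poly N w) \<and> poly N w \<noteq> 0"
    using Nw Lw ge1
  proof eventually_elim
    case (elim w)
    have n0: "norm (lead_coeff N) > 0" using N by simp
    have wp: "norm w ^ degree N > 0" "norm w ^ degree L > 0" using elim(3) by (auto intro!: zero_less_power simp del: zero_less_norm_iff)
    have 1: "norm w ^ degree N \<le> 2 / norm (lead_coeff N) * norm (poly N w)"
      using elim(1) n0 wp by (simp add: norm_divide norm_power field_simps)
    have "norm (poly L w) \<le> (norm (lead_coeff L) + 1) * norm w ^ degree L"
      using elim(2) wp by (simp add: norm_divide norm_power field_simps)
    also have "\<dots> \<le> (norm (lead_coeff L) + 1) * norm w ^ degree N"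
      using elim(3) deg by (intro mult_left_mono power_increasing) auto
    also have "\<dots> \<le> (norm (lead_coeff L) + 1) * (2 / norm (lead_coeff N) * norm (poly N w))"
      using 1 by (intro mult_left_mono) auto
    finally have "norm (poly L w) \<le> B' * norm (poly N w)" by (simp only: B'_def mult.assoc)
    moreover have "poly N w \<noteq> 0" using 1 wp by auto
    ultimately show ?case by simp
  qed
  then show ?thesis by blast
qed

text \<open>A quotient tending to 1 bounds each polynomial by twice the other, so the degrees agree;
  the limit then compares the leading coefficients.\<close>

lemma poly_same_leading_term:
  fixes p q :: "complex poly"
  assumes q: "q \<noteq> 0" and lim: "(\<lambda>n. poly p (of_nat n) / poly q (of_nat n)) \<longlonglongrightarrow> 1"
  shows "degree p = degree q" "lead_coeff p = lead_coeff q"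
proof -
  have qn: "\<forall>\<^sub>F n in sequentially. poly q (of_nat n) \<noteq> 0"
  proof -
    have "finite {z. poly q z = 0}" using q by (rule poly_roots_finite)
    then have "finite ((of_nat :: nat \<Rightarrow> complex) -` {z. poly q z = 0})"
      by (rule finite_vimageI) (rule inj_of_nat)
    then show ?thesis unfolding cofinite_eq_sequentially[symmetric] eventually_cofinite by simp
  qed
  have 1: "\<forall>\<^sub>F n in sequentially. norm (poly p (of_nat n)) \<le> 2 * norm (poly q (of_nat n))"
  proof -
    have "\<forall>\<^sub>F n in sequentially. norm (poly p (of_nat n) / poly q (of_nat n)) < 2"
      by (rule order_tendstoD(2)[OF tendsto_norm[OF lim]]) simp
    then show ?thesis using qn by eventually_elim (simp add: norm_divide field_simps)
  qed
  have 2: "\<forall>\<^sub>F n in sequentially. norm (poly q (of_nat n)) \<le> 2 * norm (poly p (of_nat n))"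
  proof -
    have "\<forall>\<^sub>F n in sequentially. norm (poly p (of_nat n) / poly q (of_nat n)) > 1 / 2"
      by (rule order_tendstoD(1)[OF tendsto_norm[OF lim]]) simp
    then show ?thesis using qn by eventually_elim (simp add: norm_divide field_simps)
  qed
  have "p \<noteq> 0"
    using lim LIMSEQ_unique[OF tendsto_const[of 0 sequentially]] by fastforce
  then show deg: "degree p = degree q"
    using poly_degree_le_of_bound[OF 1] poly_degree_le_of_bound[OF 2] q by simp
  have lp: "(\<lambda>n. poly r (of_nat n) / of_nat n ^ degree r) \<longlonglongrightarrow> lead_coeff r" for r :: "complex poly"
    by (rule filterlim_compose[OF poly_over_power_tendsto tendsto_of_nat])
  have "(\<lambda>n. (poly p (of_nat n) / poly q (of_nat n)) * (poly q (of_nat n) / of_nat n ^ degree q)) \<longlonglongrightarrow> 1 * lead_coeff q"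
    by (intro tendsto_mult lim lp)
  moreover have "\<forall>\<^sub>F n in sequentially. (poly p (of_nat n) / poly q (of_nat n)) * (poly q (of_nat n) / of_nat n ^ degree q) = poly p (of_nat n) / of_nat n ^ degree p"
    using qn by eventually_elim (simp add: deg)
  ultimately have "(\<lambda>n. poly p (of_nat n) / of_nat n ^ degree p) \<longlonglongrightarrow> lead_coeff q"
    using Lim_transform_eventually by fastforce
  then show "lead_coeff p = lead_coeff q"
    using lp[of p] LIMSEQ_unique by blast
qed

lemma complex_poly_linear_factors:
  fixes p :: "complex poly"
  assumes "degree p = n"
  shows "\<exists>v. p = smult (lead_coeff p) (\<Prod>i<n. [:v i, 1:])"
  using assms
proof (induction n arbitrary: p)
  case 0
  then show ?case by (auto elim: degree_eq_zeroE)
next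
  case (Suc n)
  then have "degree p > 0" by simp
  then obtain z where "poly p z = 0" using alg_closed_imp_poly_has_root by blast
  then obtain q where q: "p = [:- z, 1:] * q" by (auto simp: poly_eq_0_iff_dvd)
  then have "q \<noteq> 0" using Suc.prems by auto
  then have "degree p = Suc (degree q)" unfolding q by (subst degree_mult_eq) auto
  then have "degree q = n" using Suc.prems by simp
  from Suc.IH[OF this] obtain v where v: "q = smult (lead_coeff q) (\<Prod>i<n. [:v i, 1:])" by blast
  have "lead_coeff p = lead_coeff q" unfolding q by (simp add: lead_coeff_mult del: mult_pCons_left)
  moreover have "(\<Prod>i<Suc n. [:(v(n := - z)) i, 1:]) = (\<Prod>i<n. [:v i, 1:]) * [:- z, 1:]"
    by (simp cong: prod.cong_simp)
  ultimately have "p = smult (lead_coeff p) (\<Prod>i<Suc n. [:(v(n := - z)) i, 1:])"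
    by (subst q, subst v) (simp only: mult_smult_right mult.commute)
  then show ?case by blast
qed

text \<open>The sequence is n^s. Passing from n to k n multiplies it by k^s, so k^s = 1 for every k
  > 0. For consecutive integers with |s| ln ((n + 1) / n) < 1, the only admissible multiple of 2
  \<pi> i is 0.\<close>

lemma exp_ln_tendsto_imp_zero:
  fixes s K :: complex
  assumes lim: "(\<lambda>n. exp (s * of_real (ln (real n)))) \<longlonglongrightarrow> K" and K: "K \<noteq> 0"
  shows "s = 0"
proof -
  have 1: "exp (s * of_real (ln (real k))) = 1" if k: "k > 0" for k
  proof -
    have "filterlim (\<lambda>n. k * n) sequentially sequentially"
      using k by (intro filterlim_subseq) (auto simp: strict_mono_def)
    then have A: "(\<lambda>n. exp (s * of_real (ln (real (k * n))))) \<longlonglongrightarrow> K"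
      by (rule filterlim_compose[OF lim])
    have B: "\<forall>\<^sub>F n in sequentially. exp (s * of_real (ln (real k))) * exp (s * of_real (ln (real n))) = exp (s * of_real (ln (real (k * n))))"
      using eventually_gt_at_top[of 0]
      by eventually_elim (use k in \<open>auto simp: ln_mult exp_add[symmetric] algebra_simps\<close>)
    have C: "(\<lambda>n. exp (s * of_real (ln (real k))) * exp (s * of_real (ln (real n)))) \<longlonglongrightarrow> exp (s * of_real (ln (real k))) * K"
      by (intro tendsto_intros lim)
    have "exp (s * of_real (ln (real k))) * K = K"
      by (rule LIMSEQ_unique[OF Lim_transform_eventually[OF C B] A])
    then show ?thesis using K by simp
  qed
  have "(\<lambda>n. norm s * (ln (real n + 1) - ln (real n))) \<longlonglongrightarrow> norm s * 0"
    by (intro tendsto_mult tendsto_const) real_asymp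
  then have "\<forall>\<^sub>F n in sequentially. norm s * (ln (real n + 1) - ln (real n)) < 1"
    by (rule order_tendstoD) simp
  then have "\<forall>\<^sub>F n in sequentially. norm s * (ln (real n + 1) - ln (real n)) < 1 \<and> n > 0"
    using eventually_gt_at_top[of 0] by eventually_elim auto
  then obtain n where n: "norm s * (ln (real n + 1) - ln (real n)) < 1" "n > 0"
    by (auto simp: eventually_sequentially)
  define \<delta> where "\<delta> = ln (real n + 1) - ln (real n)"
  have \<delta>: "\<delta> > 0" using n by (simp add: \<delta>_def)
  have "exp (s * of_real \<delta>) = exp (s * of_real (ln (real (Suc n)))) / exp (s * of_real (ln (real n)))"
    by (simp add: \<delta>_def exp_diff[symmetric] algebra_simps)
  also have "\<dots> = 1" using 1[of n] 1[of "Suc n"] n(2) by simp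
  finally obtain m :: int where m: "Re (s * of_real \<delta>) = 0" "Im (s * of_real \<delta>) = of_int (2 * m) * pi"
    by (auto simp: exp_eq_1)
  have "\<bar>Im (s * of_real \<delta>)\<bar> < 1"
  proof -
    have "norm (s * of_real \<delta>) < 1"
      using n(1)[folded \<delta>_def] \<delta> by (simp add: norm_mult)
    then show ?thesis using abs_Im_le_cmod order_le_less_trans by blast
  qed
  then have "\<bar>real_of_int (2 * m) * pi\<bar> < 1" unfolding m(2) .
  then have "\<bar>2 * m\<bar> * pi < 1" by (simp add: abs_mult)
  then have "m = 0"
  proof (cases "m = 0")
    case False
    then have "real_of_int \<bar>2 * m\<bar> \<ge> 1" by linarith
    then have "real_of_int \<bar>2 * m\<bar> * pi \<ge> 1 * 3" using pi_gt3 by (intro mult_mono) auto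
    with \<open>\<bar>2 * m\<bar> * pi < 1\<close> show ?thesis by simp
  qed
  then have "s * of_real \<delta> = 0" using m by (simp add: complex_eq_iff)
  then show ?thesis using \<delta> by simp
qed

lemma not_nonpos_IntsI: "Re z > 0 \<Longrightarrow> z \<notin> \<int>\<^sub>\<le>\<^sub>0" for z :: complex
  by (auto elim!: nonpos_Ints_cases)

text \<open>Iterating n times compares f(t) with the products (n - 1)! n^z / (z)_n, which converge
  to Gamma z. What is left over is n^s with s = \<Sum>(v i - u i); its limit exists and is nonzero,
  so s = 0. Everything stays on the real axis, where the Laplace estimate is available.\<close>

lemma gamma_product_of_recurrence:
  fixes f :: "complex \<Rightarrow> complex" and u v :: "nat \<Rightarrow> complex" and \<kappa> L :: complex
  assumes lim: "((\<lambda>t::real. f (of_real t)) \<longlongrightarrow> L) at_top" and L: "L \<noteq> 0"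
    and rec: "\<forall>\<^sub>F t::real in at_top. f (of_real t) * (\<Prod>i<R. of_real t + u i) = \<kappa> * (\<Prod>i<R. of_real t + v i) * f (of_real t + 1)"
  shows "\<kappa> = 1" and "(\<Sum>i<R. v i) = (\<Sum>i<R. u i)"
    and "\<forall>\<^sub>F t::real in at_top. f (of_real t) * (\<Prod>i<R. rGamma (of_real t + u i)) = L * (\<Prod>i<R. rGamma (of_real t + v i))"
proof -
  have lim1: "((\<lambda>t::real. f (of_real t + 1)) \<longlongrightarrow> L) at_top"
  proof -
    have "filterlim (\<lambda>t::real. t + 1) at_top at_top" by real_asymp
    from filterlim_compose[OF lim this] show ?thesis by simp
  qed
  have prod_lim: "((\<lambda>t::real. \<Prod>i<R. (of_real t + w i) / of_real t) \<longlongrightarrow> (\<Prod>i<R. 1)) at_top" for w :: "nat \<Rightarrow> complex"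
  proof (rule tendsto_prod)
    fix i
    have "((\<lambda>t::real. 1 + w i / of_real t) \<longlongrightarrow> 1 + 0) at_top"
      by (intro tendsto_intros tendsto_divide_0[OF tendsto_const] filterlim_of_real_at_infinity)
    then have "((\<lambda>t::real. 1 + w i / of_real t) \<longlongrightarrow> 1) at_top"
      by simp
    then show "((\<lambda>t::real. (of_real t + w i) / of_real t) \<longlongrightarrow> 1) at_top"
    proof (rule Lim_transform_eventually)
      show "\<forall>\<^sub>F t::real in at_top. 1 + w i / of_real t = (of_real t + w i) / of_real t"
        using eventually_gt_at_top[of 0] by eventually_elim (auto simp: field_simps)
    qed
  qed
  show \<kappa>: "\<kappa> = 1"
  proof -
    have A: "((\<lambda>t::real. f (of_real t) * (\<Prod>i<R. (of_real t + u i) / of_real t)) \<longlongrightarrow> L * (\<Prod>i<R. 1)) at_top"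
      by (intro tendsto_mult lim prod_lim)
    have B: "((\<lambda>t::real. \<kappa> * (\<Prod>i<R. (of_real t + v i) / of_real t) * f (of_real t + 1)) \<longlongrightarrow> \<kappa> * (\<Prod>i<R. 1) * L) at_top"
      by (intro tendsto_mult lim1 prod_lim tendsto_const)
    have C: "\<forall>\<^sub>F t::real in at_top. f (of_real t) * (\<Prod>i<R. (of_real t + u i) / of_real t) = \<kappa> * (\<Prod>i<R. (of_real t + v i) / of_real t) * f (of_real t + 1)"
      using rec by eventually_elim (simp add: prod_dividef)
    have "L * (\<Prod>i<R. 1) = \<kappa> * (\<Prod>i<R. 1) * L"
      by (rule tendsto_unique[OF trivial_limit_at_top_linorder Lim_transform_eventually[OF A C] B])
    then show ?thesis using L by simp
  qed
  obtain t0 where t0: "\<And>t. t \<ge> t0 \<Longrightarrow> f (of_real t) * (\<Prod>i<R. of_real t + u i) = (\<Prod>i<R. of_real t + v i) * f (of_real t + 1)"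
    using rec unfolding eventually_at_top_linorder \<kappa> by auto
  have "\<forall>\<^sub>F t in at_top. f (of_real t) \<noteq> 0"
    using tendsto_imp_eventually_ne[OF lim L] .
  then obtain t1 where t1: "\<And>t. t \<ge> t1 \<Longrightarrow> f (of_real t) \<noteq> 0"
    unfolding eventually_at_top_linorder by auto
  \<comment> \<open>Beyond \<open>t2\<close> the recurrence holds, f has no zeros, and all Gamma
    arguments lie in the right half-plane.\<close>
  define t2 where "t2 = Max (insert t0 (insert t1 ((\<lambda>i. norm (u i) + norm (v i) + 1) ` {..<R})))"
  have t2: "t2 \<ge> t0" "t2 \<ge> t1" "\<And>i. i < R \<Longrightarrow> t2 \<ge> norm (u i) + norm (v i) + 1"
    unfolding t2_def by (rule Max_ge; simp)+
  have pos: "of_real t + u i \<notin> \<int>\<^sub>\<le>\<^sub>0" "of_real t + v i \<notin> \<int>\<^sub>\<le>\<^sub>0" if "t \<ge> t2" "i < R" for t i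
  proof -
    have "Re (u i) \<ge> - norm (u i)" "Re (v i) \<ge> - norm (v i)"
      using abs_Re_le_cmod[of "u i"] abs_Re_le_cmod[of "v i"] by linarith+
    then have "Re (of_real t + u i) > 0" "Re (of_real t + v i) > 0"
      using t2(3)[OF that(2)] that(1) norm_ge_zero[of "u i"] norm_ge_zero[of "v i"] unfolding Re_complex_of_real plus_complex.sel
      by linarith+
    then show "of_real t + u i \<notin> \<int>\<^sub>\<le>\<^sub>0" "of_real t + v i \<notin> \<int>\<^sub>\<le>\<^sub>0"
      by (simp_all only: not_nonpos_IntsI not_False_eq_True)
  qed
  define s where "s = (\<Sum>i<R. v i - u i)"
  have iter: "f (of_real t) * (\<Prod>i<R. pochhammer (of_real t + u i) n) = (\<Prod>i<R. pochhammer (of_real t + v i) n) * f (of_real t + of_nat n)"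
    if "t \<ge> t2" for t n
  proof (induction n)
    case (Suc n)
    have "f (of_real t) * (\<Prod>i<R. pochhammer (of_real t + u i) (Suc n))
        = (f (of_real t) * (\<Prod>i<R. pochhammer (of_real t + u i) n)) * (\<Prod>i<R. of_real (t + real n) + u i)"
      by (simp add: pochhammer_Suc prod.distrib add_ac)
    also have "\<dots> = (\<Prod>i<R. pochhammer (of_real t + v i) n) * (f (of_real (t + real n)) * (\<Prod>i<R. of_real (t + real n) + u i))"
      unfolding Suc by simp
    also have "f (of_real (t + real n)) * (\<Prod>i<R. of_real (t + real n) + u i) = (\<Prod>i<R. of_real (t + real n) + v i) * f (of_real (t + real n) + 1)"
      using that t2 by (intro t0) auto
    finally show ?case by (simp add: pochhammer_Suc prod.distrib add_ac mult_ac)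
  qed auto
  have key: "(\<lambda>n. exp (s * of_real (ln (real n)))) \<longlonglongrightarrow>
      f (of_real t) * (\<Prod>i<R. Gamma (of_real t + v i)) / (\<Prod>i<R. Gamma (of_real t + u i)) / L" if t: "t \<ge> t2" for t
  proof -
    have lim_n: "(\<lambda>n. f (of_real t + of_nat n)) \<longlonglongrightarrow> L"
    proof -
      have "filterlim (\<lambda>n. t + real n) at_top sequentially" by real_asymp
      from filterlim_compose[OF lim this] show ?thesis by simp
    qed
    have "(\<lambda>n. f (of_real t) * (\<Prod>i<R. Gamma_series' (of_real t + v i) n) / (\<Prod>i<R. Gamma_series' (of_real t + u i) n) / f (of_real t + of_nat n))
      \<longlonglongrightarrow> f (of_real t) * (\<Prod>i<R. Gamma (of_real t + v i)) / (\<Prod>i<R. Gamma (of_real t + u i)) / L"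
      using pos[OF t] L
      by (intro tendsto_intros Gamma_series'_LIMSEQ lim_n) (auto simp: Gamma_eq_zero_iff)
    moreover have "\<forall>\<^sub>F n in sequentially. f (of_real t) * (\<Prod>i<R. Gamma_series' (of_real t + v i) n) / (\<Prod>i<R. Gamma_series' (of_real t + u i) n) / f (of_real t + of_nat n)
        = exp (s * of_real (ln (real n)))"
      using eventually_gt_at_top[of 0]
    proof eventually_elim
      case (elim n)
      have nz: "f (of_real t + of_nat n) \<noteq> 0" using t1[of "t + real n"] t t2 by simp
      have pu: "(\<Prod>i<R. pochhammer (of_real t + u i) n) \<noteq> 0" "(\<Prod>i<R. pochhammer (of_real t + v i) n) \<noteq> 0"
      proof -
        have "pochhammer y n \<noteq> 0" if "y \<notin> \<int>\<^sub>\<le>\<^sub>0" for y :: complex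
          using that by (auto simp: pochhammer_eq_0_iff)
        then show "(\<Prod>i<R. pochhammer (of_real t + u i) n) \<noteq> 0" "(\<Prod>i<R. pochhammer (of_real t + v i) n) \<noteq> 0"
          using pos[OF t] by auto
      qed
      have G: "(\<Prod>i<R. Gamma_series' (of_real t + w i) n) = fact (n - 1) ^ R * exp ((\<Sum>i<R. of_real t + w i) * of_real (ln (real n))) / (\<Prod>i<R. pochhammer (of_real t + w i) n)"
        for w :: "nat \<Rightarrow> complex"
        by (simp add: Gamma_series'_def prod_dividef prod.distrib exp_sum sum_distrib_right)
      have "f (of_real t) * (\<Prod>i<R. Gamma_series' (of_real t + v i) n) / (\<Prod>i<R. Gamma_series' (of_real t + u i) n) / f (of_real t + of_nat n)
         = exp ((\<Sum>i<R. of_real t + v i) * of_real (ln (real n))) / exp ((\<Sum>i<R. of_real t + u i) * of_real (ln (real n))) *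
           ((f (of_real t) * (\<Prod>i<R. pochhammer (of_real t + u i) n)) / ((\<Prod>i<R. pochhammer (of_real t + v i) n) * f (of_real t + of_nat n)))"
        unfolding G by (simp add: field_simps)
      also have "\<dots> = exp ((\<Sum>i<R. of_real t + v i) * of_real (ln (real n))) / exp ((\<Sum>i<R. of_real t + u i) * of_real (ln (real n)))"
        unfolding iter[OF t] using nz pu by simp
      also have "\<dots> = exp (((\<Sum>i<R. of_real t + v i) - (\<Sum>i<R. of_real t + u i)) * of_real (ln (real n)))"
        by (simp add: exp_diff left_diff_distrib)
      also have "(\<Sum>i<R. of_real t + v i) - (\<Sum>i<R. of_real t + u i) = s"
        by (simp add: s_def sum.distrib sum_subtractf)
      finally show ?case .
    qed
    ultimately show ?thesis by (rule Lim_transform_eventually)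
  qed
  have "f (of_real t) * (\<Prod>i<R. Gamma (of_real t + v i)) / (\<Prod>i<R. Gamma (of_real t + u i)) / L \<noteq> 0" if "t \<ge> t2" for t
    using that pos[OF that] t1[of t] t2 L by (auto simp: Gamma_eq_zero_iff)
  then have s: "s = 0" using exp_ln_tendsto_imp_zero[OF key] by blast
  then show "(\<Sum>i<R. v i) = (\<Sum>i<R. u i)" by (simp add: s_def sum_subtractf)
  have "f (of_real t) * (\<Prod>i<R. rGamma (of_real t + u i)) = L * (\<Prod>i<R. rGamma (of_real t + v i))" if "t \<ge> t2" for t
  proof -
    have "f (of_real t) * (\<Prod>i<R. Gamma (of_real t + v i)) / (\<Prod>i<R. Gamma (of_real t + u i)) / L = 1"
      using key[OF that] unfolding s by (simp add: LIMSEQ_const_iff)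
    moreover have "(\<Prod>i<R. Gamma (of_real t + v i)) \<noteq> 0" "(\<Prod>i<R. Gamma (of_real t + u i)) \<noteq> 0"
      using pos[OF that] by (auto simp: Gamma_eq_zero_iff)
    moreover have r: "(\<Prod>i<R. rGamma (of_real t + w i)) = inverse (\<Prod>i<R. Gamma (of_real t + w i))" for w :: "nat \<Rightarrow> complex"
      by (simp add: rGamma_inverse_Gamma prod_inversef[symmetric] comp_def)
    ultimately show ?thesis
      unfolding r using L by (simp add: field_simps)
  qed
  then show "\<forall>\<^sub>F t::real in at_top. f (of_real t) * (\<Prod>i<R. rGamma (of_real t + u i)) = L * (\<Prod>i<R. rGamma (of_real t + v i))"
    unfolding eventually_at_top_linorder by blast
qed

lemma entire_eqI_at_top:
  fixes f g :: "complex \<Rightarrow> complex"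
  assumes "f holomorphic_on UNIV" "g holomorphic_on UNIV"
    and "\<forall>\<^sub>F t::real in at_top. f (of_real t) = g (of_real t)"
  shows "f w = g w"
proof -
  obtain t0 where t0: "\<And>t. t \<ge> t0 \<Longrightarrow> f (of_real t) = g (of_real t)"
    using assms(3) unfolding eventually_at_top_linorder by blast
  have "(\<lambda>z. f z - g z) w = 0"
  proof (rule analytic_continuation[where f = "\<lambda>z. f z - g z" and S = UNIV and U = "of_real ` {t0..}" and \<xi> = "of_real t0"])
    show "(\<lambda>z. f z - g z) holomorphic_on UNIV" by (intro holomorphic_intros assms)
    show "of_real t0 islimpt (of_real ` {t0..} :: complex set)"
    proof (subst islimpt_approachable, intro allI impI)
      fix e :: real assume "e > 0"
      then show "\<exists>x'\<in>of_real ` {t0..}. x' \<noteq> complex_of_real t0 \<and> dist x' (complex_of_real t0) < e"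
        by (intro bexI[of _ "of_real (t0 + e / 2)"] imageI) (auto simp: dist_norm norm_divide)
    qed
  qed (use t0 in auto)
  then show ?thesis by simp
qed

section \<open>Poles and rational independence\<close>

lemma rhyp_real_sums:
  assumes z: "0 < x" "x < 1"
    and t: "\<And>n. rhyp_coeff a b c n * of_real x ^ n = of_real (t n)"
  shows "t sums Re (rhyp a b c (of_real x))" "rhyp a b c (of_real x) = of_real (Re (rhyp a b c (of_real x)))"
    and "(\<lambda>n. real n * t n) sums Re (rhyp_theta a b c (of_real x))" "rhyp_theta a b c (of_real x) = of_real (Re (rhyp_theta a b c (of_real x)))"
proof -
  have x: "norm (of_real x :: complex) < 1" using z by simp
  have 1: "(\<lambda>n. complex_of_real (t n)) sums rhyp a b c (of_real x)"
    using rhyp_sums(1)[OF x, of a b c] by (simp add: t)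
  have 2: "(\<lambda>n. complex_of_real (real n * t n)) sums rhyp_theta a b c (of_real x)"
    using rhyp_sums(2)[OF x, of a b c] by (simp add: t mult.assoc)
  show "t sums Re (rhyp a b c (of_real x))" using sums_Re[OF 1] by simp
  then show "rhyp a b c (of_real x) = of_real (Re (rhyp a b c (of_real x)))"
    using 1 sums_of_real sums_unique2 by blast
  show "(\<lambda>n. real n * t n) sums Re (rhyp_theta a b c (of_real x))" using sums_Re[OF 2] by simp
  then show "rhyp_theta a b c (of_real x) = of_real (Re (rhyp_theta a b c (of_real x)))"
    using 2 sums_of_real sums_unique2 by blast
qed

lemma pochhammer_mono_real:
  fixes a b :: real
  assumes "0 \<le> a" "a \<le> b"
  shows "pochhammer a n \<le> pochhammer b n"
  unfolding pochhammer_prod using assms by (intro prod_mono) auto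

text \<open>Relative to the first term all coefficients lie in [0, 1], because (\<alpha>)_n \<le>
  (\<gamma>)_n and (1/2)_n \<le> n!. So F is at least its first term and T at most a constant
  multiple of it, with a constant independent of \<alpha> and \<gamma>.\<close>

lemma rhyp_theta_le_rhyp:
  assumes x: "0 < x" "x < 1" and \<alpha>: "0 < \<alpha>" "\<alpha> \<le> \<gamma>"
  shows "rhyp (of_real \<alpha>) (1/2) (of_real \<gamma>) (of_real x) \<noteq> 0"
    and "norm (rhyp_theta (of_real \<alpha>) (1/2) (of_real \<gamma>) (of_real x))
      \<le> (\<Sum>n. real n * x ^ n) * norm (rhyp (of_real \<alpha>) (1/2) (of_real \<gamma>) (of_real x))"
proof -
  define G :: real where "G = rGamma \<gamma>"
  have G: "G > 0" using \<alpha> Gamma_real_pos[of \<gamma>] by (simp add: G_def rGamma_inverse_Gamma)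
  define d where "d n = pochhammer \<alpha> n * pochhammer (1/2) n / (pochhammer \<gamma> n * fact n)" for n
  define t where "t n = G * (d n * x ^ n)" for n
  have t: "rhyp_coeff (of_real \<alpha>) (1/2) (of_real \<gamma>) n * of_real x ^ n = of_real (t n)" for n
  proof -
    have "pochhammer \<gamma> n \<noteq> 0" using \<alpha> pochhammer_pos[of \<gamma> n] by simp
    then have "rGamma (\<gamma> + real n) = G / pochhammer \<gamma> n"
      using pochhammer_rGamma[of \<gamma> n] by (simp add: G_def field_simps)
    then have "rGamma (complex_of_real \<gamma> + of_nat n) = of_real (G / pochhammer \<gamma> n)"
      using rGamma_complex_of_real[of "\<gamma> + real n"] by simp
    moreover have "pochhammer (1/2::complex) n = of_real (pochhammer (1/2) n)"
      using pochhammer_of_real[of "1/2" n, where 'a = complex] by simp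
    ultimately show ?thesis
      by (simp add: rhyp_coeff_def t_def d_def pochhammer_of_real)
  qed
  have d: "0 \<le> d n" "d n \<le> 1" for n
  proof -
    have "0 \<le> pochhammer \<alpha> n" "pochhammer \<alpha> n \<le> pochhammer \<gamma> n" "pochhammer \<gamma> n > 0"
      using \<alpha> by (auto intro!: pochhammer_nonneg pochhammer_pos pochhammer_mono_real)
    moreover have "0 \<le> pochhammer (1/2::real) n" "pochhammer (1/2::real) n \<le> fact n"
      using pochhammer_mono_real[of "1/2" 1 n] by (auto intro!: pochhammer_nonneg simp: pochhammer_fact)
    ultimately show "0 \<le> d n" "d n \<le> 1"
      by (auto simp: d_def intro!: mult_mono)
  qed
  note s = rhyp_real_sums[OF x t]
  have "G \<le> Re (rhyp (of_real \<alpha>) (1/2) (of_real \<gamma>) (of_real x))"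
  proof -
    have "sum t {..<1} \<le> suminf t"
    proof (rule sum_le_suminf[OF sums_summable[OF s(1)]])
      show "0 \<le> t n" for n using x G d by (simp add: t_def)
    qed simp
    moreover have "suminf t = Re (rhyp (of_real \<alpha>) (1/2) (of_real \<gamma>) (of_real x))"
      using s(1) by (rule sums_unique[symmetric])
    moreover have "sum t {..<1} = G" by (simp add: t_def d_def)
    ultimately show ?thesis by simp
  qed
  then have F: "G \<le> norm (rhyp (of_real \<alpha>) (1/2) (of_real \<gamma>) (of_real x))"
    using complex_Re_le_cmod order_trans by blast
  then show "rhyp (of_real \<alpha>) (1/2) (of_real \<gamma>) (of_real x) \<noteq> 0" using G by auto
  have sx: "summable (\<lambda>n. real n * x ^ n)"
  proof (rule summable_comparison_test')
    show "summable (\<lambda>n. of_nat (Suc n) * x ^ n)"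
      using geometric_deriv_sums[of x] x by (auto simp: sums_iff)
    show "norm (real n * x ^ n) \<le> of_nat (Suc n) * x ^ n" for n
      using x by (auto simp: abs_mult intro!: mult_right_mono)
  qed
  have "0 \<le> Re (rhyp_theta (of_real \<alpha>) (1/2) (of_real \<gamma>) (of_real x))"
    by (rule sums_le[OF _ sums_zero s(3)]) (use x G d in \<open>simp add: t_def\<close>)
  then have "norm (rhyp_theta (of_real \<alpha>) (1/2) (of_real \<gamma>) (of_real x)) = Re (rhyp_theta (of_real \<alpha>) (1/2) (of_real \<gamma>) (of_real x))"
    by (metis s(4) norm_of_real abs_of_nonneg)
  also have "\<dots> = (\<Sum>n. real n * t n)" using s(3) by (simp add: sums_iff)
  also have "\<dots> \<le> (\<Sum>n. (real n * x ^ n) * G)"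
  proof (rule suminf_le)
    show "real n * t n \<le> (real n * x ^ n) * G" for n
    proof -
      have "real n * t n = (real n * x ^ n * G) * d n" by (simp add: t_def)
      also have "\<dots> \<le> real n * x ^ n * G" using d x G by (intro mult_left_le) auto
      finally show ?thesis .
    qed
  qed (use s(3) sx in \<open>auto simp: sums_iff intro: summable_mult2\<close>)
  also have "\<dots> = (\<Sum>n. real n * x ^ n) * G" using sx by (rule suminf_mult2[symmetric])
  also have "\<dots> \<le> (\<Sum>n. real n * x ^ n) * norm (rhyp (of_real \<alpha>) (1/2) (of_real \<gamma>) (of_real x))"
    using F sx x by (intro mult_left_mono suminf_nonneg) auto
  finally show "norm (rhyp_theta (of_real \<alpha>) (1/2) (of_real \<gamma>) (of_real x))
      \<le> (\<Sum>n. real n * x ^ n) * norm (rhyp (of_real \<alpha>) (1/2) (of_real \<gamma>) (of_real x))" .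
qed

text \<open>If the lower parameter is \<open>- k\<close>, then the regularized series starts at the power \<open>k + 1\<close>.\<close>

lemma rhyp_theta_ge_rhyp:
  assumes x: "0 < x" "x < 1" and \<alpha>: "\<alpha> + real k > 0"
  shows "real k * norm (rhyp (of_real \<alpha>) (1/2) (- of_nat k) (of_real x)) \<le> norm (rhyp_theta (of_real \<alpha>) (1/2) (- of_nat k) (of_real x))"
proof -
  define t where "t n = pochhammer \<alpha> n * pochhammer (1/2) n * rGamma (- real k + real n) / fact n * x ^ n" for n
  have t: "rhyp_coeff (of_real \<alpha>) (1/2) (- of_nat k) n * of_real x ^ n = of_real (t n)" for n
  proof -
    have "rGamma (- of_nat k + of_nat n :: complex) = of_real (rGamma (- real k + real n))"
      using rGamma_complex_of_real[of "- real k + real n"] by simp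
    moreover have "pochhammer (1/2::complex) n = of_real (pochhammer (1/2) n)"
      using pochhammer_of_real[of "1/2" n, where 'a = complex] by simp
    ultimately show ?thesis
      by (simp add: rhyp_coeff_def t_def pochhammer_of_real)
  qed
  have t0: "t n = 0" if "n \<le> k" for n
  proof -
    have "- real k + real n = - real (k - n)" using that by simp
    then have "- real k + real n \<in> \<int>\<^sub>\<le>\<^sub>0" by (simp only: minus_of_nat_in_nonpos_Ints)
    then show ?thesis by (simp add: t_def rGamma_eq_zero_iff)
  qed
  \<comment> \<open>Since \<alpha> + k > 0, all terms past n = k have the sign of (\<alpha>)_k or
    vanish. After multiplication by \<open>\<sigma>\<close> nothing cancels, and each surviving term
    carries a weight n > k in the Euler derivative.\<close>
  define \<sigma> :: real where "\<sigma> = (if pochhammer \<alpha> k \<ge> 0 then 1 else -1)"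
  have \<sigma>t: "\<sigma> * t n \<ge> 0" for n
  proof (cases "n \<le> k")
    case False
    then have n: "pochhammer \<alpha> n = pochhammer \<alpha> k * pochhammer (\<alpha> + real k) (n - k)"
      using pochhammer_product[of k n \<alpha>] by simp
    have 1: "\<sigma> * pochhammer \<alpha> k \<ge> 0" by (auto simp: \<sigma>_def)
    have 2: "pochhammer (\<alpha> + real k) (n - k) \<ge> 0" using \<alpha> by (intro pochhammer_nonneg) auto
    have 3: "pochhammer (1/2::real) n \<ge> 0" by (intro pochhammer_nonneg) auto
    have 4: "rGamma (- real k + real n) \<ge> 0"
      using False Gamma_real_pos[of "- real k + real n"] by (simp add: rGamma_inverse_Gamma)
    have 5: "x ^ n / fact n \<ge> 0" using x by simp
    note mult_nonneg_nonneg[OF 1 mult_nonneg_nonneg[OF 2 mult_nonneg_nonneg[OF 3 mult_nonneg_nonneg[OF 4 5]]]]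
    then show ?thesis by (simp add: t_def n mult_ac)
  qed (simp add: t0)
  note s = rhyp_real_sums[OF x t]
  define A where "A = Re (rhyp (of_real \<alpha>) (1/2) (- of_nat k) (of_real x))"
  define B where "B = Re (rhyp_theta (of_real \<alpha>) (1/2) (- of_nat k) (of_real x))"
  have A: "(\<lambda>n. \<sigma> * t n) sums (\<sigma> * A)" unfolding A_def using s(1) by (rule sums_mult)
  have B: "(\<lambda>n. \<sigma> * (real n * t n)) sums (\<sigma> * B)" unfolding B_def using s(3) by (rule sums_mult)
  have A0: "\<sigma> * A \<ge> 0" using sums_le[OF \<sigma>t sums_zero A] .
  have AB: "real k * (\<sigma> * A) \<le> \<sigma> * B"
  proof (rule sums_le[OF _ sums_mult[OF A] B])
    show "real k * (\<sigma> * t n) \<le> \<sigma> * (real n * t n)" for n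
      using t0[of n] \<sigma>t[of n] mult_right_mono[of "real k" "real n" "\<sigma> * t n"] by (cases "n \<le> k") (auto simp: mult_ac)
  qed
  have "0 \<le> real k * (\<sigma> * A)" using A0 by simp
  then have "\<sigma> * B \<ge> 0" using AB by linarith
  moreover have "\<bar>\<sigma>\<bar> = 1" by (simp add: \<sigma>_def)
  ultimately have "\<bar>A\<bar> = \<sigma> * A" "\<bar>B\<bar> = \<sigma> * B"
    using A0 by (metis abs_mult abs_of_nonneg mult_1)+
  then have "real k * \<bar>A\<bar> \<le> \<bar>B\<bar>" using AB by simp
  then show ?thesis using s(2,4) unfolding A_def B_def by (metis norm_of_real)
qed

section \<open>The parameter line (p w + a, 1/2; r w)\<close>

locale hypergeometric_line =
  fixes p r :: nat and a x :: real
  assumes p_pos: "0 < p" and p_less_r: "p < r" and x_pos: "0 < x" and x_less_1: "x < 1"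
begin

definition F :: "complex \<Rightarrow> complex" where
  "F w = rhyp (of_nat p * w + of_real a) (1/2) (of_nat r * w) (of_real x)"

definition T :: "complex \<Rightarrow> complex" where
  "T w = rhyp_theta (of_nat p * w + of_real a) (1/2) (of_nat r * w) (of_real x)"

definition f :: "complex \<Rightarrow> complex" where
  "f w = hyp2F1 (of_nat p * w + of_real a) (1/2) (of_nat r * w) x"

lemma r_pos: "r > 0" using p_less_r by simp

lemma norm_x: "norm (of_real x :: complex) < 1" using x_pos x_less_1 by simp

lemma F_eq_f: "of_nat r * w \<notin> \<int>\<^sub>\<le>\<^sub>0 \<Longrightarrow> F w = rGamma (of_nat r * w) * f w"
  unfolding F_def f_def by (rule rhyp_eq_hyp2F1[OF _ x_pos x_less_1])

lemma holomorphic_F: "F holomorphic_on UNIV" and holomorphic_T: "T holomorphic_on UNIV"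
  unfolding F_def[abs_def] T_def[abs_def]
  by (intro holomorphic_rhyp norm_x holomorphic_intros)+

lemma f_limit: "\<exists>L\<noteq>0. ((\<lambda>t::real. f (of_real t)) \<longlongrightarrow> L) at_top"
proof -
  obtain L where "L \<noteq> 0" "((\<lambda>w. hyp2F1 (of_real (real p * w + a)) (1/2) (of_real (real r * w)) x) \<longlongrightarrow> of_real L) at_top"
    using hyp2F1_limit_at_top[OF x_pos x_less_1, of "real r" "real p" a] p_less_r by auto
  then show ?thesis by (intro exI[of _ "of_real L"]) (simp add: f_def)
qed

lemma T_le_F: "\<exists>B. \<forall>\<^sub>F n in sequentially. F (of_nat n) \<noteq> 0 \<and> norm (T (of_nat n)) \<le> B * norm (F (of_nat n))"
proof -
  have "\<forall>\<^sub>F n in sequentially. real p * real n + a > 0"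
    using p_pos by real_asymp
  moreover have "\<forall>\<^sub>F n in sequentially. real p * real n + a \<le> real r * real n"
    using p_less_r by real_asymp
  ultimately have "\<forall>\<^sub>F n in sequentially. F (of_nat n) \<noteq> 0 \<and> norm (T (of_nat n)) \<le> (\<Sum>n. real n * x ^ n) * norm (F (of_nat n))"
  proof eventually_elim
    case (elim n)
    then show ?case
      using rhyp_theta_le_rhyp[OF x_pos x_less_1, of "real p * real n + a" "real r * real n"]
      by (simp add: F_def T_def)
  qed
  then show ?thesis by blast
qed

text \<open>As \<open>w\<close> tends to infinity along the positive integers, \<open>T / F\<close> stays bounded; at the
  points \<open>- k / r\<close> it is at least \<open>k\<close> in modulus. No rational function does both.\<close>

lemma T_F_independent:
  fixes L N :: "complex poly"
  assumes inf: "infinite {k::nat. F (- of_nat k / of_nat r) \<noteq> 0}"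
    and LN: "\<And>w. poly L w * F w = poly N w * T w"
  shows "N = 0"
proof (rule ccontr)
  assume N: "N \<noteq> 0"
  obtain B where B: "\<forall>\<^sub>F n in sequentially. F (of_nat n) \<noteq> 0 \<and> norm (T (of_nat n)) \<le> B * norm (F (of_nat n))"
    using T_le_F by blast
  have "\<forall>\<^sub>F n in sequentially. norm (poly L (of_nat n)) \<le> B * norm (poly N (of_nat n))"
    using B
  proof eventually_elim
    case (elim n)
    have "norm (poly L (of_nat n)) * norm (F (of_nat n)) = norm (poly N (of_nat n)) * norm (T (of_nat n))"
      using LN by (metis norm_mult)
    also have "\<dots> \<le> norm (poly N (of_nat n)) * (B * norm (F (of_nat n)))"
      using elim by (intro mult_left_mono) auto
    also have "\<dots> = (B * norm (poly N (of_nat n))) * norm (F (of_nat n))" by (simp only: mult_ac)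
    finally show ?case using elim mult_right_le_imp_le by (metis zero_less_norm_iff)
  qed
  from poly_dominated_at_infinity[OF N this] obtain B' where
    B': "\<forall>\<^sub>F w in at_infinity. norm (poly L w) \<le> B' * norm (poly N w) \<and> poly N w \<noteq> 0" by blast
  have "filterlim (\<lambda>k. - of_nat k / of_nat r :: complex) at_infinity sequentially"
  proof -
    have "filterlim (\<lambda>k. norm (- of_nat k / of_nat r :: complex)) at_top sequentially"
      using r_pos by (simp add: norm_divide) real_asymp
    then show ?thesis by (rule filterlim_norm_at_top_imp_at_infinity)
  qed
  from eventually_compose_filterlim[OF B' this]
  have 1: "\<forall>\<^sub>F k in sequentially. norm (poly L (- of_nat k / of_nat r)) \<le> B' * norm (poly N (- of_nat k / of_nat r)) \<and> poly N (- of_nat k / of_nat r) \<noteq> 0" .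
  have 2: "\<forall>\<^sub>F k::nat in sequentially. real k > B'" by real_asymp
  \<comment> \<open>At w = - k / r the upper parameter is a - p k / r; adding k makes it positive
    for large k because p < r.\<close>
  have 3: "\<forall>\<^sub>F k::nat in sequentially. (a - real p * real k / real r) + real k > 0"
  proof -
    define c where "c = 1 - real p / real r"
    have "c > 0" using p_less_r by (simp add: c_def)
    then have "\<forall>\<^sub>F k::nat in sequentially. a + c * real k > 0" by real_asymp
    then show ?thesis by (simp add: c_def algebra_simps)
  qed
  have "\<forall>\<^sub>F k in sequentially. F (- of_nat k / of_nat r) = 0"
    using 1 2 3
  proof eventually_elim
    case (elim k)
    let ?w = "- of_nat k / of_nat r :: complex"
    have FT: "real k * norm (F ?w) \<le> norm (T ?w)"
      using rhyp_theta_ge_rhyp[OF x_pos x_less_1 elim(3)] r_pos by (simp add: F_def T_def)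
    show ?case
    proof (rule ccontr)
      assume F0: "F ?w \<noteq> 0"
      have "norm (poly N ?w) * (real k * norm (F ?w)) \<le> norm (poly N ?w) * norm (T ?w)"
        using FT by (intro mult_left_mono) auto
      also have "\<dots> = norm (poly L ?w) * norm (F ?w)"
        using LN by (metis norm_mult)
      also have "\<dots> \<le> B' * norm (poly N ?w) * norm (F ?w)"
        using elim(1) by (intro mult_right_mono) auto
      finally have "real k * (norm (poly N ?w) * norm (F ?w)) \<le> B' * (norm (poly N ?w) * norm (F ?w))"
        by (simp only: mult_ac)
      then have "real k \<le> B'"
        using F0 elim(1) by (auto dest: mult_right_le_imp_le)
      then show False using elim(2) by simp
    qed
  qed
  then have "finite {k::nat. F (- of_nat k / of_nat r) \<noteq> 0}"
    unfolding eventually_cofinite[symmetric] cofinite_eq_sequentially by simp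
  with inf show False by simp
qed

text \<open>f is F divided by \<open>rGamma\<close> of r w, whose zeros - k / r are simple. Where F
  vanishes as well, dividing both by z - w shows that f has a finite limit. In this way
  non-elementarity becomes a statement about values of the entire function F.\<close>

lemma is_pole_f_imp:
  assumes "is_pole f w"
  shows "\<exists>k::nat. w = - of_nat k / of_nat r \<and> F w \<noteq> 0"
proof (rule ccontr)
  assume neg: "\<not> ?thesis"
  have eq: "f z = F z / rGamma (of_nat r * z)" if "rGamma (of_nat r * z) \<noteq> 0" for z
    using F_eq_f[of z] that by (simp add: rGamma_eq_zero_iff)
  have Fd: "(F has_field_derivative deriv F w) (at w)"
    using holomorphic_derivI[OF holomorphic_F] by simp
  have "\<exists>l. (f \<longlongrightarrow> l) (at w)"
  proof (cases "of_nat r * w \<in> \<int>\<^sub>\<le>\<^sub>0")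
    case False
    then have nz: "rGamma (of_nat r * w) \<noteq> 0" by (simp add: rGamma_eq_zero_iff)
    have G: "((\<lambda>z. rGamma (of_nat r * z)) \<longlongrightarrow> rGamma (of_nat r * w)) (at w)"
      by (intro isContD continuous_intros)
    have "((\<lambda>z. F z / rGamma (of_nat r * z)) \<longlongrightarrow> F w / rGamma (of_nat r * w)) (at w)"
      using DERIV_isCont[OF Fd] by (intro tendsto_divide G nz) (simp add: isCont_def)
    moreover have "\<forall>\<^sub>F z in at w. F z / rGamma (of_nat r * z) = f z"
      using tendsto_imp_eventually_ne[OF G nz] by eventually_elim (simp add: eq)
    ultimately show ?thesis using Lim_transform_eventually by blast
  next
    case True
    then obtain k where k: "of_nat r * w = - of_nat k" by (auto elim!: nonpos_Ints_cases')
    then have wk: "w = - of_nat k / of_nat r" using r_pos by (simp add: field_simps)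
    then have F0: "F w = 0" using neg by blast
    have "((\<lambda>z. rGamma (of_nat r * z)) has_field_derivative ((-1) ^ k * fact k) * of_nat r) (at w)"
    proof (rule DERIV_chain2[where f = rGamma and g = "\<lambda>z. of_nat r * z"])
      show "(rGamma has_field_derivative (-1) ^ k * fact k) (at (of_nat r * w))"
        unfolding k by (rule has_field_derivative_rGamma_nonpos_int)
    qed (auto intro!: derivative_eq_intros)
    moreover have "rGamma (of_nat r * w) = 0" unfolding k by simp
    ultimately have G: "((\<lambda>z. rGamma (of_nat r * z) / (z - w)) \<longlongrightarrow> ((-1) ^ k * fact k) * of_nat r) (at w)"
      by (simp add: has_field_derivative_iff)
    have H: "((\<lambda>z. F z / (z - w)) \<longlongrightarrow> deriv F w) (at w)"
      using Fd F0 by (simp add: has_field_derivative_iff)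
    have nz: "((-1) ^ k * fact k) * of_nat r \<noteq> (0::complex)" using r_pos by simp
    have "((\<lambda>z. (F z / (z - w)) / (rGamma (of_nat r * z) / (z - w))) \<longlongrightarrow> deriv F w / (((-1) ^ k * fact k) * of_nat r)) (at w)"
      by (intro tendsto_divide G H nz)
    moreover have "\<forall>\<^sub>F z in at w. (F z / (z - w)) / (rGamma (of_nat r * z) / (z - w)) = f z"
      using tendsto_imp_eventually_ne[OF G nz] by eventually_elim (auto simp: eq)
    ultimately show ?thesis using Lim_transform_eventually by blast
  qed
  then obtain l where "(f \<longlongrightarrow> l) (at w)" by blast
  with assms show False
    unfolding is_pole_def using not_tendsto_and_filterlim_at_infinity[of "at w"] by auto
qed

lemma infinite_F_nonzero:
  assumes "infinite {w. is_pole f w}"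
  shows "infinite {k::nat. F (- of_nat k / of_nat r) \<noteq> 0}"
proof
  assume fin: "finite {k::nat. F (- of_nat k / of_nat r) \<noteq> 0}"
  have "{w. is_pole f w} \<subseteq> (\<lambda>k::nat. - of_nat k / of_nat r) ` {k. F (- of_nat k / of_nat r) \<noteq> 0}"
    using is_pole_f_imp by blast
  with fin assms show False using finite_surj by blast
qed

end

section \<open>First-order recurrence\<close>

lemma prod_lessThan_split:
  fixes g :: "nat \<Rightarrow> 'a :: comm_monoid_mult"
  assumes "m \<le> n"
  shows "(\<Prod>i<n. g i) = (\<Prod>i<m. g i) * (\<Prod>i<n - m. g (m + i))"
proof -
  obtain k where k: "n = m + k" using assms le_Suc_ex by blast
  show ?thesis unfolding k by (induction k) (simp_all add: mult.assoc)
qed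

lemma degree_prod_linear: "degree (\<Prod>i<n. [:v i, 1:]) = n"
  and monic_prod_linear: "lead_coeff (\<Prod>i<n. [:v i, 1:]) = 1"
  for v :: "nat \<Rightarrow> complex"
proof -
  show "lead_coeff (\<Prod>i<n. [:v i, 1:]) = 1" unfolding lead_coeff_prod by simp
  show "degree (\<Prod>i<n. [:v i, 1:]) = n" by (subst degree_prod_eq_sum_degree) auto
qed

lemma rGamma_multiple_shift:
  fixes w :: complex
  assumes "n > 0"
  shows "rGamma (of_nat n * w) = of_nat n ^ n * (\<Prod>i<n. w + of_real (real i / real n)) * rGamma (of_nat n * (w + 1))"
proof -
  have "pochhammer (of_nat n * w) n = (\<Prod>i<n. of_nat n * (w + of_real (real i / real n)))"
    unfolding pochhammer_prod atLeast0LessThan using assms by (intro prod.cong) (auto simp: field_simps)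
  then have "pochhammer (of_nat n * w) n = of_nat n ^ n * (\<Prod>i<n. w + of_real (real i / real n))"
    by (simp add: prod.distrib)
  then show ?thesis
    using pochhammer_rGamma[of "of_nat n * w" n] by (simp add: distrib_left)
qed

context hypergeometric_line
begin

text \<open>The choice is unique, since polynomials are determined by their values. As locale
  constants P and Q can also be named for the dual parameter, where only \<open>a\<close>
  changes.\<close>

definition PQ :: "complex poly \<times> complex poly" where
  "PQ = (SOME PQ. \<forall>w. contig_row (1/2) (of_real x) (of_nat p * w + of_real a) (of_nat r * w) p (r - p)
            = (poly (fst PQ) w, poly (snd PQ) w))"

definition P :: "complex poly" where "P = fst PQ"
definition Q :: "complex poly" where "Q = snd PQ"

lemma contig_row_eq:
  "contig_row (1/2) (of_real x) (of_nat p * w + of_real a) (of_nat r * w) p (r - p) = (poly P w, poly Q w)"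
proof -
  obtain P' Q' where "\<And>w. contig_row (1/2) (of_real x) (poly [:of_real a, of_nat p:] w) (poly [:0, of_nat r:] w) p (r - p) = (poly P' w, poly Q' w)"
    using contig_row_poly by blast
  then have "\<forall>w. contig_row (1/2) (of_real x) (of_nat p * w + of_real a) (of_nat r * w) p (r - p)
            = (poly (fst (P', Q')) w, poly (snd (P', Q')) w)"
    by (simp add: algebra_simps)
  then have "\<forall>w. contig_row (1/2) (of_real x) (of_nat p * w + of_real a) (of_nat r * w) p (r - p)
            = (poly (fst PQ) w, poly (snd PQ) w)"
    unfolding PQ_def by (rule someI)
  then show ?thesis by (simp add: P_def Q_def)
qed

lemma of_nat_r: "of_nat p + of_nat (r - p) = (of_nat r :: complex)"
  using p_less_r by (simp flip: of_nat_add)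

lemma F_shift: "poly P w * F (w + 1) + poly Q w * T (w + 1) = F w"
proof -
  have 1: "of_nat p * w + of_real a + of_nat p = of_nat p * (w + 1) + of_real a"
    by (simp add: distrib_left)
  have 2: "of_nat r * w + of_nat p + of_nat (r - p) = of_nat r * (w + 1)"
    by (simp only: add.assoc of_nat_r distrib_left mult_1_right)
  show ?thesis
    using contig_row_rhyp[OF norm_x, of "1/2" "of_nat p * w + of_real a" "of_nat r * w" p "r - p"]
    unfolding contig_row_eq 1 2 F_def T_def by simp
qed

definition D :: "complex poly" where
  "D = smult (of_nat r ^ r) (\<Prod>i<r. [:of_real (real i / real r), 1:])"

lemma poly_D: "poly D w = of_nat r ^ r * (\<Prod>i<r. w + of_real (real i / real r))"
  by (simp add: D_def poly_prod add.commute)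

lemma rGamma_shift: "rGamma (of_nat r * w) = poly D w * rGamma (of_nat r * (w + 1))"
  unfolding poly_D by (rule rGamma_multiple_shift[OF r_pos])

lemma degree_D: "degree D = r"
  using r_pos unfolding D_def by (simp add: degree_prod_linear)

lemma lead_coeff_D: "lead_coeff D = of_nat r ^ r"
  unfolding D_def lead_coeff_smult monic_prod_linear by simp

lemma not_nonpos_at_top: "\<forall>\<^sub>F t::real in at_top. of_nat r * (of_real t :: complex) \<notin> \<int>\<^sub>\<le>\<^sub>0"
  using eventually_gt_at_top[of 0]
proof eventually_elim
  case (elim t)
  then show ?case using r_pos by (intro not_nonpos_IntsI) simp
qed

lemma eventually_shift_at_top:
  fixes R :: "complex \<Rightarrow> bool"
  assumes "\<forall>\<^sub>F t::real in at_top. R (of_real t)"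
  shows "\<forall>\<^sub>F t::real in at_top. R (of_real t + 1)"
proof -
  have "filterlim (\<lambda>t::real. t + 1) at_top at_top" by real_asymp
  from eventually_compose_filterlim[OF assms this] show ?thesis by simp
qed

text \<open>Comparing the product formula at w and at w + 1 removes all gamma factors and leaves exp
  \<delta> U(w) F(w) = V(w) D(w) F(w + 1). Inserting the contiguity relation for F(w) gives a
  polynomial relation between F and T at w + 1, and independence annihilates its T-coefficient exp
  \<delta> U Q.\<close>

lemma Q_eq_0:
  assumes inf: "infinite {k::nat. F (- of_nat k / of_nat r) \<noteq> 0}"
    and C: "C \<noteq> 0"
    and sol: "\<And>w. of_nat r * w \<notin> \<int>\<^sub>\<le>\<^sub>0 \<Longrightarrow>
         f w * (\<Prod>u\<leftarrow>us. rGamma (w + u)) = C * exp (w * \<delta>) * (\<Prod>v\<leftarrow>vs. rGamma (w + v))"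
  shows "Q = 0"
proof -
  define U where "U = (\<Prod>u\<leftarrow>us. [:u, 1:])"
  define V where "V = (\<Prod>v\<leftarrow>vs. [:v, 1:])"
  have shift: "(\<Prod>u\<leftarrow>ws. rGamma (w + u)) = poly (\<Prod>u\<leftarrow>ws. [:u, 1:]) w * (\<Prod>u\<leftarrow>ws. rGamma (w + 1 + u))" for ws and w :: complex
  proof (induction ws)
    case (Cons u ws)
    have "rGamma (w + u) = (w + u) * rGamma (w + 1 + u)"
      using rGamma_plus1[of "w + u"] by (simp add: add_ac)
    with Cons show ?case by (simp add: algebra_simps)
  qed simp
  have nz: "\<forall>\<^sub>F t::real in at_top. (\<Prod>u\<leftarrow>us. rGamma (of_real t + 1 + u)) \<noteq> 0"
  proof -
    have "\<forall>\<^sub>F t::real in at_top. \<forall>u\<in>set us. rGamma (of_real t + 1 + u) \<noteq> 0"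
    proof (rule eventually_ball_finite, simp, rule ballI)
      fix u :: complex
      show "\<forall>\<^sub>F t::real in at_top. rGamma (of_real t + 1 + u) \<noteq> 0"
        using eventually_gt_at_top[of "- Re u"]
      proof eventually_elim
        case (elim t)
        then have "of_real t + 1 + u \<notin> \<int>\<^sub>\<le>\<^sub>0" by (intro not_nonpos_IntsI) simp
        then show ?case by (simp add: rGamma_eq_zero_iff)
      qed
    qed
    then show ?thesis by eventually_elim (auto simp: prod_list_zero_iff)
  qed
  define L where "L = V * D - smult (exp \<delta>) U * P"
  define N where "N = smult (exp \<delta>) U * Q"
  have "poly L w * F (w + 1) = poly N w * T (w + 1)" for w
  proof (rule entire_eqI_at_top[where f = "\<lambda>w. poly L w * F (w + 1)" and g = "\<lambda>w. poly N w * T (w + 1)"])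
    have w1: "(\<lambda>w::complex. w + 1) holomorphic_on UNIV" by (intro holomorphic_intros)
    have FT: "(\<lambda>w. F (w + 1)) holomorphic_on UNIV" "(\<lambda>w. T (w + 1)) holomorphic_on UNIV"
      using holomorphic_on_compose_gen[OF w1 holomorphic_F] holomorphic_on_compose_gen[OF w1 holomorphic_T]
      by (simp_all add: comp_def)
    show "(\<lambda>w. poly L w * F (w + 1)) holomorphic_on UNIV"
      by (intro holomorphic_intros FT(1))
    show "(\<lambda>w. poly N w * T (w + 1)) holomorphic_on UNIV"
      by (intro holomorphic_intros FT(2))
    show "\<forall>\<^sub>F t::real in at_top. poly L (of_real t) * F (of_real t + 1) = poly N (of_real t) * T (of_real t + 1)"
      using nz not_nonpos_at_top eventually_shift_at_top[OF not_nonpos_at_top]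
    proof eventually_elim
      case (elim t)
      let ?w = "of_real t :: complex"
      let ?X = "\<Prod>u\<leftarrow>us. rGamma (?w + 1 + u)" and ?Y = "\<Prod>v\<leftarrow>vs. rGamma (?w + 1 + v)"
      have 1: "f ?w * (poly U ?w * ?X) = C * exp (?w * \<delta>) * (poly V ?w * ?Y)"
        using sol[OF elim(2)] unfolding shift[of ?w us] shift[of ?w vs] U_def V_def .
      have 2: "f (?w + 1) * ?X = C * (exp (?w * \<delta>) * exp \<delta>) * ?Y"
        using sol[OF elim(3)] by (simp add: exp_add[symmetric] distrib_right)
      have "exp \<delta> * (f ?w * poly U ?w) * ?X = (poly V ?w * f (?w + 1)) * ?X"
        using 1 2 by algebra
      then have 3: "exp \<delta> * (f ?w * poly U ?w) = poly V ?w * f (?w + 1)"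
        using elim(1) by simp
      have "F ?w = poly D ?w * rGamma (of_nat r * (?w + 1)) * f ?w" "F (?w + 1) = rGamma (of_nat r * (?w + 1)) * f (?w + 1)"
        using F_eq_f[OF elim(2)] F_eq_f[OF elim(3)] by (simp_all add: rGamma_shift[of ?w])
      then have "exp \<delta> * poly U ?w * F ?w = poly V ?w * poly D ?w * F (?w + 1)"
        using 3 by algebra
      then show ?case
        unfolding F_shift[of ?w, symmetric] by (simp add: L_def N_def algebra_simps)
    qed
  qed
  \<comment> \<open>The relation is translated from w + 1 to w, the form that independence
    expects.\<close>
  from this[of "w - 1" for w] have "poly (pcompose L [:-1, 1:]) w * F w = poly (pcompose N [:-1, 1:]) w * T w" for w
    by (simp add: poly_pcompose)
  from T_F_independent[OF inf this] have "N = 0"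
    by (rule pcompose_eq_0) simp
  moreover have "U \<noteq> 0" by (auto simp: U_def prod_list_zero_iff)
  ultimately show ?thesis by (simp add: N_def)
qed

end

locale hypergeometric_line_first_order = hypergeometric_line +
  assumes Q0: "Q = 0"
begin

lemma F_first_order: "F w = poly P w * F (w + 1)"
  using F_shift[of w] Q0 by simp

lemma f_first_order: "\<forall>\<^sub>F t::real in at_top. f (of_real t) * poly D (of_real t) = poly P (of_real t) * f (of_real t + 1)"
  using not_nonpos_at_top eventually_shift_at_top[OF not_nonpos_at_top]
proof eventually_elim
  case (elim t)
  have "rGamma (of_nat r * (of_real t + 1)) * (f (of_real t) * poly D (of_real t)) = rGamma (of_nat r * (of_real t + 1)) * (poly P (of_real t) * f (of_real t + 1))"
    using F_first_order[of "of_real t"] F_eq_f[OF elim(1)] F_eq_f[OF elim(2)] rGamma_shift[of "of_real t"]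
    by (simp add: mult_ac)
  then show ?case using elim(2) by (simp add: rGamma_eq_zero_iff)
qed

text \<open>f(n) / f(n + 1) equals P(n) / D(n) for large n and tends to 1, because f has a nonzero
  limit; so P has the leading term of D.\<close>

lemma degree_P: "degree P = r" and lead_coeff_P: "lead_coeff P = of_nat r ^ r"
proof -
  obtain L where L: "L \<noteq> 0" "((\<lambda>t::real. f (of_real t)) \<longlongrightarrow> L) at_top" using f_limit by blast
  have real: "filterlim real at_top sequentially" by (rule filterlim_real_sequentially)
  have L0: "(\<lambda>n. f (of_nat n)) \<longlonglongrightarrow> L" using filterlim_compose[OF L(2) real] by simp
  have L1: "(\<lambda>n. f (of_nat n + 1)) \<longlonglongrightarrow> L" using LIMSEQ_Suc[OF L0] by (simp add: add.commute)
  have ev: "\<forall>\<^sub>F n in sequentially. f (of_nat n) * poly D (of_nat n) = poly P (of_nat n) * f (of_nat n + 1)"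
    using eventually_compose_filterlim[OF f_first_order real] by simp
  have D0: "D \<noteq> 0" using degree_D r_pos by auto
  have "(\<lambda>n. poly P (of_nat n) / poly D (of_nat n)) \<longlonglongrightarrow> 1"
  proof (rule Lim_transform_eventually)
    show "(\<lambda>n. f (of_nat n) / f (of_nat n + 1)) \<longlonglongrightarrow> 1"
      using tendsto_divide[OF L0 L1 L(1)] L(1) by simp
    show "\<forall>\<^sub>F n in sequentially. f (of_nat n) / f (of_nat n + 1) = poly P (of_nat n) / poly D (of_nat n)"
      using ev tendsto_imp_eventually_ne[OF L1 L(1)] eventually_gt_at_top[of 0]
    proof eventually_elim
      case (elim n)
      have "complex_of_nat n + of_real (real i / real r) \<noteq> 0" for i
      proof -
        have "real n + real i / real r > 0" using elim(3) by (intro add_pos_nonneg) auto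
        moreover have "Re (complex_of_nat n + of_real (real i / real r)) = real n + real i / real r" by simp
        ultimately show ?thesis by (metis zero_complex.sel(1) less_irrefl)
      qed
      then have "poly D (of_nat n) \<noteq> 0"
        using r_pos unfolding poly_D by auto
      then show ?case using elim by (simp add: field_simps)
    qed
  qed
  note * = poly_same_leading_term[OF D0 this]
  show "degree P = r" using *(1) degree_D by (rule trans)
  show "lead_coeff P = of_nat r ^ r" using *(2) lead_coeff_D by (rule trans)
qed

lemma gamma_product:
  assumes v: "P = smult (of_nat r ^ r) (\<Prod>i<r. [:v i, 1:])"
  shows "(\<Sum>i<r. v i) = (of_nat r - 1) / 2"
    and "\<exists>C\<noteq>0. \<forall>w. of_nat r * w \<notin> \<int>\<^sub>\<le>\<^sub>0 \<longrightarrow>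
      f w * (\<Prod>i<r. rGamma (w + of_real (real i / real r))) = C * (\<Prod>i<r. rGamma (w + v i))"
proof -
  obtain L where L: "L \<noteq> 0" "((\<lambda>t::real. f (of_real t)) \<longlongrightarrow> L) at_top" using f_limit by blast
  have r0: "(of_nat r :: complex) ^ r \<noteq> 0" using r_pos by simp
  have rec: "\<forall>\<^sub>F t::real in at_top. f (of_real t) * (\<Prod>i<r. of_real t + of_real (real i / real r)) = 1 * (\<Prod>i<r. of_real t + v i) * f (of_real t + 1)"
    using f_first_order
  proof eventually_elim
    case (elim t)
    then have "of_nat r ^ r * (f (of_real t) * (\<Prod>i<r. of_real t + of_real (real i / real r))) = of_nat r ^ r * ((\<Prod>i<r. of_real t + v i) * f (of_real t + 1))"
      unfolding v poly_D by (simp add: poly_prod add.commute mult_ac)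
    then show ?case by (simp only: mult_left_cancel[OF r0] mult_1)
  qed
  note g = gamma_product_of_recurrence[OF L(2,1) rec]
  \<comment> \<open>The recurrence lemma equates the sum of the v i with the sum of the numbers i /
    r, which is the origin of (r - 1) / 2.\<close>
  have "(\<Sum>i<r. complex_of_real (real i / real r)) = of_real ((\<Sum>i<r. real i) / real r)"
    by (simp add: sum_divide_distrib)
  also have "(\<Sum>i<r. real i) = real r * (real r - 1) / 2"
    by (induction r) (auto simp: field_simps)
  finally show "(\<Sum>i<r. v i) = (of_nat r - 1) / 2"
    using g(2) r_pos by simp
  have eq: "F w * (\<Prod>i<r. rGamma (w + of_real (real i / real r))) = L * rGamma (of_nat r * w) * (\<Prod>i<r. rGamma (w + v i))" for w
  proof (rule entire_eqI_at_top[where f = "\<lambda>w. F w * (\<Prod>i<r. rGamma (w + of_real (real i / real r)))"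
        and g = "\<lambda>w. L * rGamma (of_nat r * w) * (\<Prod>i<r. rGamma (w + v i))"])
    show "(\<lambda>w. F w * (\<Prod>i<r. rGamma (w + of_real (real i / real r)))) holomorphic_on UNIV"
      by (intro holomorphic_intros holomorphic_F)
    show "(\<lambda>w. L * rGamma (of_nat r * w) * (\<Prod>i<r. rGamma (w + v i))) holomorphic_on UNIV"
      by (intro holomorphic_intros)
    show "\<forall>\<^sub>F t::real in at_top. F (of_real t) * (\<Prod>i<r. rGamma (of_real t + of_real (real i / real r)))
       = L * rGamma (of_nat r * of_real t) * (\<Prod>i<r. rGamma (of_real t + v i))"
      using g(3) not_nonpos_at_top by eventually_elim (simp add: F_eq_f mult_ac)
  qed
  have "f w * (\<Prod>i<r. rGamma (w + of_real (real i / real r))) = L * (\<Prod>i<r. rGamma (w + v i))" if "of_nat r * w \<notin> \<int>\<^sub>\<le>\<^sub>0" for w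
  proof -
    have "rGamma (of_nat r * w) * (f w * (\<Prod>i<r. rGamma (w + of_real (real i / real r)))) = rGamma (of_nat r * w) * (L * (\<Prod>i<r. rGamma (w + v i)))"
      using eq[of w] F_eq_f[OF that] by (simp add: mult_ac)
    then show ?thesis using that by (simp add: rGamma_eq_zero_iff)
  qed
  then show "\<exists>C\<noteq>0. \<forall>w. of_nat r * w \<notin> \<int>\<^sub>\<le>\<^sub>0 \<longrightarrow>
      f w * (\<Prod>i<r. rGamma (w + of_real (real i / real r))) = C * (\<Prod>i<r. rGamma (w + v i))"
    using L(1) by blast
qed

end

section \<open>Zeros of the recurrence coefficient\<close>

lemma rhyp_terminating:
  fixes b c z :: complex
  assumes "c \<notin> \<int>\<^sub>\<le>\<^sub>0"
  shows "rhyp (- of_nat N) b c z = rGamma c * (\<Sum>k\<le>N. pochhammer (- of_nat N) k * pochhammer b k / fact k * z ^ k / pochhammer c k)"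
    and "rhyp_theta (- of_nat N) b c z = rGamma c * (\<Sum>k\<le>N. of_nat k * (pochhammer (- of_nat N) k * pochhammer b k / fact k * z ^ k / pochhammer c k))"
proof -
  have eq: "rhyp_coeff (- of_nat N) b c k * z ^ k = rGamma c * (pochhammer (- of_nat N) k * pochhammer b k / fact k * z ^ k / pochhammer c k)" for k
  proof -
    have "pochhammer c k \<noteq> 0" using assms by (auto simp: pochhammer_eq_0_iff)
    then have "rGamma (c + of_nat k) = rGamma c / pochhammer c k"
      using pochhammer_rGamma[of c k] by (simp add: field_simps)
    then show ?thesis by (simp add: rhyp_coeff_def mult_ac)
  qed
  have 0: "rhyp_coeff (- of_nat N) b c k = 0" if "k \<notin> {..N}" for k
    using that pochhammer_of_nat_eq_0_lemma[of N k, where 'a = complex] by (simp add: rhyp_coeff_def)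
  have "rhyp (- of_nat N) b c z = (\<Sum>k\<le>N. rhyp_coeff (- of_nat N) b c k * z ^ k)"
    unfolding rhyp_def by (rule suminf_finite) (auto simp: 0)
  then show "rhyp (- of_nat N) b c z = rGamma c * (\<Sum>k\<le>N. pochhammer (- of_nat N) k * pochhammer b k / fact k * z ^ k / pochhammer c k)"
    unfolding eq sum_distrib_left .
  have "rhyp_theta (- of_nat N) b c z = (\<Sum>k\<le>N. of_nat k * rhyp_coeff (- of_nat N) b c k * z ^ k)"
    unfolding rhyp_theta_def by (rule suminf_finite) (auto simp: 0)
  then show "rhyp_theta (- of_nat N) b c z = rGamma c * (\<Sum>k\<le>N. of_nat k * (pochhammer (- of_nat N) k * pochhammer b k / fact k * z ^ k / pochhammer c k))"
    unfolding mult.assoc eq sum_distrib_left by (simp only: mult.left_commute)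
qed

lemma rhyp_0_left:
  fixes b c z :: complex
  assumes "c \<notin> \<int>\<^sub>\<le>\<^sub>0"
  shows "rhyp 0 b c z = rGamma c"
  using rhyp_terminating(1)[OF assms, of 0 b z] by simp

text \<open>For \<open>c < 1 - N\<close> all factors of the two Pochhammer symbols are negative.\<close>

lemma terminating_sum_nonzero:
  fixes c x :: real
  assumes c: "c < 1 - real N" and x: "x > 0"
  shows "(\<Sum>k\<le>N. pochhammer (- of_nat N) k * pochhammer (1/2) k / fact k * of_real x ^ k / pochhammer (of_real c :: complex) k) \<noteq> 0"
proof -
  define e where "e k = pochhammer (- real N) k * pochhammer (1/2) k / fact k * x ^ k / pochhammer c k" for k
  have e: "pochhammer (- of_nat N) k * pochhammer (1/2) k / fact k * of_real x ^ k / pochhammer (of_real c :: complex) k = of_real (e k)" for k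
  proof -
    have "pochhammer (1/2::complex) k = of_real (pochhammer (1/2) k)"
      using pochhammer_of_real[of "1/2" k, where 'a = complex] by simp
    moreover have "pochhammer (- of_nat N :: complex) k = of_real (pochhammer (- real N) k)"
      using pochhammer_of_real[of "- real N" k, where 'a = complex] by simp
    ultimately show ?thesis by (simp add: e_def pochhammer_of_real)
  qed
  have "e k \<ge> 0" if "k \<le> N" for k
  proof -
    have "pochhammer (- real N) k / pochhammer c k = (\<Prod>j<k. (- real N + real j) / (c + real j))"
      by (simp add: pochhammer_prod prod_dividef atLeast0LessThan)
    also have "\<dots> \<ge> 0"
      using that c by (intro prod_nonneg divide_nonpos_nonpos) auto
    finally have 1: "0 \<le> pochhammer (- real N) k / pochhammer c k" .
    have 2: "0 \<le> pochhammer (1/2) k / fact k * x ^ k"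
      using x by (auto intro!: mult_nonneg_nonneg divide_nonneg_nonneg pochhammer_nonneg)
    show ?thesis using mult_nonneg_nonneg[OF 1 2] by (simp add: e_def mult_ac)
  qed
  then have "sum e {0} \<le> sum e {..N}" by (intro sum_mono2) auto
  then have "sum e {..N} \<noteq> 0" by (simp add: e_def)
  then show ?thesis unfolding e by (simp flip: of_real_sum)
qed

context hypergeometric_line_first_order
begin

text \<open>Where \<open>p w + a = - i\<close>, the product of the transport factors of the dual solution vanishes,
  while that solution is a terminating series with positive terms. For integral \<open>r w\<close> its regularized
  form may vanish identically, so the lower parameter is first moved off the real axis.\<close>

lemma P_root:
  assumes i: "i < p" and c: "real p * real (p - i) < real r * (real (p - i) - a)"
  shows "poly P (- (of_nat i + of_real a) / of_nat p) = 0"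
proof -
  define w0 where "w0 = - (real i + a) / real p"
  have w0: "- (of_nat i + of_real a) / of_nat p = complex_of_real w0" by (simp add: w0_def)
  have pw0: "of_nat p * complex_of_real w0 + of_real a = - of_nat i"
    using p_pos by (simp add: w0_def)
  define c0 where "c0 = real r * w0"
  \<comment> \<open>With \<alpha> = - i fixed and \<gamma> free, the row is polynomial in \<gamma>;
    at \<gamma> = \<open>c0\<close> it is the row (P, 0) of the point \<open>w0\<close>.\<close>
  obtain P1 Q1 where PQ1: "\<And>\<gamma>. contig_row (1/2) (of_real x) (- of_nat i) \<gamma> p (r - p) = (poly P1 \<gamma>, poly Q1 \<gamma>)"
  proof -
    obtain P1 Q1 where "\<And>\<gamma>. contig_row (1/2) (of_real x) (poly [:- of_nat i:] \<gamma>) (poly [:0, 1:] \<gamma>) p (r - p) = (poly P1 \<gamma>, poly Q1 \<gamma>)"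
      using contig_row_poly by blast
    then show ?thesis using that by simp
  qed
  have at_c0: "poly P1 (of_real c0) = poly P (of_real w0)" "poly Q1 (of_real c0) = 0"
    using contig_row_eq[of "of_real w0"] PQ1[of "of_real c0"] by (simp_all add: pw0 c0_def Q0)
  define N where "N = p - 1 - i"
  have N: "of_nat N = (of_nat p - 1 - of_nat i :: complex)" "real N = real p - 1 - real i"
    using i by (simp_all add: N_def of_nat_diff)
  define C where "C \<gamma> = 2 - \<gamma> - of_nat r" for \<gamma> :: complex
  define h where "h \<gamma> = (\<Sum>k\<le>N. pochhammer (- of_nat N) k * pochhammer (1/2) k / fact k * of_real x ^ k / pochhammer (C \<gamma>) k)" for \<gamma>
  define g where "g \<gamma> = (\<Sum>k\<le>N. of_nat k * (pochhammer (- of_nat N) k * pochhammer (1/2) k / fact k * of_real x ^ k / pochhammer (C \<gamma>) k))" for \<gamma>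
  define \<tau> where "\<tau> \<gamma> = dual_tau (1/2) (of_real x) (- of_nat i + of_nat p) (\<gamma> + of_nat p + of_nat (r - p))" for \<gamma>
  have vanish: "poly P1 \<gamma> * h \<gamma> + poly Q1 \<gamma> * (\<tau> \<gamma> * h \<gamma> + g \<gamma>) = 0" if \<gamma>: "C \<gamma> \<notin> \<int>\<^sub>\<le>\<^sub>0" for \<gamma>
  proof -
    have 1: "1 - (- of_nat i) - of_nat p = (- of_nat N :: complex)" by (simp add: N)
    have 2: "2 - \<gamma> - of_nat p - of_nat (r - p) = C \<gamma>" unfolding C_def of_nat_r[symmetric] by simp
    \<comment> \<open>The factor k = i is zero.\<close>
    have "(\<Prod>k<p. - of_real x * (- of_nat i + of_nat k) * (\<gamma> + of_nat k - 1/2)) = (0::complex)"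
      using i by (intro prod_zero) auto
    then have "poly P1 \<gamma> * rhyp (- of_nat N) (1/2) (C \<gamma>) (of_real x) + poly Q1 \<gamma> * (\<tau> \<gamma> * rhyp (- of_nat N) (1/2) (C \<gamma>) (of_real x)
        + rhyp_theta (- of_nat N) (1/2) (C \<gamma>) (of_real x)) = 0"
      using contig_row_dual[OF norm_x, of "1/2" "- of_nat i" \<gamma> p "r - p"]
      unfolding PQ1 1 2 \<tau>_def by simp
    then have "rGamma (C \<gamma>) * (poly P1 \<gamma> * h \<gamma> + poly Q1 \<gamma> * (\<tau> \<gamma> * h \<gamma> + g \<gamma>)) = 0"
      unfolding rhyp_terminating[OF \<gamma>] h_def[symmetric] g_def[symmetric] by (simp add: algebra_simps)
    then show ?thesis using \<gamma> by (simp add: rGamma_eq_zero_iff)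
  qed
  \<comment> \<open>The inequality assumed for \<open>a\<close> is this bound in terms of i, the one
    under which the terminating sum has nonnegative terms.\<close>
  have C0: "2 - c0 - real r < 1 - real N"
  proof -
    have "real r * (real p - real i - a) > real p * (real p - real i)"
      using c i by (simp add: of_nat_diff)
    then have "real p - real i < real r * (real p - real i - a) / real p"
      using p_pos by (simp add: field_simps)
    also have "\<dots> = c0 + real r" using p_pos by (simp add: c0_def w0_def field_simps)
    finally show ?thesis by (simp add: N)
  qed
  define s where "s n = of_real c0 + \<i> * of_real (inverse (real (Suc n)))" for n
  have s: "s \<longlonglongrightarrow> of_real c0"
  proof -
    have "s \<longlonglongrightarrow> of_real c0 + \<i> * of_real 0"
      unfolding s_def by (intro tendsto_intros LIMSEQ_inverse_real_of_nat)
    then show ?thesis by simp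
  qed
  have Cs: "C (s n) \<notin> \<int>\<^sub>\<le>\<^sub>0" for n
  proof
    assume "C (s n) \<in> \<int>\<^sub>\<le>\<^sub>0"
    then obtain m where "C (s n) = of_int m" by (auto elim!: nonpos_Ints_cases)
    then have "Im (C (s n)) = 0" by simp
    then show False by (simp add: C_def s_def)
  qed
  have nz: "pochhammer (C (of_real c0)) k \<noteq> 0" if "k \<le> N" for k
  proof -
    have "C (of_real c0) + of_nat j \<noteq> 0" if "j < k" for j
    proof -
      have "Re (C (of_real c0) + of_nat j) < 0" using C0 that \<open>k \<le> N\<close> by (simp add: C_def)
      then show ?thesis by (metis less_irrefl zero_complex.sel(1))
    qed
    then show ?thesis by (auto simp: pochhammer_prod)
  qed
  have lims: "(\<lambda>n. h (s n)) \<longlonglongrightarrow> h (of_real c0)" "(\<lambda>n. g (s n)) \<longlonglongrightarrow> g (of_real c0)"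
    unfolding h_def g_def C_def pochhammer_prod
    using nz by (intro tendsto_intros s; simp add: C_def pochhammer_prod)+
  have \<tau>: "(\<lambda>n. \<tau> (s n)) \<longlonglongrightarrow> \<tau> (of_real c0)"
    unfolding \<tau>_def dual_tau_def by (intro tendsto_intros s)
  have "(\<lambda>n. poly P1 (s n) * h (s n) + poly Q1 (s n) * (\<tau> (s n) * h (s n) + g (s n))) \<longlonglongrightarrow>
      poly P1 (of_real c0) * h (of_real c0) + poly Q1 (of_real c0) * (\<tau> (of_real c0) * h (of_real c0) + g (of_real c0))"
    by (intro tendsto_intros s lims \<tau>)
  then have "poly P (of_real w0) * h (of_real c0) = 0"
    unfolding vanish[OF Cs] by (simp add: at_c0 LIMSEQ_const_iff)
  moreover have "h (of_real c0) \<noteq> 0"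
    using terminating_sum_nonzero[OF C0 x_pos] by (simp add: h_def C_def)
  ultimately show ?thesis unfolding w0 by simp
qed

text \<open>For a < 0 the inequality of \<open>P_root\<close> holds at i = 0, so P and with it F
  vanish at - a / p. But there the upper parameter is 0, and F is the value of \<open>rGamma\<close>
  at the positive number - r a / p. For the dual parameter the result reads a \<le> 1 - 2 p /
  r.\<close>

lemma a_nonneg: "a \<ge> 0"
proof (rule ccontr)
  assume "\<not> ?thesis"
  then have a: "a < 0" by simp
  have "real p * real p \<le> real r * real p" using p_less_r by (intro mult_right_mono) auto
  also have "\<dots> < real r * (real p - a)" using a r_pos by (intro mult_strict_left_mono) auto
  finally have "poly P (- (of_nat 0 + of_real a) / of_nat p) = 0"
    using p_pos by (intro P_root) auto
  then have "F (of_real (- a / real p)) = 0"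
    using F_first_order[of "of_real (- a / real p)"] by simp
  moreover have p0: "of_nat p * complex_of_real (- a / real p) + of_real a = 0"
    using p_pos by simp
  moreover have c: "of_nat r * complex_of_real (- a / real p) \<notin> \<int>\<^sub>\<le>\<^sub>0"
  proof -
    have "real r * (- a / real p) > 0"
      using a p_pos r_pos by (intro mult_pos_pos divide_pos_pos) auto
    then show ?thesis by (intro not_nonpos_IntsI) simp
  qed
  ultimately show False
    unfolding F_def p0 rhyp_0_left[OF c] by (simp add: rGamma_eq_zero_iff)
qed

text \<open>The chain r a \<le> r - 2 p < r - p \<le> (p - i) (r - p) is the inequality of
  \<open>P_root\<close> rearranged.\<close>

lemma P_roots:
  assumes "a \<le> 1 - 2 * real p / real r" "i < p"
  shows "poly P (- (of_nat i + of_real a) / of_nat p) = 0"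
proof (rule P_root[OF assms(2)])
  have ra: "real r * a \<le> real r - 2 * real p"
    using mult_left_mono[OF assms(1), of "real r"] r_pos by (simp add: right_diff_distrib)
  have "1 * (real r - real p) \<le> real (p - i) * (real r - real p)"
    using assms(2) p_less_r by (intro mult_right_mono) auto
  then have "real (p - i) * (real r - real p) > real r - 2 * real p" using p_pos by simp
  then show "real p * real (p - i) < real r * (real (p - i) - a)"
    using ra by (simp add: algebra_simps)
qed

end

section \<open>Reciprocity and duality\<close>

lemma linear_factors_dvd:
  fixes c :: "nat \<Rightarrow> complex" and q :: "complex poly"
  assumes "inj_on c {..<n}" "\<And>i. i < n \<Longrightarrow> poly q (- c i) = 0"
  shows "(\<Prod>i<n. [:c i, 1:]) dvd q"
  using assms
proof (induction n)
  case (Suc n)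
  have "inj_on c {..<n}" using Suc.prems(1) by (rule inj_on_subset) auto
  then have "(\<Prod>i<n. [:c i, 1:]) dvd q"
    using Suc by simp
  then obtain s where s: "q = (\<Prod>i<n. [:c i, 1:]) * s" by blast
  have "poly (\<Prod>i<n. [:c i, 1:]) (- c n) \<noteq> 0"
    using Suc.prems(1) by (auto simp: poly_prod inj_on_def)
  then have "poly s (- c n) = 0"
    using Suc.prems(2)[of n] by (simp add: s)
  then have "[:c n, 1:] dvd s" by (simp add: poly_eq_0_iff_dvd)
  then show ?case unfolding s prod.lessThan_Suc by (rule mult_dvd_mono[OF dvd_refl])
qed simp

context hypergeometric_line_first_order
begin

lemma P_factor:
  assumes "a \<le> 1 - 2 * real p / real r"
  shows "\<exists>u. P = smult (of_nat r ^ r) ((\<Prod>i<r - p. [:u i, 1:]) * (\<Prod>i<p. [:of_real ((real i + a) / real p), 1:]))"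
proof -
  define A :: "complex poly" where "A = (\<Prod>i<p. [:of_real ((real i + a) / real p), 1:])"
  have "A dvd P"
    unfolding A_def
  proof (rule linear_factors_dvd)
    show "inj_on (\<lambda>i. complex_of_real ((real i + a) / real p)) {..<p}"
      using p_pos by (intro inj_onI) (simp only: of_real_eq_iff, simp)
    show "poly P (- complex_of_real ((real i + a) / real p)) = 0" if "i < p" for i
      using P_roots[OF assms that] by (simp add: minus_divide_left)
  qed
  then obtain s where s: "P = A * s" by blast
  have A: "degree A = p" "lead_coeff A = 1"
    unfolding A_def by (rule degree_prod_linear, rule monic_prod_linear)
  have "P \<noteq> 0" using degree_P r_pos by auto
  then have "degree P = degree A + degree s" unfolding s by (intro degree_mult_eq) auto
  then have "degree s = r - p" using A degree_P by simp
  moreover have "lead_coeff s = of_nat r ^ r"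
    using lead_coeff_P A(2) unfolding s lead_coeff_mult by simp
  ultimately obtain u where "s = smult (of_nat r ^ r) (\<Prod>i<r - p. [:u i, 1:])"
    using complex_poly_linear_factors[of s "r - p"] by auto
  then show ?thesis
    unfolding s A_def by (intro exI[of _ u]) (simp only: mult_smult_right mult.commute)
qed

text \<open>The shift s = (1/2 - a) / (r - p) is the one for which the lower parameter \<gamma> -
  \<alpha> + 1/2 of the solution at 1, taken at w - s, becomes (r - p) w. As Q = 0, transport is a
  first-order recurrence; its scalar contains the p linear factors known to divide P, and after
  cancellation r - p factors remain on each side.\<close>

lemma recip_product:
  assumes u: "P = smult (of_nat r ^ r) ((\<Prod>i<r - p. [:u i, 1:]) * (\<Prod>i<p. [:of_real ((real i + a) / real p), 1:]))"
  shows "\<exists>C\<noteq>0. \<forall>w. of_nat (r - p) * w \<notin> \<int>\<^sub>\<le>\<^sub>0 \<longrightarrow>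
     hyp2F1 (- of_nat p * w + of_real ((real r * (1 - a) - real p / 2) / real (r - p))) (1/2) (of_nat (r - p) * w) (1 - x)
       * (\<Prod>i<r - p. rGamma (w + of_real (real i / real (r - p))))
     = C * (\<Prod>i<r - p. rGamma (w + (u i - of_real ((1/2 - a) / real (r - p)))))"
proof -
  define R where "R = r - p"
  have R: "R > 0" "real R = real r - real p" using p_less_r by (auto simp: R_def of_nat_diff)
  have Rc: "(of_nat R :: complex) = of_nat r - of_nat p" using p_less_r by (simp add: R_def of_nat_diff)
  define s where "s = (1/2 - a) / real R"
  define a' where "a' = (real r * (1 - a) - real p / 2) / real R"
  define g where "g w = hyp2F1 (- of_nat p * w + of_real a') (1/2) (of_nat R * w) (1 - x)" for w
  define G where "G w = rhyp (- of_nat p * w + of_real a') (1/2) (of_nat R * w) (of_real (1 - x))" for w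
  have z: "norm (of_real (1 - x) :: complex) < 1" "0 < 1 - x" "1 - x < 1"
    using x_pos x_less_1 unfolding norm_of_real by auto
  have Gg: "G w = rGamma (of_nat R * w) * g w" if "of_nat R * w \<notin> \<int>\<^sub>\<le>\<^sub>0" for w
    unfolding G_def g_def by (rule rhyp_eq_hyp2F1[OF that z(2,3)])
  define k where "k = - of_real x / (1 - of_real x :: complex)"
  have Rs: "real R * s = 1/2 - a" using R by (simp add: s_def)
  \<comment> \<open>In other words, \<open>a'\<close> is the upper parameter 1 - \<alpha> at the
    shifted origin.\<close>
  have a's: "a' - real p * s = 1 - a"
  proof -
    have "real R * a' = real r * (1 - a) - real p / 2" using R by (simp add: a'_def)
    then have "real R * (a' - real p * s) = real r * (1 - a) - real p / 2 - real p * (real R * s)"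
      by algebra
    also have "\<dots> = real R * (1 - a)" unfolding Rs by (simp add: R(2) algebra_simps)
    finally show ?thesis using R by simp
  qed
  have G_rec: "poly P (w - of_real s) * G (w + 1) =
      (\<Prod>i<p. of_real x * (of_nat p * (w - of_real s) + of_real a + of_nat i)) * k ^ R * G w" for w
  proof -
    have c1: "complex_of_real a' - of_nat p * of_real s = 1 - of_real a"
      using arg_cong[OF a's, of complex_of_real] by simp
    have c2: "of_nat R * complex_of_real s = 1/2 - of_real a"
      using arg_cong[OF Rs, of complex_of_real] by simp
    have 1: "1 - (of_nat p * (w - of_real s) + of_real a) = - of_nat p * w + of_real a'"
      using c1 by algebra
    have 2: "- of_nat p * w + of_real a' - of_nat p = - of_nat p * (w + 1) + of_real a'"
      by (simp add: algebra_simps)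
    have 3: "of_nat r * (w - of_real s) - (of_nat p * (w - of_real s) + of_real a) - 1/2 + 1 = of_nat R * w"
      using c2 unfolding Rc by algebra
    have 4: "of_nat R * w + of_nat R = of_nat R * (w + 1)"
      by (simp add: distrib_left)
    have 5: "1 - complex_of_real x = of_real (1 - x)" by simp
    have 6: "1 - 1/2 = (1/2 :: complex)" by simp
    have "norm (1 - complex_of_real x) < 1" using z(1) by simp
    from contig_row_recip[OF norm_x this, of "1/2" "of_nat p * (w - of_real s) + of_real a" "of_nat r * (w - of_real s)" p "r - p"]
    show ?thesis
      unfolding contig_row_eq Q0 1 3 6
      unfolding R_def[symmetric] 2 4 G_def k_def 5[symmetric] by simp
  qed
  obtain L where L: "L \<noteq> 0" "((\<lambda>t::real. g (of_real t)) \<longlongrightarrow> L) at_top"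
  proof -
    obtain L where "L \<noteq> 0" "((\<lambda>w. hyp2F1 (of_real (- real p * w + a')) (1/2) (of_real (real R * w)) (1 - x)) \<longlongrightarrow> of_real L) at_top"
      using hyp2F1_limit_at_top[OF z(2,3), of "real R" "- real p" a'] R by auto
    then show ?thesis using that[of "of_real L"] by (simp add: g_def)
  qed
  define c :: complex where "c = of_real x ^ p * of_nat p ^ p * k ^ R * of_nat R ^ R"
  \<comment> \<open>By the recurrence lemma this ratio equals 1. As \<open>c\<close> contains the
    factor (- x / (1 - x))^(r - p), its sign shows that r - p is even.\<close>
  define \<kappa> where "\<kappa> = of_nat r ^ r / c"
  have c: "c \<noteq> 0"
    using x_pos x_less_1 p_pos R by (auto simp: c_def k_def)
  have nonpos: "\<forall>\<^sub>F t::real in at_top. of_nat R * (of_real t :: complex) \<notin> \<int>\<^sub>\<le>\<^sub>0"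
    using eventually_gt_at_top[of 0]
    by eventually_elim (use R in \<open>auto intro!: not_nonpos_IntsI\<close>)
  have rec: "\<forall>\<^sub>F t::real in at_top. g (of_real t) * (\<Prod>i<R. of_real t + of_real (real i / real R))
      = \<kappa> * (\<Prod>i<R. of_real t + (u i - of_real s)) * g (of_real t + 1)"
    using nonpos eventually_shift_at_top[OF nonpos] eventually_gt_at_top[of "s + \<bar>a\<bar> / real p"]
  proof eventually_elim
    case (elim t)
    let ?w = "of_real t :: complex"
    define A where "A = (\<Prod>i<p. ?w - of_real s + of_real ((real i + a) / real p))"
    have "A \<noteq> 0"
    proof -
      have "t - s + (real i + a) / real p > 0" for i
      proof -
        have "- \<bar>a\<bar> / real p \<le> (real i + a) / real p" by (intro divide_right_mono) auto
        then show ?thesis using elim(3) by simp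
      qed
      then have "of_real (t - s + (real i + a) / real p) \<noteq> (0::complex)" for i
        by (metis less_irrefl of_real_eq_0_iff)
      then show ?thesis by (simp add: A_def)
    qed
    have P: "poly P (?w - of_real s) = of_nat r ^ r * (\<Prod>i<R. ?w + (u i - of_real s)) * A"
      unfolding u R_def A_def by (simp add: poly_prod algebra_simps)
    have pA: "(\<Prod>i<p. of_real x * (of_nat p * (?w - of_real s) + of_real a + of_nat i)) = of_real x ^ p * of_nat p ^ p * A"
    proof -
      have "of_real x * (of_nat p * (?w - of_real s) + of_real a + of_nat i)
          = of_real x * of_nat p * (?w - of_real s + of_real ((real i + a) / real p))" for i
        using p_pos by (simp add: field_simps)
      then show ?thesis
        by (simp only: A_def prod.distrib prod_constant card_lessThan power_mult_distrib)
    qed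
    have r: "rGamma (of_nat R * ?w) = of_nat R ^ R * (\<Prod>i<R. ?w + of_real (real i / real R)) * rGamma (of_nat R * (?w + 1))"
      by (rule rGamma_multiple_shift[OF R(1)])
    have nz: "rGamma (of_nat R * (?w + 1)) \<noteq> 0" using elim(2) by (simp add: rGamma_eq_zero_iff)
    have "(A * rGamma (of_nat R * (?w + 1))) * (of_nat r ^ r * (\<Prod>i<R. ?w + (u i - of_real s)) * g (?w + 1))
      = (A * rGamma (of_nat R * (?w + 1))) * (c * (g ?w * (\<Prod>i<R. ?w + of_real (real i / real R))))"
      using G_rec[of ?w] unfolding P pA Gg[OF elim(1)] Gg[OF elim(2)] r c_def by (simp only: mult_ac)
    then have "of_nat r ^ r * (\<Prod>i<R. ?w + (u i - of_real s)) * g (?w + 1)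
      = c * (g ?w * (\<Prod>i<R. ?w + of_real (real i / real R)))"
      using \<open>A \<noteq> 0\<close> nz by (simp only: mult_left_cancel mult_eq_0_iff de_Morgan_disj simp_thms)
    then have "c * (g ?w * (\<Prod>i<R. ?w + of_real (real i / real R))) = c * (\<kappa> * (\<Prod>i<R. ?w + (u i - of_real s)) * g (?w + 1))"
      using c by (simp add: \<kappa>_def)
    then show ?case by (simp only: mult_left_cancel[OF c])
  qed
  note prod = gamma_product_of_recurrence(3)[OF L(2,1) rec]
  have eq: "G w * (\<Prod>i<R. rGamma (w + of_real (real i / real R))) = L * rGamma (of_nat R * w) * (\<Prod>i<R. rGamma (w + (u i - of_real s)))" for w
  proof (rule entire_eqI_at_top[where f = "\<lambda>w. G w * (\<Prod>i<R. rGamma (w + of_real (real i / real R)))"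
        and g = "\<lambda>w. L * rGamma (of_nat R * w) * (\<Prod>i<R. rGamma (w + (u i - of_real s)))"])
    have "G holomorphic_on UNIV"
      unfolding G_def by (intro holomorphic_rhyp z holomorphic_intros)
    then show "(\<lambda>w. G w * (\<Prod>i<R. rGamma (w + of_real (real i / real R)))) holomorphic_on UNIV"
      by (intro holomorphic_intros)
    show "(\<lambda>w. L * rGamma (of_nat R * w) * (\<Prod>i<R. rGamma (w + (u i - of_real s)))) holomorphic_on UNIV"
      by (intro holomorphic_intros)
    show "\<forall>\<^sub>F t::real in at_top. G (of_real t) * (\<Prod>i<R. rGamma (of_real t + of_real (real i / real R)))
       = L * rGamma (of_nat R * of_real t) * (\<Prod>i<R. rGamma (of_real t + (u i - of_real s)))"
      using prod nonpos by eventually_elim (simp add: Gg mult_ac)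
  qed
  have "g w * (\<Prod>i<R. rGamma (w + of_real (real i / real R))) = L * (\<Prod>i<R. rGamma (w + (u i - of_real s)))"
    if "of_nat R * w \<notin> \<int>\<^sub>\<le>\<^sub>0" for w
  proof -
    have "rGamma (of_nat R * w) * (g w * (\<Prod>i<R. rGamma (w + of_real (real i / real R)))) = rGamma (of_nat R * w) * (L * (\<Prod>i<R. rGamma (w + (u i - of_real s))))"
      using eq[of w] Gg[OF that] by (simp add: mult_ac)
    then show ?thesis using that by (simp add: rGamma_eq_zero_iff)
  qed
  then show ?thesis
    using L(1) unfolding g_def s_def a'_def R_def by blast
qed

text \<open>Under the reflection w to 2 / r - 1 - w the second solution at 0 for the dual parameter
  is F itself, transported between F(w + 1) and F(w). Eliminating F(w + 1) by the recurrence of F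
  leaves a polynomial relation between F and T at w, so independence for the original parameter
  gives both conclusions.\<close>

lemma dual_first_order:
  fixes a' :: real
  defines "a' \<equiv> 1 - 2 * real p / real r - a"
  assumes inf: "infinite {k::nat. F (- of_nat k / of_nat r) \<noteq> 0}"
  shows "hypergeometric_line.Q p r a' x = 0"
    and "\<exists>\<kappa>. smult \<kappa> ((\<Prod>i<p. [:of_real ((real i + a) / real p), 1:]) * (\<Prod>j<r - p. [:of_real ((real j - a) / real (r - p)), 1:])
             * (\<Prod>j<r. [:of_real ((real j - 1/2) / real r), 1:]))
           = P * pcompose (hypergeometric_line.P p r a' x) [:2 / of_nat r - 1, -1:]"
proof -
  interpret d: hypergeometric_line p r a' x
    using p_pos p_less_r x_pos x_less_1 by unfold_locales
  define k where "k = of_real x / (1 - of_real x :: complex)"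
  define W where "W w = 2 / of_nat r - 1 - w" for w :: complex
  have rW: "of_nat r * W w = 2 - of_nat r - of_nat r * w" for w
    using r_pos by (simp add: W_def right_diff_distrib)
  have pW: "of_nat p * W w + of_real a' = 1 - of_nat p - (of_nat p * w + of_real a)" for w
  proof -
    have "complex_of_real a' = 1 - 2 * of_nat p / of_nat r - of_real a" by (simp add: a'_def)
    then show ?thesis by (simp add: W_def algebra_simps)
  qed
  define \<tau> where "\<tau> = [:- 1 - (1/2 + of_real a) * k, of_nat r + of_nat (r - p) * k:]"
  define \<kappa> where "\<kappa> = (- of_real x) ^ p * k ^ (r - p) * (- of_nat p) ^ p * (- of_nat (r - p)) ^ (r - p) * (- of_nat r) ^ r"
  define K where "K = (\<Prod>i<p. [:of_real ((real i + a) / real p), 1:]) * (\<Prod>j<r - p. [:of_real ((real j - a) / real (r - p)), 1:])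
             * (\<Prod>j<r. [:complex_of_real ((real j - 1/2) / real r), 1:])"
  define P' where "P' = pcompose d.P [:2 / of_nat r - 1, -1:]"
  define Q' where "Q' = pcompose d.Q [:2 / of_nat r - 1, -1:]"
  have P'W: "poly P' w = poly d.P (W w)" and Q'W: "poly Q' w = poly d.Q (W w)" for w
    by (simp_all add: P'_def Q'_def W_def poly_pcompose)
  \<comment> \<open>The index is reversed, i to n - 1 - i, so that the ascending product in - n w
    splits into the linear factors of the formula.\<close>
  have factor: "(\<Prod>i<n. c - of_nat n + 1 + of_nat i - of_nat n * w) = (- of_nat n) ^ n * (\<Prod>i<n. w + of_real ((real i - c') / real n))"
    if "n > 0" "c = of_real c'" for n c c' and w :: complex
  proof -
    have "(\<Prod>i<n. c - of_nat n + 1 + of_nat i - of_nat n * w) = (\<Prod>i<n. - of_nat n * (w + of_real ((real (n - Suc i) - c') / real n)))"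
      using that by (intro prod.cong) (auto simp: field_simps of_nat_diff)
    also have "\<dots> = (- of_nat n) ^ n * (\<Prod>i<n. w + of_real ((real i - c') / real n))"
      unfolding prod.distrib prod_constant card_lessThan
      by (subst prod.nat_diff_reindex[of "\<lambda>i. w + of_real ((real i - c') / real n)" n]) (rule refl)
    finally show ?thesis .
  qed
  have K_eq: "(\<Prod>i<p. - of_real x * (of_nat p * W w + of_real a' + of_nat i) * (of_nat r * W w + of_nat i - 1/2)) *
         (\<Prod>j<r - p. k * (of_nat r * W w + of_nat j - (of_nat p * W w + of_real a')) * (of_nat r * W w + of_nat p + of_nat j - 1/2))
       = \<kappa> * poly K w" for w
  proof -
    have 1: "(\<Prod>i<p. of_nat p * W w + of_real a' + of_nat i) = (- of_nat p) ^ p * (\<Prod>i<p. w + of_real ((real i + a) / real p))"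
      using factor[OF p_pos, of "- of_real a" "- a" w] unfolding pW by (simp add: algebra_simps)
    have 2: "(\<Prod>j<r - p. of_nat r * W w + of_nat j - (of_nat p * W w + of_real a')) = (- of_nat (r - p)) ^ (r - p) * (\<Prod>j<r - p. w + of_real ((real j - a) / real (r - p)))"
      using factor[of "r - p" "of_real a" a w] p_less_r unfolding pW rW by (simp add: algebra_simps of_nat_diff)
    have 3: "(\<Prod>j<r. of_nat r * W w + of_nat j - 1/2) = (- of_nat r) ^ r * (\<Prod>j<r. w + of_real ((real j - 1/2) / real r))"
      using factor[OF r_pos, of "1/2" "1/2" w] unfolding rW by (simp add: algebra_simps)
    \<comment> \<open>Joint steps contribute the factors with j < p and single steps those with p
      \<le> j < r; together they form the third product of the formula.\<close>
    have 4: "(\<Prod>j<r. of_nat r * W w + of_nat j - 1/2) = (\<Prod>i<p. of_nat r * W w + of_nat i - 1/2) * (\<Prod>j<r - p. of_nat r * W w + of_nat p + of_nat j - 1/2)"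
      using prod_lessThan_split[of p r "\<lambda>j. of_nat r * W w + of_nat j - 1/2"] p_less_r by (simp add: add.assoc)
    have "(\<Prod>i<p. - of_real x * (of_nat p * W w + of_real a' + of_nat i) * (of_nat r * W w + of_nat i - 1/2)) *
         (\<Prod>j<r - p. k * (of_nat r * W w + of_nat j - (of_nat p * W w + of_real a')) * (of_nat r * W w + of_nat p + of_nat j - 1/2))
       = (- of_real x) ^ p * k ^ (r - p) * (\<Prod>i<p. of_nat p * W w + of_real a' + of_nat i)
         * (\<Prod>j<r - p. of_nat r * W w + of_nat j - (of_nat p * W w + of_real a')) * (\<Prod>j<r. of_nat r * W w + of_nat j - 1/2)"
      unfolding 4 by (simp only: prod.distrib prod_constant card_lessThan mult_ac)
    also have "\<dots> = \<kappa> * poly K w"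
      unfolding 1 2 3 \<kappa>_def K_def by (simp add: poly_prod add.commute mult_ac)
    finally show ?thesis .
  qed
  have transport: "poly P' w * F w + poly Q' w * (poly \<tau> w * F w + T w) = \<kappa> * poly K w * F (w + 1)" for w
  proof -
    have 1: "1 - (of_nat p * W w + of_real a') - of_nat p = of_nat p * w + of_real a" unfolding pW by simp
    have 2: "2 - of_nat r * W w - of_nat p - of_nat (r - p) = of_nat r * w"
      unfolding rW by (simp only: of_nat_r[symmetric]) (simp add: algebra_simps)
    have 3: "1 - (of_nat p * W w + of_real a') = of_nat p * (w + 1) + of_real a" unfolding pW by (simp add: algebra_simps)
    have 4: "2 - of_nat r * W w = of_nat r * (w + 1)" unfolding rW by (simp add: algebra_simps)
    have 5: "1 - 1/2 = (1/2 :: complex)" by simp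
    have 6: "dual_tau (1/2) (of_real x) (of_nat p * W w + of_real a' + of_nat p) (of_nat r * W w + of_nat p + of_nat (r - p)) = poly \<tau> w"
      unfolding dual_tau_def pW rW k_def[symmetric] \<tau>_def add.assoc of_nat_r using p_less_r
      by (simp add: algebra_simps of_nat_diff)
    show ?thesis
      using contig_row_dual[OF norm_x, of "1/2" "of_nat p * W w + of_real a'" "of_nat r * W w" p "r - p"]
      unfolding d.contig_row_eq 1 2 5 6 k_def[symmetric] K_eq
      unfolding 3 4 fst_conv snd_conv F_def[symmetric] T_def[symmetric] P'W Q'W .
  qed
  define L where "L = P * P' + P * Q' * \<tau> - smult \<kappa> K"
  define N where "N = - (P * Q')"
  \<comment> \<open>After multiplication by P(w) the right side contains P(w) F(w + 1), which is
    F(w).\<close>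
  have LN: "poly L w * F w = poly N w * T w" for w
  proof -
    have "poly P w * (poly P' w * F w + poly Q' w * (poly \<tau> w * F w + T w)) = \<kappa> * poly K w * (poly P w * F (w + 1))"
      unfolding transport by (simp only: mult_ac)
    then show ?thesis
      unfolding F_first_order[of w, symmetric] by (simp add: L_def N_def algebra_simps)
  qed
  have P0: "P \<noteq> 0" using degree_P r_pos by auto
  from T_F_independent[OF inf LN] have "Q' = 0" using P0 by (simp add: N_def)
  then show dQ: "d.Q = 0" unfolding Q'_def by (rule pcompose_eq_0) simp
  have "L = 0"
  proof (rule ccontr)
    assume "L \<noteq> 0"
    \<comment> \<open>With 0 as the dominated polynomial the growth lemma says just that L has no
      zeros near infinity.\<close>
    then have "\<exists>B'. \<forall>\<^sub>F w in at_infinity. norm (poly 0 w) \<le> B' * norm (poly L w) \<and> poly L w \<noteq> 0"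
      by (rule poly_dominated_at_infinity[where B = 0]) simp
    then have "\<forall>\<^sub>F w in at_infinity. poly L w \<noteq> 0" by (auto elim: eventually_mono)
    from eventually_compose_filterlim[OF this tendsto_of_nat]
    have "\<forall>\<^sub>F n in sequentially. poly L (of_nat n) \<noteq> 0" .
    moreover obtain B where "\<forall>\<^sub>F n in sequentially. F (of_nat n) \<noteq> 0 \<and> norm (T (of_nat n)) \<le> B * norm (F (of_nat n))"
      using T_le_F by blast
    ultimately have "\<forall>\<^sub>F n::nat in sequentially. False"
    proof eventually_elim
      case (elim n)
      have "poly L (of_nat n) * F (of_nat n) = 0"
        unfolding LN by (simp add: N_def \<open>Q' = 0\<close>)
      then show ?case using elim by simp
    qed
    then show False by simp
  qed
  then have "smult \<kappa> K = P * P'" by (simp add: L_def \<open>Q' = 0\<close>)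
  then show "\<exists>\<kappa>. smult \<kappa> ((\<Prod>i<p. [:of_real ((real i + a) / real p), 1:]) * (\<Prod>j<r - p. [:of_real ((real j - a) / real (r - p)), 1:])
             * (\<Prod>j<r. [:of_real ((real j - 1/2) / real r), 1:]))
           = P * pcompose d.P [:2 / of_nat r - 1, -1:]"
    unfolding K_def P'_def by blast
qed

end

lemma smult_eq_smult_monic:
  fixes A B :: "'a :: idom poly"
  assumes "smult c A = smult d B" "lead_coeff A = 1" "lead_coeff B = 1" "c \<noteq> 0"
  shows "A = B"
proof -
  have "c = d" using assms(2,3) arg_cong[OF assms(1), of lead_coeff] by (simp only: lead_coeff_smult) simp
  then show ?thesis using assms(1,4) smult_cancel by blast
qed

section \<open>Ordering of the numbers v_i and their dual counterparts\<close>

theorem theorem2p2: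
  fixes p r :: nat and a x :: real
  defines "lam \<equiv> (real p, 0, real r, a, 1/2, x)"
  assumes inI: "in_I lam"
    and sol: "solution_I lam"
    and nonel: "\<not> elementary lam"
  shows "\<exists>(v::nat \<Rightarrow> complex) (vs::nat \<Rightarrow> complex) (C::complex) (C'::complex).
     C \<noteq> 0 \<and> C' \<noteq> 0 \<and>
     (\<forall>w::complex. (\<Prod>i=1..r. w + v i) * (\<Prod>i=1..r. w + vs i) =
        (\<Prod>i<p. w + of_real ((real i + a) / real p)) *
        (\<Prod>j<r - p. w + of_real ((real j - a) / real (r - p))) *
        (\<Prod>j<r. w + of_real ((real j - 1/2) / real r))) \<and>
     (\<forall>w. w \<notin> bad_pts lam \<longrightarrow>
        fF lam w * (\<Prod>i<r. rGamma (w + of_real (real i / real r)))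
          = C * (\<Prod>i=1..r. rGamma (w + v i))) \<and>
     (\<forall>w. w \<notin> bad_pts (dual lam) \<longrightarrow>
        fF (dual lam) w * (\<Prod>i<r. rGamma (w + of_real (real i / real r)))
          = C' * (\<Prod>i=1..r. rGamma (w + (1 - 2 / of_nat r - vs i)))) \<and>
     (\<Sum>i=1..r. v i) = (of_nat r - 1) / 2 \<and>
     (\<Sum>i=1..r. 1 - 2 / of_nat r - vs i) = (of_nat r - 1) / 2 \<and>
     (\<Prod>i<p. [: of_real ((real i + a) / real p), 1 :]) dvd (\<Prod>i=1..r. [: v i, 1 :]) \<and>
     (\<exists>\<sigma>. \<sigma> permutes {1..r} \<and>
        (\<forall>w. (\<Prod>i<p. w + of_real ((real i + a) / real p)) = (\<Prod>i=r-p+1..r. w + v (\<sigma> i)))) \<and>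
     (\<forall>\<sigma>. \<sigma> permutes {1..r} \<and>
        (\<forall>w. (\<Prod>i<p. w + of_real ((real i + a) / real p)) = (\<Prod>i=r-p+1..r. w + v (\<sigma> i))) \<longrightarrow>
        solution_I (recip lam) \<and>
        (\<exists>Cc::complex. Cc \<noteq> 0 \<and>
          (\<forall>w. w \<notin> bad_pts (recip lam) \<longrightarrow>
             fF (recip lam) w * (\<Prod>i<r - p. rGamma (w + of_real (real i / real (r - p))))
               = Cc * (\<Prod>i=1..r-p. rGamma (w + (v (\<sigma> i) - of_real ((1/2 - a) / real (r - p))))))))"
proof -
  interpret hypergeometric_line p r a x
    using inI by unfold_locales (auto simp: in_I_def lam_def)
  have fF: "fF lam = f"
    by (auto simp: fF_def lam_def f_def fun_eq_iff)
  have bad: "w \<notin> bad_pts lam \<longleftrightarrow> of_nat r * w \<notin> \<int>\<^sub>\<le>\<^sub>0" for w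
    by (simp add: bad_pts_def lam_def)
  have inf: "infinite {k::nat. F (- of_nat k / of_nat r) \<noteq> 0}"
    using nonel by (intro infinite_F_nonzero) (simp add: elementary_def fF)
  have "Q = 0"
    using sol Q_eq_0[OF inf] unfolding solution_I_def fF bad by blast
  then interpret hypergeometric_line_first_order p r a x by unfold_locales
  define a' where "a' = 1 - 2 * real p / real r - a"
  interpret d: hypergeometric_line p r a' x
    using p_pos p_less_r x_pos x_less_1 by unfold_locales
  interpret d: hypergeometric_line_first_order p r a' x
    using dual_first_order(1)[OF inf] by unfold_locales (simp add: a'_def)
  have dual: "dual lam = (real p, 0, real r, a', 1/2, x)"
    by (simp add: dual_def lam_def a'_def)
  have fFd: "fF (dual lam) = d.f"
    unfolding dual by (auto simp: fF_def d.f_def fun_eq_iff)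
  have badd: "w \<notin> bad_pts (dual lam) \<longleftrightarrow> of_nat r * w \<notin> \<int>\<^sub>\<le>\<^sub>0" for w
    by (simp add: bad_pts_def lam_def dual_def)
  \<comment> \<open>Nonnegativity of the dual \<open>a'\<close> is the upper bound on
    \<open>a\<close> under which all p roots are available.\<close>
  have "a \<le> 1 - 2 * real p / real r" using d.a_nonneg by (simp add: a'_def)
  from P_factor[OF this] obtain u where
    u: "P = smult (of_nat r ^ r) ((\<Prod>i<r - p. [:u i, 1:]) * (\<Prod>i<p. [:of_real ((real i + a) / real p), 1:]))" by blast
  \<comment> \<open>The cofactor comes first and the p known numbers last, so the identity
    permutation is already a valid ordering. Indices count from 1 here and from 0 in
    \<open>u\<close>.\<close>
  define v where "v i = (if i \<le> r - p then u (i - 1) else of_real ((real (i - (r - p) - 1) + a) / real p))" for i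
  have split: "(\<Prod>i=1..r. g i) = (\<Prod>i<r - p. g (Suc i)) * (\<Prod>i=r-p+1..r. g i)" for g :: "nat \<Rightarrow> 'b :: comm_monoid_mult"
  proof -
    have "{1..r} = {1..r - p} \<union> {r - p + 1..r}" using p_less_r by auto
    moreover have "(\<Prod>i\<in>{1..r - p} \<union> {r - p + 1..r}. g i) = (\<Prod>i=1..r - p. g i) * (\<Prod>i=r-p+1..r. g i)"
      by (intro prod.union_disjoint) auto
    ultimately show ?thesis by (simp add: prod.atLeast1_atMost_eq)
  qed
  have last: "(\<Prod>i=r-p+1..r. g i) = (\<Prod>i<p. g (r - p + 1 + i))" for g :: "nat \<Rightarrow> 'b :: comm_monoid_mult"
    using p_less_r by (intro prod.reindex_bij_witness[of _ "\<lambda>i. r - p + 1 + i" "\<lambda>i. i - (r - p + 1)"]) auto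
  have v_last: "(\<Prod>i=r-p+1..r. h (v i)) = (\<Prod>i<p. h (of_real ((real i + a) / real p)))" for h :: "complex \<Rightarrow> 'b :: comm_monoid_mult"
    unfolding last by (simp add: v_def)
  have P_v: "P = smult (of_nat r ^ r) (\<Prod>i=1..r. [:v i, 1:])"
    unfolding u split v_last[of "\<lambda>c. [:c, 1:]"] by (simp add: v_def)
  have P_v': "P = smult (of_nat r ^ r) (\<Prod>i<r. [:v (Suc i), 1:])"
    using P_v by (simp add: prod.atLeast1_atMost_eq)
  obtain v' where v': "d.P = smult (of_nat r ^ r) (\<Prod>i<r. [:v' i, 1:])"
    using complex_poly_linear_factors[OF d.degree_P] d.lead_coeff_P by auto
  \<comment> \<open>Chosen so that 1 - 2 / r - \<open>vs i\<close> returns the numbers of the dual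
    parameter.\<close>
  define vs where "vs i = 1 - 2 / of_nat r - v' (i - 1)" for i
  have vs: "1 - 2 / of_nat r - vs (Suc i) = v' i" for i by (simp add: vs_def)
  obtain C where C: "C \<noteq> 0" "\<And>w. of_nat r * w \<notin> \<int>\<^sub>\<le>\<^sub>0 \<Longrightarrow>
      f w * (\<Prod>i<r. rGamma (w + of_real (real i / real r))) = C * (\<Prod>i<r. rGamma (w + v (Suc i)))"
    using gamma_product(2)[OF P_v'] by blast
  obtain C' where C': "C' \<noteq> 0" "\<And>w. of_nat r * w \<notin> \<int>\<^sub>\<le>\<^sub>0 \<Longrightarrow>
      d.f w * (\<Prod>i<r. rGamma (w + of_real (real i / real r))) = C' * (\<Prod>i<r. rGamma (w + v' i))"
    using d.gamma_product(2)[OF v'] by blast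
  have r0: "of_nat r \<noteq> (0::complex)" using r_pos by simp
  have factorization: "(\<Prod>i<r. [:v (Suc i), 1:]) * (\<Prod>i<r. [:vs (Suc i), 1:])
      = (\<Prod>i<p. [:of_real ((real i + a) / real p), 1:]) * (\<Prod>j<r - p. [:of_real ((real j - a) / real (r - p)), 1:])
             * (\<Prod>j<r. [:of_real ((real j - 1/2) / real r), 1:])"
    (is "?A = ?B")
  proof -
    obtain \<kappa> where \<kappa>: "smult \<kappa> ?B = P * pcompose d.P [:2 / of_nat r - 1, -1:]"
      using dual_first_order(2)[OF inf] unfolding a'_def[symmetric] by blast
    \<comment> \<open>The reflection sends w + \<open>v' i\<close> to - (w +
      \<open>vs (Suc i)\<close>); the r signs are collected in (-1)^r.\<close>
    have "pcompose [:v' i, 1:] [:2 / of_nat r - 1, -1:] = smult (-1) [:vs (Suc i), 1:]" for i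
      by (simp add: vs_def pcompose_pCons)
    then have "pcompose d.P [:2 / of_nat r - 1, -1:] = smult (of_nat r ^ r * (-1) ^ r) (\<Prod>i<r. [:vs (Suc i), 1:])"
      unfolding v' pcompose_smult pcompose_prod by (simp add: prod_smult del: smult_minus_left smult_pCons)
    then have "smult (of_nat r ^ r * (of_nat r ^ r * (-1) ^ r)) ?A = smult \<kappa> ?B"
      unfolding \<kappa> by (subst P_v') (simp add: mult_ac)
    \<comment> \<open>Both products are monic, so leading coefficients fix the unspecified
      \<kappa>.\<close>
    then show ?thesis
      by (rule smult_eq_smult_monic) (use r0 in \<open>simp_all add: lead_coeff_mult monic_prod_linear\<close>)
  qed
  have recip: "solution_I (recip lam) \<and>
        (\<exists>Cc::complex. Cc \<noteq> 0 \<and>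
          (\<forall>w. w \<notin> bad_pts (recip lam) \<longrightarrow>
             fF (recip lam) w * (\<Prod>i<r - p. rGamma (w + of_real (real i / real (r - p))))
               = Cc * (\<Prod>i=1..r-p. rGamma (w + (v (\<sigma> i) - of_real ((1/2 - a) / real (r - p)))))))"
    if \<sigma>: "\<sigma> permutes {1..r}"
      "\<forall>w. (\<Prod>i<p. w + of_real ((real i + a) / real p)) = (\<Prod>i=r-p+1..r. w + v (\<sigma> i))" for \<sigma>
  proof -
    have e1: "(\<Prod>i<p. [:complex_of_real ((real i + a) / real p), 1:]) = (\<Prod>i=r-p+1..r. [:v (\<sigma> i), 1:])"
      by (rule poly_ext) (use \<sigma>(2) in \<open>simp add: poly_prod add.commute\<close>)
    have e2: "(\<Prod>i=1..r. [:v (\<sigma> i), 1:]) = (\<Prod>i=1..r. [:v i, 1:])"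
      using prod.permute[OF \<sigma>(1), of "\<lambda>i. [:v i, 1:]"] by (simp add: comp_def)
    \<comment> \<open>For any admissible \<open>\<sigma>\<close> the first r - p numbers again make
      up the cofactor, so they can play the role of \<open>u\<close> in the reciprocity
      lemma.\<close>
    have "P = smult (of_nat r ^ r) ((\<Prod>i<r - p. [:v (\<sigma> (Suc i)), 1:]) * (\<Prod>i<p. [:of_real ((real i + a) / real p), 1:]))"
      unfolding P_v e2[symmetric] split[of "\<lambda>i. [:v (\<sigma> i), 1:]"] e1 by (rule refl)
    from recip_product[OF this] obtain c where c: "c \<noteq> 0" "\<And>w. of_nat (r - p) * w \<notin> \<int>\<^sub>\<le>\<^sub>0 \<Longrightarrow>
       hyp2F1 (- of_nat p * w + of_real ((real r * (1 - a) - real p / 2) / real (r - p))) (1/2) (of_nat (r - p) * w) (1 - x)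
         * (\<Prod>i<r - p. rGamma (w + of_real (real i / real (r - p))))
       = c * (\<Prod>i<r - p. rGamma (w + (v (\<sigma> (Suc i)) - of_real ((1/2 - a) / real (r - p)))))" by blast
    have rp: "of_nat (r - p) = (of_nat r - of_nat p :: 'b :: ring_1)" using p_less_r by (simp add: of_nat_diff)
    have fFr: "fF (recip lam) w = hyp2F1 (- of_nat p * w + of_real ((real r * (1 - a) - real p / 2) / real (r - p))) (1/2) (of_nat (r - p) * w) (1 - x)" for w
      by (simp add: fF_def lam_def recip_def rp)
    have badr: "w \<notin> bad_pts (recip lam) \<longleftrightarrow> of_nat (r - p) * w \<notin> \<int>\<^sub>\<le>\<^sub>0" for w
      by (simp add: bad_pts_def lam_def recip_def rp)
    have list: "(\<Prod>y\<leftarrow>map g [0..<n]. h y) = (\<Prod>i<n. h (g i))" for g and h :: "complex \<Rightarrow> complex" and n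
      by (induction n) auto
    have formula: "fF (recip lam) w * (\<Prod>i<r - p. rGamma (w + of_real (real i / real (r - p))))
       = c * (\<Prod>i<r - p. rGamma (w + (v (\<sigma> (Suc i)) - of_real ((1/2 - a) / real (r - p)))))"
      if "w \<notin> bad_pts (recip lam)" for w
      using c(2) that unfolding fFr badr by blast
    have "solution_I (recip lam)"
      unfolding solution_I_def
    \<comment> \<open>The witnesses are read off from the two facts shown below; the exponential is
      trivial, with \<delta> = 0.\<close>
    proof (intro exI conjI allI impI)
      show "c \<noteq> 0" by (rule c(1))
      show "fF (recip lam) w * (\<Prod>y\<leftarrow>map (\<lambda>i. of_real (real i / real (r - p))) [0..<r - p]. rGamma (w + y))
         = c * exp (w * 0) * (\<Prod>y\<leftarrow>map (\<lambda>i. v (\<sigma> (Suc i)) - of_real ((1/2 - a) / real (r - p))) [0..<r - p]. rGamma (w + y))"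
        if "w \<notin> bad_pts (recip lam)" for w
        unfolding list using formula[OF that] by simp
    qed
    then show ?thesis
      using c(1) formula by (auto simp: prod.atLeast1_atMost_eq)
  qed
  show ?thesis
  proof (rule exI[of _ v], rule exI[of _ vs], rule exI[of _ C], rule exI[of _ C'], intro conjI)
    show "C \<noteq> 0" "C' \<noteq> 0" by (rule C(1), rule C'(1))
    show "\<forall>w. (\<Prod>i=1..r. w + v i) * (\<Prod>i=1..r. w + vs i) =
        (\<Prod>i<p. w + of_real ((real i + a) / real p)) *
        (\<Prod>j<r - p. w + of_real ((real j - a) / real (r - p))) *
        (\<Prod>j<r. w + of_real ((real j - 1/2) / real r))"
    proof
      fix w
      show "(\<Prod>i=1..r. w + v i) * (\<Prod>i=1..r. w + vs i) =
        (\<Prod>i<p. w + of_real ((real i + a) / real p)) *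
        (\<Prod>j<r - p. w + of_real ((real j - a) / real (r - p))) *
        (\<Prod>j<r. w + of_real ((real j - 1/2) / real r))"
      using arg_cong[OF factorization, of "\<lambda>q. poly q w"]
      by (simp only: One_nat_def prod.atLeast1_atMost_eq poly_mult poly_prod poly_pCons poly_0 mult_zero_right add_0_right mult_1_right add.commute[of w])
    qed
    show "\<forall>w. w \<notin> bad_pts lam \<longrightarrow>
        fF lam w * (\<Prod>i<r. rGamma (w + of_real (real i / real r))) = C * (\<Prod>i=1..r. rGamma (w + v i))"
      using C(2) unfolding fF bad One_nat_def prod.atLeast1_atMost_eq by blast
    show "\<forall>w. w \<notin> bad_pts (dual lam) \<longrightarrow>
        fF (dual lam) w * (\<Prod>i<r. rGamma (w + of_real (real i / real r))) = C' * (\<Prod>i=1..r. rGamma (w + (1 - 2 / of_nat r - vs i)))"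
      using C'(2) unfolding fFd badd One_nat_def prod.atLeast1_atMost_eq vs by blast
    show "(\<Sum>i=1..r. v i) = (of_nat r - 1) / 2"
      using gamma_product(1)[OF P_v'] by (simp add: sum.atLeast1_atMost_eq)
    show "(\<Sum>i=1..r. 1 - 2 / of_nat r - vs i) = (of_nat r - 1) / 2"
      unfolding One_nat_def sum.atLeast1_atMost_eq vs using d.gamma_product(1)[OF v'] .
    show "(\<Prod>i<p. [:complex_of_real ((real i + a) / real p), 1:]) dvd (\<Prod>i=1..r. [:v i, 1:])"
      unfolding split v_last[of "\<lambda>c. [:c, 1:]"] by simp
    show "\<exists>\<sigma>. \<sigma> permutes {1..r} \<and>
        (\<forall>w. (\<Prod>i<p. w + of_real ((real i + a) / real p)) = (\<Prod>i=r-p+1..r. w + v (\<sigma> i)))"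
      unfolding v_last[of "\<lambda>c. w + c" for w, symmetric]
      by (rule exI[of _ id]) (simp add: permutes_id)
  qed (intro allI impI, elim conjE, rule recip, assumption+)
qed

end
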